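(* Let $X=X_1\times X_2\times\cdots\times X_r$ be a product of locally compact Hadamard spaces and let $\Gamma<\mathrm{Is}(X_1)\times\cdots\times\mathrm{Is}(X_r)$ be a group which acts properly discontinuously on $X$ and contains two independent regular axial isometries. Then for every open cone $\mathcal{C}\subset\mathbb{R}_{>0}^r$ with $\mathcal{C}\cap\ell_\Gamma\neq\emptyset$ there exists a free subgroup $\Gamma'<\Gamma$ such that $\ell_{\Gamma'}\setminus\{0\}\subset\mathcal{C}$.
   Context: A Hadamard space is a complete CAT(0) metric space. Let $(X_i,d_i)$, $i=1,\ldots,r$, be locally compact Hadamard spaces, and let $X=X_1\times\cdots\times X_r$ carry the product distance $d=\sqrt{d_1^2+\cdots+d_r^2}$. An isometry $h$ of a Hadamard space $Y$ is axial if there are $l(h)>0$ (translation length) and a geodesic line $\sigma:\mathbb{R}\to Y$ (an axis) with $h(\sigma(t))=\sigma(t+l(h))$ for all $t$; set $h^+=\sigma(\infty)$, $h^-=\sigma(-\infty)$. It is rank one if it has an axis which does not bound a flat half-plane (a closed convex subset of $Y$ isometric to $[0,\infty)\times\mathbb{R}$ whose boundary line is the axis). Two rank one isometries $g,h$ are independent if $\{g^+,g^-\}\cap\{h^+,h^-\}=\emptyset$. An element $h=(h_1,\ldots,h_r)\in\mathrm{Is}(X_1)\times\cdots\times\mathrm{Is}(X_r)$ is regular axial if each $h_i$ is a rank one isometry of $X_i$; its translation vector is $L(h)=(l_1(h),\ldots,l_r(h))\in\mathbb{R}_{>0}^r$, where $l_i(h)$ is the translation length of $h_i$. Two regular axial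 isometries $g,h$ are independent if $g_i,h_i$ are independent for all $i$. For a discrete group $\Gamma<\mathrm{Is}(X_1)\times\cdots\times\mathrm{Is}(X_r)$ the limit cone $\ell_\Gamma$ is the closure in $\mathbb{R}_{\ge0}^r$ of the union of the half-lines spanned by the vectors $L(\gamma)$, $\gamma\in\Gamma$ regular axial. A cone is a subset invariant under multiplication by positive scalars. *)

theory Defs
  imports
    "HOL-Analysis.Analysis"
    "HOL-Algebra.Bij"
    "HOL-Algebra.Product_Groups"
    "HOL-Algebra.Generated_Groups"
begin

section \<open>Hadamard spaces\<close>

text \<open>Parametrisation by arc length is built in. Values of \<open>\<sigma>\<close> outside \<open>I\<close> are irrelevant.\<close>

definition geodesic_on :: "'a metric \<Rightarrow> real set \<Rightarrow> (real \<Rightarrow> 'a) \<Rightarrow> bool" where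
  "geodesic_on Y I \<sigma> \<longleftrightarrow>
     \<sigma> ` I \<subseteq> mspace Y \<and> (\<forall>s\<in>I. \<forall>t\<in>I. mdist Y (\<sigma> s) (\<sigma> t) = \<bar>s - t\<bar>)"

definition geodesic_joining :: "'a metric \<Rightarrow> 'a \<Rightarrow> 'a \<Rightarrow> (real \<Rightarrow> 'a) \<Rightarrow> bool" where
  "geodesic_joining Y x y \<sigma> \<longleftrightarrow>
     geodesic_on Y {0..mdist Y x y} \<sigma> \<and> \<sigma> 0 = x \<and> \<sigma> (mdist Y x y) = y"

definition geodesic_space :: "'a metric \<Rightarrow> bool" where
  "geodesic_space Y \<longleftrightarrow> (\<forall>x\<in>mspace Y. \<forall>y\<in>mspace Y. \<exists>\<sigma>. geodesic_joining Y x y \<sigma>)"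

text \<open>
  Comparison of a geodesic triangle with vertices \<open>x, y, z\<close> with a Euclidean triangle
  \<open>x', y', z'\<close> of the same side lengths. The two points that are compared are \<open>\<sigma> s\<close> on the
  side from \<open>x\<close> to \<open>y\<close> and \<open>\<tau> t\<close> on the side from \<open>x\<close> to \<open>z\<close>; as the vertices are arbitrary,
  this covers every pair of sides (for two points on one side there is nothing to compare).
\<close>

definition CAT0_space :: "'a metric \<Rightarrow> bool" where
  "CAT0_space Y \<longleftrightarrow> geodesic_space Y \<and>
     (\<forall>x y z \<sigma> \<tau> \<rho> s t. \<forall>x' y' z' p' q' :: real^2.
        x \<in> mspace Y \<and> y \<in> mspace Y \<and> z \<in> mspace Y \<and>
        geodesic_joining Y x y \<sigma> \<and> geodesic_joining Y x z \<tau> \<and> geodesic_joining Y y z \<rho> \<and>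
        dist x' y' = mdist Y x y \<and> dist x' z' = mdist Y x z \<and> dist y' z' = mdist Y y z \<and>
        s \<in> {0..mdist Y x y} \<and> p' \<in> closed_segment x' y' \<and> dist x' p' = s \<and>
        t \<in> {0..mdist Y x z} \<and> q' \<in> closed_segment x' z' \<and> dist x' q' = t
        \<longrightarrow> mdist Y (\<sigma> s) (\<tau> t) \<le> dist p' q')"

definition Hadamard_space :: "'a metric \<Rightarrow> bool" where
  "Hadamard_space Y \<longleftrightarrow> mspace Y \<noteq> {} \<and> mcomplete_of Y \<and> CAT0_space Y"


section \<open>Isometry groups and products\<close>

definition isometry_on :: "'a metric \<Rightarrow> ('a \<Rightarrow> 'a) \<Rightarrow> bool" where
  "isometry_on Y h \<longleftrightarrow> (\<forall>x\<in>mspace Y. \<forall>y\<in>mspace Y. mdist Y (h x) (h y) = mdist Y x y)"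

definition isometry_group :: "'a metric \<Rightarrow> ('a \<Rightarrow> 'a) monoid" where
  "isometry_group Y = BijGroup (mspace Y) \<lparr>carrier := {h \<in> Bij (mspace Y). isometry_on Y h}\<rparr>"

lemma subgroup_isometries: "subgroup {h \<in> Bij (mspace Y). isometry_on Y h} (BijGroup (mspace Y))"
proof -
  interpret B: group "BijGroup (mspace Y)" by (rule group_BijGroup)
  show ?thesis
  proof (rule B.subgroupI)
    show "{h \<in> Bij (mspace Y). isometry_on Y h} \<subseteq> carrier (BijGroup (mspace Y))"
      by (auto simp: BijGroup_def)
    show "{h \<in> Bij (mspace Y). isometry_on Y h} \<noteq> {}"
      using id_Bij[of "mspace Y"] by (auto simp: isometry_on_def)
  next
    fix a assume a: "a \<in> {h \<in> Bij (mspace Y). isometry_on Y h}"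
    then have bij: "bij_betw a (mspace Y) (mspace Y)" by (simp add: Bij_def)
    have "mdist Y (inv_into (mspace Y) a x) (inv_into (mspace Y) a y) = mdist Y x y"
      if "x \<in> mspace Y" "y \<in> mspace Y" for x y
    proof -
      have "inv_into (mspace Y) a x \<in> mspace Y" "inv_into (mspace Y) a y \<in> mspace Y"
        using that a by (auto simp: Bij_inv_into_mem)
      then have "mdist Y (inv_into (mspace Y) a x) (inv_into (mspace Y) a y)
          = mdist Y (a (inv_into (mspace Y) a x)) (a (inv_into (mspace Y) a y))"
        using a by (simp add: isometry_on_def)
      then show ?thesis using bij that by (simp add: bij_betw_inv_into_right)
    qed
    then show "inv\<^bsub>BijGroup (mspace Y)\<^esub> a \<in> {h \<in> Bij (mspace Y). isometry_on Y h}"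
      using a by (simp add: inv_BijGroup restrict_inv_into_Bij isometry_on_def)
  next
    fix a b assume "a \<in> {h \<in> Bij (mspace Y). isometry_on Y h}" "b \<in> {h \<in> Bij (mspace Y). isometry_on Y h}"
    then show "a \<otimes>\<^bsub>BijGroup (mspace Y)\<^esub> b \<in> {h \<in> Bij (mspace Y). isometry_on Y h}"
      by (auto simp: BijGroup_def compose_Bij isometry_on_def compose_eq
          dest!: Bij_imp_funcset intro!: funcset_mem)
        (simp add: Pi_iff)
  qed
qed

lemma group_isometry_group: "group (isometry_group Y)"
  unfolding isometry_group_def
  by (rule subgroup.subgroup_is_group[OF subgroup_isometries group_BijGroup])

definition isometry_product_group :: "('n \<Rightarrow> 'a metric) \<Rightarrow> ('n \<Rightarrow> 'a \<Rightarrow> 'a) monoid" where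
  "isometry_product_group X = product_group UNIV (\<lambda>i. isometry_group (X i))"

lemma group_isometry_product_group: "group (isometry_product_group X)"
  by (simp add: isometry_product_group_def group_isometry_group)

definition l2_product :: "('n::finite \<Rightarrow> 'a metric) \<Rightarrow> ('n \<Rightarrow> 'a) metric" where
  "l2_product X = metric (\<Pi>\<^sub>E i\<in>UNIV. mspace (X i),
     \<lambda>x y. sqrt (\<Sum>i\<in>UNIV. (mdist (X i) (x i) (y i))\<^sup>2))"

lemma Metric_space_l2_product:
  fixes X :: "'n::finite \<Rightarrow> 'a metric"
  shows "Metric_space (\<Pi>\<^sub>E i\<in>UNIV. mspace (X i))
           (\<lambda>x y. sqrt (\<Sum>i\<in>UNIV. (mdist (X i) (x i) (y i))\<^sup>2))"
proof
  fix x y :: "'n \<Rightarrow> 'a"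
  show "0 \<le> sqrt (\<Sum>i\<in>UNIV. (mdist (X i) (x i) (y i))\<^sup>2)" by (simp add: sum_nonneg)
  show "sqrt (\<Sum>i\<in>UNIV. (mdist (X i) (x i) (y i))\<^sup>2) = sqrt (\<Sum>i\<in>UNIV. (mdist (X i) (y i) (x i))\<^sup>2)"
    by (simp add: mdist_commute)
next
  fix x y :: "'n \<Rightarrow> 'a"
  assume "x \<in> (\<Pi>\<^sub>E i\<in>UNIV. mspace (X i))" "y \<in> (\<Pi>\<^sub>E i\<in>UNIV. mspace (X i))"
  then show "(sqrt (\<Sum>i\<in>UNIV. (mdist (X i) (x i) (y i))\<^sup>2) = 0) = (x = y)"
    by (auto simp: sum_nonneg_eq_0_iff fun_eq_iff PiE_iff)
next
  fix x y z :: "'n \<Rightarrow> 'a"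
  assume *: "x \<in> (\<Pi>\<^sub>E i\<in>UNIV. mspace (X i))" "y \<in> (\<Pi>\<^sub>E i\<in>UNIV. mspace (X i))"
    "z \<in> (\<Pi>\<^sub>E i\<in>UNIV. mspace (X i))"
  have "L2_set (\<lambda>i. mdist (X i) (x i) (z i)) UNIV
      \<le> L2_set (\<lambda>i. mdist (X i) (x i) (y i) + mdist (X i) (y i) (z i)) UNIV"
    using * by (intro L2_set_mono mdist_triangle) (auto simp: PiE_iff)
  also have "\<dots> \<le> L2_set (\<lambda>i. mdist (X i) (x i) (y i)) UNIV + L2_set (\<lambda>i. mdist (X i) (y i) (z i)) UNIV"
    by (rule L2_set_triangle_ineq)
  finally show "sqrt (\<Sum>i\<in>UNIV. (mdist (X i) (x i) (z i))\<^sup>2)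
      \<le> sqrt (\<Sum>i\<in>UNIV. (mdist (X i) (x i) (y i))\<^sup>2) + sqrt (\<Sum>i\<in>UNIV. (mdist (X i) (y i) (z i))\<^sup>2)"
    by (simp add: L2_set_def)
qed

lemma mspace_l2_product: "mspace (l2_product X) = (\<Pi>\<^sub>E i\<in>UNIV. mspace (X i))"
  by (simp add: l2_product_def Metric_space.mspace_metric[OF Metric_space_l2_product])

lemma mdist_l2_product:
  "mdist (l2_product X) = (\<lambda>x y. sqrt (\<Sum>i\<in>UNIV. (mdist (X i) (x i) (y i))\<^sup>2))"
  by (simp add: l2_product_def Metric_space.mdist_metric[OF Metric_space_l2_product])

definition properly_discontinuous :: "('n::finite \<Rightarrow> 'a metric) \<Rightarrow> ('n \<Rightarrow> 'a \<Rightarrow> 'a) set \<Rightarrow> bool" where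
  "properly_discontinuous X \<Gamma> \<longleftrightarrow>
     (\<forall>K. compactin (mtopology_of (l2_product X)) K
        \<longrightarrow> finite {\<gamma>\<in>\<Gamma>. (\<lambda>x i. \<gamma> i (x i)) ` K \<inter> K \<noteq> {}})"


section \<open>Rank one isometries\<close>

definition axis_of :: "'a metric \<Rightarrow> ('a \<Rightarrow> 'a) \<Rightarrow> real \<Rightarrow> (real \<Rightarrow> 'a) \<Rightarrow> bool" where
  "axis_of Y h l \<sigma> \<longleftrightarrow> 0 < l \<and> geodesic_on Y UNIV \<sigma> \<and> (\<forall>t. h (\<sigma> t) = \<sigma> (t + l))"

text \<open>The point at infinity of a ray is its class of asymptotic rays.\<close>

definition ray_end :: "'a metric \<Rightarrow> (real \<Rightarrow> 'a) \<Rightarrow> (real \<Rightarrow> 'a) set" where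
  "ray_end Y \<sigma> = {\<rho>. geodesic_on Y {0..} \<rho> \<and> (\<exists>B. \<forall>t\<ge>0. mdist Y (\<sigma> t) (\<rho> t) \<le> B)}"

text \<open>
  The following three descriptions do not depend on the choice of the axis; see the lemmas
  \<open>translation_length_eq\<close>, \<open>attracting_point_eq\<close> and \<open>repelling_point_eq\<close> below.
\<close>

definition translation_length :: "'a metric \<Rightarrow> ('a \<Rightarrow> 'a) \<Rightarrow> real" where
  "translation_length Y h = (THE l. \<exists>\<sigma>. axis_of Y h l \<sigma>)"

definition attracting_point :: "'a metric \<Rightarrow> ('a \<Rightarrow> 'a) \<Rightarrow> (real \<Rightarrow> 'a) set" where
  "attracting_point Y h = (THE \<xi>. \<exists>l \<sigma>. axis_of Y h l \<sigma> \<and> \<xi> = ray_end Y \<sigma>)"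

definition repelling_point :: "'a metric \<Rightarrow> ('a \<Rightarrow> 'a) \<Rightarrow> (real \<Rightarrow> 'a) set" where
  "repelling_point Y h = (THE \<xi>. \<exists>l \<sigma>. axis_of Y h l \<sigma> \<and> \<xi> = ray_end Y (\<lambda>t. \<sigma> (- t)))"

definition geodesically_convex :: "'a metric \<Rightarrow> 'a set \<Rightarrow> bool" where
  "geodesically_convex Y F \<longleftrightarrow>
     (\<forall>x\<in>F. \<forall>y\<in>F. \<forall>\<sigma>. geodesic_joining Y x y \<sigma> \<longrightarrow> \<sigma> ` {0..mdist Y x y} \<subseteq> F)"

text \<open>The distance on \<open>real \<times> real\<close> is the Euclidean one.\<close>

definition bounds_flat_half_plane :: "'a metric \<Rightarrow> (real \<Rightarrow> 'a) \<Rightarrow> bool" where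
  "bounds_flat_half_plane Y \<sigma> \<longleftrightarrow>
     (\<exists>F. \<exists>\<phi> :: real \<times> real \<Rightarrow> 'a.
        closedin (mtopology_of Y) F \<and> geodesically_convex Y F \<and>
        bij_betw \<phi> ({0..} \<times> UNIV) F \<and>
        (\<forall>p \<in> {0..} \<times> UNIV. \<forall>q \<in> {0..} \<times> UNIV. mdist Y (\<phi> p) (\<phi> q) = dist p q) \<and>
        \<phi> ` ({0} \<times> UNIV) = range \<sigma>)"

definition rank_one :: "'a metric \<Rightarrow> ('a \<Rightarrow> 'a) \<Rightarrow> bool" where
  "rank_one Y h \<longleftrightarrow> h \<in> carrier (isometry_group Y) \<and>
     (\<exists>l \<sigma>. axis_of Y h l \<sigma> \<and> \<not> bounds_flat_half_plane Y \<sigma>)"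

definition independent_rank_one :: "'a metric \<Rightarrow> ('a \<Rightarrow> 'a) \<Rightarrow> ('a \<Rightarrow> 'a) \<Rightarrow> bool" where
  "independent_rank_one Y g h \<longleftrightarrow> rank_one Y g \<and> rank_one Y h \<and>
     {attracting_point Y g, repelling_point Y g} \<inter> {attracting_point Y h, repelling_point Y h} = {}"

lemma axis_of_shift:
  assumes h: "isometry_on Y h" and "axis_of Y h l \<sigma>" "axis_of Y h m \<tau>"
  shows "mdist Y (\<sigma> (s + real n * l)) (\<tau> (t + real n * m)) = mdist Y (\<sigma> s) (\<tau> t)"
proof (induction n)
  case (Suc n)
  have "\<sigma> (s + real (Suc n) * l) = h (\<sigma> (s + real n * l))" "\<tau> (t + real (Suc n) * m) = h (\<tau> (t + real n * m))"
    using assms by (simp_all add: axis_of_def algebra_simps)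
  moreover have "\<sigma> (s + real n * l) \<in> mspace Y" "\<tau> (t + real n * m) \<in> mspace Y"
    using assms by (auto simp: axis_of_def geodesic_on_def)
  ultimately show ?case using Suc h by (simp add: isometry_on_def)
qed simp

lemma axis_of_length_le:
  assumes h: "isometry_on Y h" and s: "axis_of Y h l \<sigma>" and t: "axis_of Y h m \<tau>"
  shows "l \<le> m"
proof (rule ccontr)
  assume "\<not> l \<le> m"
  then have pos: "0 < l - m" by simp
  define D where "D = mdist Y (\<sigma> 0) (\<tau> 0)"
  obtain n :: nat where n: "2 * D < real n * (l - m)"
    using reals_Archimedean3[OF pos] by blast
  have in_space: "\<sigma> u \<in> mspace Y" "\<tau> u \<in> mspace Y" for u
    using s t by (auto simp: axis_of_def geodesic_on_def)
  have eq: "mdist Y (\<sigma> (real n * l)) (\<tau> (real n * m)) = D"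
    using axis_of_shift[OF h s t, of 0 n 0] by (simp add: D_def)
  have "real n * l = mdist Y (\<sigma> 0) (\<sigma> (real n * l))" "real n * m = mdist Y (\<tau> 0) (\<tau> (real n * m))"
    using s t by (auto simp: axis_of_def geodesic_on_def)
  moreover have "mdist Y (\<sigma> 0) (\<sigma> (real n * l))
      \<le> mdist Y (\<sigma> 0) (\<tau> 0) + mdist Y (\<tau> 0) (\<tau> (real n * m)) + mdist Y (\<tau> (real n * m)) (\<sigma> (real n * l))"
    by (smt (verit) in_space mdist_triangle)
  ultimately have "real n * l \<le> 2 * D + real n * m"
    using eq by (simp add: D_def mdist_commute)
  with n show False by (simp add: algebra_simps)
qed

lemma translation_length_eq:
  assumes "isometry_on Y h" "axis_of Y h l \<sigma>"
  shows "translation_length Y h = l"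
  unfolding translation_length_def
proof (rule the_equality)
  show "\<exists>\<sigma>. axis_of Y h l \<sigma>" using assms(2) by blast
next
  fix m assume "\<exists>\<tau>. axis_of Y h m \<tau>"
  then obtain \<tau> where "axis_of Y h m \<tau>" by blast
  with assms show "m = l" by (intro antisym) (auto intro: axis_of_length_le)
qed

lemma axes_parallel:
  assumes h: "isometry_on Y h" and s: "axis_of Y h l \<sigma>" and t: "axis_of Y h m \<tau>"
  obtains B where "\<And>u. mdist Y (\<sigma> u) (\<tau> u) \<le> B"
proof
  have m: "m = l" using axis_of_length_le[OF h s t] axis_of_length_le[OF h t s] by simp
  have l: "0 < l" using s by (simp add: axis_of_def)
  have in_space: "\<sigma> u \<in> mspace Y" "\<tau> u \<in> mspace Y" for u
    using s t by (auto simp: axis_of_def geodesic_on_def)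
  fix u
  define k where "k = \<lfloor>u / l\<rfloor>"
  define v where "v = u - of_int k * l"
  have v: "0 \<le> v" "v \<le> l"
    using l floor_divide_lower[OF l, of u] floor_divide_upper[OF l, of u]
    by (simp_all add: v_def k_def algebra_simps)
  have eq: "mdist Y (\<sigma> u) (\<tau> u) = mdist Y (\<sigma> v) (\<tau> v)"
  proof (cases "0 \<le> k")
    case True
    then show ?thesis
      using axis_of_shift[OF h s t, of v "nat k" v] by (simp add: m v_def)
  next
    case False
    then show ?thesis
      using axis_of_shift[OF h s t, of u "nat (- k)" u] by (simp add: m v_def)
  qed
  have "mdist Y (\<sigma> v) (\<tau> v) \<le> mdist Y (\<sigma> v) (\<sigma> 0) + mdist Y (\<sigma> 0) (\<tau> 0) + mdist Y (\<tau> 0) (\<tau> v)"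
    by (smt (verit) in_space mdist_triangle)
  also have "\<dots> \<le> mdist Y (\<sigma> 0) (\<tau> 0) + 2 * l"
    using s t v by (auto simp: axis_of_def geodesic_on_def)
  finally show "mdist Y (\<sigma> u) (\<tau> u) \<le> mdist Y (\<sigma> 0) (\<tau> 0) + 2 * l"
    by (simp add: eq)
qed

lemma ray_end_cong:
  assumes "geodesic_on Y {0..} \<sigma>" "geodesic_on Y {0..} \<tau>" "\<And>t. t \<ge> 0 \<Longrightarrow> mdist Y (\<sigma> t) (\<tau> t) \<le> B"
  shows "ray_end Y \<sigma> = ray_end Y \<tau>"
proof -
  have *: "ray_end Y \<sigma> \<subseteq> ray_end Y \<tau>"
    if "geodesic_on Y {0..} \<sigma>" "geodesic_on Y {0..} \<tau>" "\<And>t. t \<ge> 0 \<Longrightarrow> mdist Y (\<sigma> t) (\<tau> t) \<le> B"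
    for \<sigma> \<tau>
  proof
    fix \<rho> assume "\<rho> \<in> ray_end Y \<sigma>"
    then obtain C where r: "geodesic_on Y {0..} \<rho>" and C: "\<And>t. t \<ge> 0 \<Longrightarrow> mdist Y (\<sigma> t) (\<rho> t) \<le> C"
      by (auto simp: ray_end_def)
    have "mdist Y (\<tau> t) (\<rho> t) \<le> B + C" if "t \<ge> 0" for t
    proof -
      have "\<sigma> t \<in> mspace Y" "\<tau> t \<in> mspace Y" "\<rho> t \<in> mspace Y"
        using \<open>geodesic_on Y {0..} \<sigma>\<close> \<open>geodesic_on Y {0..} \<tau>\<close> r that by (auto simp: geodesic_on_def)
      then have "mdist Y (\<tau> t) (\<rho> t) \<le> mdist Y (\<tau> t) (\<sigma> t) + mdist Y (\<sigma> t) (\<rho> t)"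
        by (intro mdist_triangle)
      then show ?thesis
        using C[OF that] \<open>\<And>t. t \<ge> 0 \<Longrightarrow> mdist Y (\<sigma> t) (\<tau> t) \<le> B\<close>[OF that]
        by (simp add: mdist_commute)
    qed
    with r show "\<rho> \<in> ray_end Y \<tau>" by (auto simp: ray_end_def)
  qed
  show ?thesis
    using *[of \<sigma> \<tau>] *[of \<tau> \<sigma>] assms by (simp add: mdist_commute subset_antisym)
qed

lemma attracting_point_eq:
  assumes h: "isometry_on Y h" and s: "axis_of Y h l \<sigma>"
  shows "attracting_point Y h = ray_end Y \<sigma>"
  unfolding attracting_point_def
proof (rule the_equality)
  show "\<exists>l \<tau>. axis_of Y h l \<tau> \<and> ray_end Y \<sigma> = ray_end Y \<tau>" using s by blast
next
  fix \<xi> assume "\<exists>l \<tau>. axis_of Y h l \<tau> \<and> \<xi> = ray_end Y \<tau>"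
  then obtain m \<tau> where t: "axis_of Y h m \<tau>" and \<xi>: "\<xi> = ray_end Y \<tau>" by blast
  obtain B where "\<And>u. mdist Y (\<tau> u) (\<sigma> u) \<le> B" using axes_parallel[OF h t s] by blast
  moreover have "geodesic_on Y {0..} \<tau>" "geodesic_on Y {0..} \<sigma>"
    using s t by (auto simp: axis_of_def geodesic_on_def)
  ultimately show "\<xi> = ray_end Y \<sigma>"
    unfolding \<xi> by (intro ray_end_cong) auto
qed

lemma repelling_point_eq:
  assumes h: "isometry_on Y h" and s: "axis_of Y h l \<sigma>"
  shows "repelling_point Y h = ray_end Y (\<lambda>t. \<sigma> (- t))"
  unfolding repelling_point_def
proof (rule the_equality)
  show "\<exists>l \<tau>. axis_of Y h l \<tau> \<and> ray_end Y (\<lambda>t. \<sigma> (- t)) = ray_end Y (\<lambda>t. \<tau> (- t))" using s by blast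
next
  fix \<xi> assume "\<exists>l \<tau>. axis_of Y h l \<tau> \<and> \<xi> = ray_end Y (\<lambda>t. \<tau> (- t))"
  then obtain m \<tau> where t: "axis_of Y h m \<tau>" and \<xi>: "\<xi> = ray_end Y (\<lambda>t. \<tau> (- t))" by blast
  obtain B where "\<And>u. mdist Y (\<tau> u) (\<sigma> u) \<le> B" using axes_parallel[OF h t s] by blast
  moreover have "geodesic_on Y {0..} (\<lambda>t. \<tau> (- t))" "geodesic_on Y {0..} (\<lambda>t. \<sigma> (- t))"
    using s t by (auto simp: axis_of_def geodesic_on_def)
  ultimately show "\<xi> = ray_end Y (\<lambda>t. \<sigma> (- t))"
    unfolding \<xi> by (intro ray_end_cong) auto
qed


section \<open>Regular axial isometries and the limit cone\<close>

definition regular_axial :: "('n \<Rightarrow> 'a metric) \<Rightarrow> ('n \<Rightarrow> 'a \<Rightarrow> 'a) \<Rightarrow> bool" where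
  "regular_axial X h \<longleftrightarrow> (\<forall>i. rank_one (X i) (h i))"

definition independent_regular_axial ::
    "('n \<Rightarrow> 'a metric) \<Rightarrow> ('n \<Rightarrow> 'a \<Rightarrow> 'a) \<Rightarrow> ('n \<Rightarrow> 'a \<Rightarrow> 'a) \<Rightarrow> bool" where
  "independent_regular_axial X g h \<longleftrightarrow> regular_axial X g \<and> regular_axial X h \<and>
     (\<forall>i. independent_rank_one (X i) (g i) (h i))"

definition translation_vector :: "('n::finite \<Rightarrow> 'a metric) \<Rightarrow> ('n \<Rightarrow> 'a \<Rightarrow> 'a) \<Rightarrow> real^'n" where
  "translation_vector X h = (\<chi> i. translation_length (X i) (h i))"

text \<open>
  The half-lines lie in the closed positive orthant, so that the closure in the whole space
  is the closure in the orthant.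
\<close>

definition limit_cone :: "('n::finite \<Rightarrow> 'a metric) \<Rightarrow> ('n \<Rightarrow> 'a \<Rightarrow> 'a) set \<Rightarrow> (real^'n) set" where
  "limit_cone X \<Gamma> =
     closure (\<Union>\<gamma>\<in>{\<gamma>\<in>\<Gamma>. regular_axial X \<gamma>}. {t *\<^sub>R translation_vector X \<gamma> | t. 0 \<le> t})"


section \<open>Free subgroups\<close>

text \<open>
  A letter \<open>(s, True)\<close> stands for the generator \<open>s\<close>, a letter \<open>(s, False)\<close> for its formal inverse.
\<close>

definition reduced_word :: "('g \<times> bool) list \<Rightarrow> bool" where
  "reduced_word w \<longleftrightarrow> successively (\<lambda>(s, a) (t, b). \<not> (s = t \<and> a \<noteq> b)) w"

definition word_value :: "('g, 'm) monoid_scheme \<Rightarrow> ('g \<times> bool) list \<Rightarrow> 'g" where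
  "word_value G w = foldr (\<lambda>(s, a) x. (if a then s else inv\<^bsub>G\<^esub> s) \<otimes>\<^bsub>G\<^esub> x) w \<one>\<^bsub>G\<^esub>"

text \<open>
  Freeness in the usual sense, of arbitrary rank; the trivial subgroup is free on the empty basis.
\<close>

definition free_basis :: "('g, 'm) monoid_scheme \<Rightarrow> 'g set \<Rightarrow> 'g set \<Rightarrow> bool" where
  "free_basis G S H \<longleftrightarrow> S \<subseteq> carrier G \<and> generate G S = H \<and>
     (\<forall>w. w \<noteq> [] \<and> fst ` set w \<subseteq> S \<and> reduced_word w \<longrightarrow> word_value G w \<noteq> \<one>\<^bsub>G\<^esub>)"

definition free_subgroup :: "'g set \<Rightarrow> ('g, 'm) monoid_scheme \<Rightarrow> bool" where
  "free_subgroup H G \<longleftrightarrow> subgroup H G \<and> (\<exists>S. free_basis G S H)"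

text \<open>
  Existence results for free subgroups in the style of the Tits alternative mean free subgroups
  of rank at least two. For a free subgroup, this is the same as being nonabelian.
\<close>

definition nonabelian :: "'g set \<Rightarrow> ('g, 'm) monoid_scheme \<Rightarrow> bool" where
  "nonabelian H G \<longleftrightarrow> (\<exists>a\<in>H. \<exists>b\<in>H. a \<otimes>\<^bsub>G\<^esub> b \<noteq> b \<otimes>\<^bsub>G\<^esub> a)"

end

theory Submission
  imports Defs "HOL-Real_Asymp.Real_Asymp"
begin

text \<open>
  An axis without a flat half-plane is contracting: otherwise distance functions from far points
  would be almost affine, with slope bounded away from \<open>\<plusminus>1\<close>, along longer and longer parts of the
  axis, and the geodesics to these points would converge to rays that sweep out a flat
  half-plane. Contraction controls everything else by distances alone: it determines the fixed
  ends of a rank one isometry, bounds the mutual projections of axes without common ends, and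
  makes ping-pong quantitative.

  By openness, \<open>C\<close> contains the translation vector of some regular axial \<open>\<gamma>\<close> in the group. A
  counting argument gives a product \<open>\<phi>\<close> of powers of the two independent elements that moves the
  two ends of the axis of \<open>\<gamma>\<close> to a disjoint pair in all factors at once. For large \<open>n\<close>, a cyclically
  reduced word of length \<open>m\<close> in \<open>\<gamma>\<^sup>n\<close> and its conjugate by \<open>\<phi>\<close> has translation lengths
  \<open>m (n l\<^sub>i(\<gamma>) + O(1))\<close>, with an error that does not depend on \<open>n\<close>. So these two elements are a free
  basis, and all translation vectors have almost the direction of that of \<open>\<gamma>\<close>.
\<close>

section \<open>CAT(0) geometry\<close>

text \<open>Points at infinity enter only through rays at bounded distance from each other; neither
  a topology on the boundary nor an angle in the space is used. All geometry rests on the comparison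
  of a vertex with a point of a side, the inequality \<open>CN\<close>, together with a limit along
  an ultrafilter. Translation lengths are read off from the displacement of one base point under
  high powers. Powers of a merely reduced word need not be reduced; hence the passage to cyclically
  reduced conjugates. The conjugating element must serve all factors at once, although a good choice
  in one factor says nothing about another. Counting overcomes this, since every single condition
  excludes only a thin set of exponents. The limit cone is a closure, so membership in the open cone
  would not survive on its own. The directions are therefore controlled by a closed homogeneous
  condition, bounds on 2x2 minors against the vector of \<open>\<gamma>\<close>, whose nonzero
  solutions lie in \<open>C\<close>.\<close>

lemma euclidean_triangle:
  fixes a b c :: real
  assumes "0 \<le> a" "0 \<le> b" "0 \<le> c" "a \<le> b + c" "b \<le> a + c" "c \<le> a + b"
  shows "\<exists>x y z :: real^2. dist x y = a \<and> dist x z = b \<and> dist y z = c"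
proof (cases "a = 0")
  case True
  then have "b = c" using assms by simp
  have "dist (0::real^2) (vector [b, 0]) = b"
    using assms by (simp add: dist_norm norm_vec_def L2_set_def sum_2)
  then show ?thesis
    using True \<open>b = c\<close> by (intro exI[of _ 0] exI[of _ "vector [b,0]"]) auto
next
  case False
  then have a: "a > 0" using assms by simp
  \<comment> \<open>With \<open>x\<close> at the origin and \<open>y\<close> at
    \<open>(a, 0)\<close>, this is the first coordinate of \<open>z\<close> by the law of cosines.
    The triangle has to be built because the CAT(0) condition speaks only of comparison triangles
    that are given.\<close>
  define u where "u = (a\<^sup>2 + b\<^sup>2 - c\<^sup>2) / (2 * a)"
  have ua: "2 * a * u = a\<^sup>2 + b\<^sup>2 - c\<^sup>2" using a by (simp add: u_def)
  have "\<bar>a\<^sup>2 + b\<^sup>2 - c\<^sup>2\<bar> \<le> 2 * a * b"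
  proof -
    have "(a - b)\<^sup>2 \<le> c\<^sup>2" "c\<^sup>2 \<le> (a + b)\<^sup>2"
      using assms by (auto intro!: power_mono simp: abs_le_square_iff[symmetric])
    then show ?thesis by (auto simp: power2_eq_square algebra_simps abs_le_iff)
  qed
  then have "\<bar>2 * a * u\<bar> \<le> 2 * a * b" by (simp add: ua)
  then have "\<bar>u\<bar> \<le> \<bar>b\<bar>" using a assms by (simp add: abs_mult)
  then have ub: "u\<^sup>2 \<le> b\<^sup>2" by (simp add: abs_le_square_iff)
  define v where "v = sqrt (b\<^sup>2 - u\<^sup>2)"
  have v: "v\<^sup>2 = b\<^sup>2 - u\<^sup>2" using ub by (simp add: v_def)
  have "dist (0::real^2) (vector [a, 0]) = a"
    using a by (simp add: dist_norm norm_vec_def L2_set_def sum_2)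
  moreover have "dist (0::real^2) (vector [u, v]) = b"
    using assms v by (simp add: dist_norm norm_vec_def L2_set_def sum_2)
  moreover have "dist (vector [a, 0] ::real^2) (vector [u, v]) = c"
  proof -
    have "(a - u)\<^sup>2 + v\<^sup>2 = c\<^sup>2" using ua v by (simp add: power2_eq_square algebra_simps)
    then show ?thesis using assms by (simp add: dist_norm norm_vec_def L2_set_def sum_2)
  qed
  ultimately show ?thesis by blast
qed

text \<open>The Euclidean equality that comparison turns into the inequality
  \<open>CN\<close>.\<close>

lemma stewart:
  fixes x y z :: "'a::real_inner"
  shows "(dist z (x + r *\<^sub>R (y - x)))\<^sup>2 =
    (1 - r) * (dist z x)\<^sup>2 + r * (dist z y)\<^sup>2 - r * (1 - r) * (dist x y)\<^sup>2"
  unfolding dist_norm power2_norm_eq_inner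
  by (simp add: inner_diff_left inner_diff_right inner_add_left inner_add_right inner_commute algebra_simps power2_eq_square)

text \<open>The parameter is a fraction of the length, so that comparison reads as an affine
  combination in the plane. The choice of the geodesic is harmless by
  \<open>point_at_unique\<close>.\<close>

definition point_at :: "'a metric \<Rightarrow> 'a \<Rightarrow> 'a \<Rightarrow> real \<Rightarrow> 'a" where
  "point_at Y x y r = (SOME \<sigma>. geodesic_joining Y x y \<sigma>) (r * mdist Y x y)"

locale cat0 =
  fixes Y :: "'a metric"
  assumes CAT0: "CAT0_space Y"
begin

abbreviation d :: "'a \<Rightarrow> 'a \<Rightarrow> real" where "d \<equiv> mdist Y"
abbreviation M :: "'a set" where "M \<equiv> mspace Y"

lemma ex_geodesic: "x \<in> M \<Longrightarrow> y \<in> M \<Longrightarrow> \<exists>\<sigma>. geodesic_joining Y x y \<sigma>"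
  using CAT0 by (auto simp: CAT0_space_def geodesic_space_def)

lemma d_self [simp]: "x \<in> M \<Longrightarrow> d x x = 0"
  by simp

lemma CN_geodesic:
  assumes x: "x \<in> M" and y: "y \<in> M" and z: "z \<in> M"
    and g: "geodesic_joining Y x y \<sigma>" and r: "0 \<le> r" "r \<le> 1"
  shows "(d z (\<sigma> (r * d x y)))\<^sup>2 \<le> (1 - r) * (d z x)\<^sup>2 + r * (d z y)\<^sup>2 - r * (1 - r) * (d x y)\<^sup>2"
proof -
  obtain \<tau> where t: "geodesic_joining Y x z \<tau>" using ex_geodesic x z by blast
  obtain \<rho> where rho: "geodesic_joining Y y z \<rho>" using ex_geodesic y z by blast
  have "d x y \<le> d x z + d y z" "d x z \<le> d x y + d y z" "d y z \<le> d x y + d x z"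
    using mdist_triangle[of x Y z y] mdist_triangle[of x Y y z] mdist_triangle[of y Y x z] x y z
    by (simp_all add: mdist_commute)
  then obtain x' y' z' :: "real^2" where
    e: "dist x' y' = d x y" "dist x' z' = d x z" "dist y' z' = d y z"
    using euclidean_triangle[of "d x y" "d x z" "d y z"] by auto
  define p' where "p' = x' + r *\<^sub>R (y' - x')"
  have "p' \<in> closed_segment x' y'"
    using r by (auto simp: p'_def closed_segment_def algebra_simps intro!: exI[of _ r])
  moreover have "dist x' p' = r * d x y"
    using r by (simp add: p'_def dist_norm norm_minus_commute flip: e)
  moreover have "r * d x y \<in> {0..d x y}" using r by (simp add: mult_left_le_one_le)
  \<comment> \<open>The second compared point is the vertex \<open>z\<close> itself. This special
    case already yields every later estimate.\<close>
  moreover have "z' \<in> closed_segment x' z'" "d x z \<in> {0..d x z}" by auto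
  ultimately have "d (\<sigma> (r * d x y)) (\<tau> (d x z)) \<le> dist p' z'"
    using CAT0 x y z g t rho e unfolding CAT0_space_def by blast
  also have "\<tau> (d x z) = z" using t by (simp add: geodesic_joining_def)
  finally have "(d z (\<sigma> (r * d x y)))\<^sup>2 \<le> (dist z' p')\<^sup>2"
    by (intro power_mono) (simp_all add: mdist_commute dist_commute)
  then show ?thesis
    unfolding p'_def stewart using e by (simp add: mdist_commute dist_commute)
qed

lemma point_at:
  assumes x: "x \<in> M" and y: "y \<in> M" and r: "0 \<le> r" "r \<le> 1"
  shows point_at_in: "point_at Y x y r \<in> M" and dist_point_at_left: "d x (point_at Y x y r) = r * d x y"
    and dist_point_at_right: "d (point_at Y x y r) y = (1 - r) * d x y"
proof -
  let ?s = "SOME \<sigma>. geodesic_joining Y x y \<sigma>"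
  have g: "geodesic_joining Y x y ?s" using ex_geodesic[OF x y] by (rule someI_ex)
  then have iso: "\<And>s t. s \<in> {0..d x y} \<Longrightarrow> t \<in> {0..d x y} \<Longrightarrow> d (?s s) (?s t) = \<bar>s - t\<bar>"
    and im: "?s ` {0..d x y} \<subseteq> M" and e: "?s 0 = x" "?s (d x y) = y"
    by (auto simp: geodesic_joining_def geodesic_on_def)
  have rd: "r * d x y \<in> {0..d x y}" using r by (simp add: mult_left_le_one_le)
  show "point_at Y x y r \<in> M" using im rd by (auto simp: point_at_def)
  show "d x (point_at Y x y r) = r * d x y" using iso[of 0 "r * d x y"] rd e by (simp add: point_at_def)
  show "d (point_at Y x y r) y = (1 - r) * d x y"
    using iso[of "r * d x y" "d x y"] rd e by (simp add: point_at_def algebra_simps)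
qed

lemma CN:
  assumes "x \<in> M" "y \<in> M" "z \<in> M" "0 \<le> r" "r \<le> 1"
  shows "(d z (point_at Y x y r))\<^sup>2 \<le> (1 - r) * (d z x)\<^sup>2 + r * (d z y)\<^sup>2 - r * (1 - r) * (d x y)\<^sup>2"
  unfolding point_at_def using assms CN_geodesic someI_ex[OF ex_geodesic] by blast

text \<open>\<open>CN\<close> with the point itself as apex has right side zero.\<close>

lemma point_at_unique:
  assumes x: "x \<in> M" and y: "y \<in> M" and m: "m \<in> M" and r: "0 \<le> r" "r \<le> 1"
    and 1: "d x m = r * d x y" and 2: "d m y = (1 - r) * d x y"
  shows "m = point_at Y x y r"
proof -
  have "(d m (point_at Y x y r))\<^sup>2 \<le> (1 - r) * (d m x)\<^sup>2 + r * (d m y)\<^sup>2 - r * (1 - r) * (d x y)\<^sup>2"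
    using CN[OF x y m r] .
  also have "\<dots> = (1 - r) * (r * d x y)\<^sup>2 + r * ((1 - r) * d x y)\<^sup>2 - r * (1 - r) * (d x y)\<^sup>2"
    using 1 2 by (simp add: mdist_commute[of Y m x])
  also have "\<dots> = 0" by algebra
  finally have "d m (point_at Y x y r) = 0" by simp
  then show ?thesis using m point_at_in[OF x y r] by simp
qed

lemma geodesic_joining_point_at:
  assumes "geodesic_joining Y x y \<sigma>" "x \<in> M" "y \<in> M" "0 \<le> r" "r \<le> 1"
  shows "\<sigma> (r * d x y) = point_at Y x y r"
proof (rule point_at_unique)
  have rd: "r * d x y \<in> {0..d x y}" using assms by (simp add: mult_left_le_one_le)
  have iso: "\<And>s t. s \<in> {0..d x y} \<Longrightarrow> t \<in> {0..d x y} \<Longrightarrow> d (\<sigma> s) (\<sigma> t) = \<bar>s - t\<bar>"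
    and im: "\<sigma> ` {0..d x y} \<subseteq> M" and e: "\<sigma> 0 = x" "\<sigma> (d x y) = y"
    using assms by (auto simp: geodesic_joining_def geodesic_on_def)
  show "\<sigma> (r * d x y) \<in> M" using im rd by auto
  show "d x (\<sigma> (r * d x y)) = r * d x y" using iso[of 0 "r * d x y"] rd e by simp
  show "d (\<sigma> (r * d x y)) y = (1 - r) * d x y"
    using iso[of "r * d x y" "d x y"] rd e by (simp add: algebra_simps)
qed (use assms in auto)

lemma point_at_commute:
  assumes "x \<in> M" "y \<in> M" "0 \<le> r" "r \<le> 1"
  shows "point_at Y x y r = point_at Y y x (1 - r)"
  using assms dist_point_at_left[OF assms] dist_point_at_right[OF assms]
  by (intro point_at_unique) (auto simp: point_at_in mdist_commute)

lemma point_at_0 [simp]: "x \<in> M \<Longrightarrow> y \<in> M \<Longrightarrow> point_at Y x y 0 = x"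
  by (rule point_at_unique[symmetric]) auto

lemma point_at_1 [simp]: "x \<in> M \<Longrightarrow> y \<in> M \<Longrightarrow> point_at Y x y 1 = y"
  by (rule point_at_unique[symmetric]) auto

text \<open>\<open>CN\<close> once on each side of the hinge at \<open>c\<close>. The bound is the
  squared distance of the corresponding points of the comparison triangle.\<close>

lemma fan:
  assumes c: "c \<in> M" and x: "x \<in> M" and y: "y \<in> M"
    and a: "0 \<le> a" "a \<le> 1" and b: "0 \<le> b" "b \<le> 1"
  shows "(d (point_at Y c x a) (point_at Y c y b))\<^sup>2 \<le>
    (a * d c x)\<^sup>2 + (b * d c y)\<^sup>2 - a * b * ((d c x)\<^sup>2 + (d c y)\<^sup>2 - (d x y)\<^sup>2)"
proof -
  let ?p = "point_at Y c x a"
  have p: "?p \<in> M" using point_at_in c x a by blast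
  have "(d ?p (point_at Y c y b))\<^sup>2 \<le> (1 - b) * (d ?p c)\<^sup>2 + b * (d ?p y)\<^sup>2 - b * (1 - b) * (d c y)\<^sup>2"
    using CN[OF c y p b] .
  also have "d ?p c = a * d c x" using dist_point_at_left[OF c x a] by (simp add: mdist_commute)
  also have "(1 - b) * (a * d c x)\<^sup>2 + b * (d ?p y)\<^sup>2 - b * (1 - b) * (d c y)\<^sup>2
    \<le> (1 - b) * (a * d c x)\<^sup>2 + b * ((1 - a) * (d y c)\<^sup>2 + a * (d y x)\<^sup>2 - a * (1 - a) * (d c x)\<^sup>2)
      - b * (1 - b) * (d c y)\<^sup>2"
    using CN[OF c x y a] b by (simp add: mdist_commute mult_left_mono)
  also have "\<dots> = (a * d c x)\<^sup>2 + (b * d c y)\<^sup>2 - a * b * ((d c x)\<^sup>2 + (d c y)\<^sup>2 - (d x y)\<^sup>2)"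
    unfolding mdist_commute[of Y y c] mdist_commute[of Y y x] by algebra
  finally show ?thesis .
qed

text \<open>A chord of the circle of radius \<open>s\<close> around \<open>c\<close>, bounded by the
  comparison angle, with denominators cleared. Read backwards, a chord of length almost
  \<open>2 * s\<close> forces a comparison angle near \<pi>.\<close>

lemma fan_equal_length:
  assumes c: "c \<in> M" and x: "x \<in> M" and y: "y \<in> M"
    and s: "0 \<le> s" "s \<le> d c x" "s \<le> d c y" "0 < d c x" "0 < d c y"
  shows "(d (point_at Y c x (s / d c x)) (point_at Y c y (s / d c y)))\<^sup>2 * (d c x * d c y) \<le>
    s\<^sup>2 * (2 * (d c x * d c y) - ((d c x)\<^sup>2 + (d c y)\<^sup>2 - (d x y)\<^sup>2))"
proof -
  let ?X = "d c x" and ?Z = "d c y"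
  have "(d (point_at Y c x (s / ?X)) (point_at Y c y (s / ?Z)))\<^sup>2 \<le>
    (s / ?X * ?X)\<^sup>2 + (s / ?Z * ?Z)\<^sup>2 - s / ?X * (s / ?Z) * (?X\<^sup>2 + ?Z\<^sup>2 - (d x y)\<^sup>2)"
    using s by (intro fan c x y) auto
  also have "\<dots> = 2 * s\<^sup>2 - s\<^sup>2 * (?X\<^sup>2 + ?Z\<^sup>2 - (d x y)\<^sup>2) / (?X * ?Z)"
    using s by (simp add: power2_eq_square)
  finally have "(d (point_at Y c x (s / ?X)) (point_at Y c y (s / ?Z)))\<^sup>2 * (?X * ?Z) \<le>
    (2 * s\<^sup>2 - s\<^sup>2 * (?X\<^sup>2 + ?Z\<^sup>2 - (d x y)\<^sup>2) / (?X * ?Z)) * (?X * ?Z)"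
    using s by (intro mult_right_mono) auto
  also have "\<dots> = s\<^sup>2 * (2 * (?X * ?Z) - (?X\<^sup>2 + ?Z\<^sup>2 - (d x y)\<^sup>2))"
  proof -
    have "(2 * s\<^sup>2 - s\<^sup>2 * Q / P) * P = s\<^sup>2 * (2 * P - Q)" if "P \<noteq> 0" for P Q
      using that by (simp add: field_simps)
    then show ?thesis using s by simp
  qed
  finally show ?thesis .
qed

text \<open>Add \<open>CN\<close> for \<open>b\<close> and for \<open>e\<close> at the midpoint of
  the other diagonal. This replaces comparison of quadrilaterals, both for projections and for
  flatness.\<close>

lemma quadrilateral:
  assumes "a \<in> M" "b \<in> M" "c \<in> M" "e \<in> M"
  shows "(d a c)\<^sup>2 + (d b e)\<^sup>2 \<le> (d a b)\<^sup>2 + (d b c)\<^sup>2 + (d c e)\<^sup>2 + (d e a)\<^sup>2"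
proof -
  let ?m = "point_at Y a c (1/2)"
  have m: "?m \<in> M" using assms by (intro point_at_in) auto
  have "d b e \<le> d b ?m + d e ?m"
    using mdist_triangle[of b Y ?m e] assms m by (simp add: mdist_commute)
  then have "(d b e)\<^sup>2 \<le> (d b ?m + d e ?m)\<^sup>2" by (intro power_mono) auto
  also have "\<dots> \<le> 2 * (d b ?m)\<^sup>2 + 2 * (d e ?m)\<^sup>2"
    using sum_squares_bound[of "d b ?m" "d e ?m"] by (simp add: power2_sum)
  also have "\<dots> \<le> (d a b)\<^sup>2 + (d b c)\<^sup>2 + (d c e)\<^sup>2 + (d e a)\<^sup>2 - (d a c)\<^sup>2"
    using CN[of a c b "1/2"] CN[of a c e "1/2"] assms
    by (simp add: mdist_commute power2_eq_square algebra_simps)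
  finally show ?thesis by simp
qed

end

section \<open>Projection to a geodesic line\<close>

text \<open>A projection is recorded by its parameter on the line, so that distances of feet are
  differences of reals and a translation along the line is an addition.\<close>

definition foot :: "'a metric \<Rightarrow> (real \<Rightarrow> 'a) \<Rightarrow> 'a \<Rightarrow> real \<Rightarrow> bool" where
  "foot Y \<sigma> x a \<longleftrightarrow> (\<forall>t. mdist Y x (\<sigma> a) \<le> mdist Y x (\<sigma> t))"

locale cat0_line = cat0 +
  fixes \<sigma> :: "real \<Rightarrow> 'a"
  assumes line: "geodesic_on Y UNIV \<sigma>"
begin

lemma line_in [simp]: "\<sigma> t \<in> M"
  using line by (auto simp: geodesic_on_def)

lemma line_dist: "d (\<sigma> s) (\<sigma> t) = \<bar>s - t\<bar>"
  using line by (auto simp: geodesic_on_def)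

lemma line_point_at:
  assumes "0 \<le> r" "r \<le> 1"
  shows "point_at Y (\<sigma> s) (\<sigma> t) r = \<sigma> ((1 - r) * s + r * t)"
proof (rule point_at_unique[symmetric])
  have "\<bar>s - ((1 - r) * s + r * t)\<bar> = \<bar>r * (s - t)\<bar>" by (simp add: algebra_simps)
  then show "d (\<sigma> s) (\<sigma> ((1 - r) * s + r * t)) = r * d (\<sigma> s) (\<sigma> t)"
    using assms by (simp add: line_dist abs_mult)
  have "\<bar>(1 - r) * s + r * t - t\<bar> = \<bar>(1 - r) * (s - t)\<bar>" by (simp add: algebra_simps)
  then show "d (\<sigma> ((1 - r) * s + r * t)) (\<sigma> t) = (1 - r) * d (\<sigma> s) (\<sigma> t)"
    using assms by (simp add: line_dist abs_mult)
qed (use assms in auto)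

lemma CN_line:
  assumes "x \<in> M" "0 \<le> r" "r \<le> 1"
  shows "(d x (\<sigma> ((1 - r) * s + r * t)))\<^sup>2 \<le>
    (1 - r) * (d x (\<sigma> s))\<^sup>2 + r * (d x (\<sigma> t))\<^sup>2 - r * (1 - r) * (s - t)\<^sup>2"
  using CN[of "\<sigma> s" "\<sigma> t" x r] assms by (simp add: line_point_at line_dist)

lemma lipschitz_line:
  assumes "x \<in> M"
  shows "\<bar>d x (\<sigma> s) - d x (\<sigma> t)\<bar> \<le> \<bar>s - t\<bar>"
  using mdist_triangle[of x Y "\<sigma> s" "\<sigma> t"] mdist_triangle[of x Y "\<sigma> t" "\<sigma> s"] assms
  by (simp add: line_dist abs_le_iff)

text \<open>The distance is 1-Lipschitz along the line, so the term \<open>(s - t)\<^sup>2\<close>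
  in \<open>CN_line\<close> dominates the squared difference of the values at \<open>s\<close> and
  \<open>t\<close>; replacing it completes a square.\<close>

lemma convex_dist_line:
  assumes x: "x \<in> M"
  shows "convex_on UNIV (\<lambda>t. d x (\<sigma> t))"
proof (rule convex_onI)
  fix r s t :: real assume r: "0 < r" "r < 1"
  let ?f = "\<lambda>t. d x (\<sigma> t)"
  have "(?f s - ?f t)\<^sup>2 \<le> (s - t)\<^sup>2" using lipschitz_line[OF x] by (simp add: abs_le_square_iff)
  then have "r * (1 - r) * (?f s - ?f t)\<^sup>2 \<le> r * (1 - r) * (s - t)\<^sup>2"
    using r by (intro mult_left_mono) auto
  then have "(?f ((1 - r) * s + r * t))\<^sup>2 \<le>
      (1 - r) * (?f s)\<^sup>2 + r * (?f t)\<^sup>2 - r * (1 - r) * (?f s - ?f t)\<^sup>2"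
    using CN_line[OF x, of r s t] r by linarith
  also have "\<dots> = ((1 - r) * ?f s + r * ?f t)\<^sup>2" by algebra
  finally have "?f ((1 - r) * s + r * t) \<le> (1 - r) * ?f s + r * ?f t"
    by (rule power2_le_imp_le) (use r in auto)
  then show "?f ((1 - r) *\<^sub>R s + r *\<^sub>R t) \<le> (1 - r) * ?f s + r * ?f t" by simp
qed simp

text \<open>The angle at the foot is at least a right angle: take \<open>CN_line\<close> at a point
  near the foot, use minimality, divide by the ratio \<open>r\<close> and let \<open>r\<close> tend
  to 0.\<close>

lemma foot_pythagoras:
  assumes x: "x \<in> M" and a: "foot Y \<sigma> x a"
  shows "(d x (\<sigma> a))\<^sup>2 + (t - a)\<^sup>2 \<le> (d x (\<sigma> t))\<^sup>2"
proof -
  have "(d x (\<sigma> a))\<^sup>2 + (1 - r) * (t - a)\<^sup>2 \<le> (d x (\<sigma> t))\<^sup>2" if r: "0 < r" "r \<le> 1" for r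
  proof -
    have "(d x (\<sigma> a))\<^sup>2 \<le> (d x (\<sigma> ((1 - r) * a + r * t)))\<^sup>2"
      using a by (intro power_mono) (auto simp: foot_def)
    also have "\<dots> \<le> (1 - r) * (d x (\<sigma> a))\<^sup>2 + r * (d x (\<sigma> t))\<^sup>2 - r * (1 - r) * (a - t)\<^sup>2"
      using r by (intro CN_line x) auto
    finally have "r * ((d x (\<sigma> a))\<^sup>2 + (1 - r) * (t - a)\<^sup>2) \<le> r * (d x (\<sigma> t))\<^sup>2"
      by (simp add: algebra_simps power2_commute)
    then show ?thesis using r by simp
  qed
  then have ev: "\<forall>\<^sub>F r in at_right (0::real). (d x (\<sigma> a))\<^sup>2 + (1 - r) * (t - a)\<^sup>2 \<le> (d x (\<sigma> t))\<^sup>2"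
    unfolding eventually_at_right_field by (intro exI[of _ 1]) auto
  have "((\<lambda>r. (d x (\<sigma> a))\<^sup>2 + (1 - r) * (t - a)\<^sup>2) \<longlongrightarrow> (d x (\<sigma> a))\<^sup>2 + (1 - 0) * (t - a)\<^sup>2) (at_right (0::real))"
    by (intro tendsto_intros)
  then show ?thesis using tendsto_upperbound[OF _ ev] by simp
qed

lemma foot_unique:
  assumes "x \<in> M" "foot Y \<sigma> x a" "foot Y \<sigma> x b"
  shows "a = b"
proof -
  have "(d x (\<sigma> b))\<^sup>2 \<le> (d x (\<sigma> a))\<^sup>2" using assms(3) by (intro power_mono) (auto simp: foot_def)
  then have "(b - a)\<^sup>2 \<le> 0" using foot_pythagoras[OF assms(1,2), of b] by linarith
  then show ?thesis by simp
qed

lemma foot_ex: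
  assumes x: "x \<in> M"
  shows "\<exists>a. foot Y \<sigma> x a"
proof -
  \<comment> \<open>Outside \<open>[-?R, ?R]\<close> no point of the line is closer to
    \<open>x\<close> than \<open>\<sigma> 0\<close>.\<close>
  let ?f = "\<lambda>t. d x (\<sigma> t)" and ?R = "2 * d x (\<sigma> 0)"
  have "1-lipschitz_on {-?R..?R} ?f"
    using lipschitz_line[OF x] by (auto intro!: lipschitz_onI simp: dist_real_def)
  then have "continuous_on {-?R..?R} ?f" by (rule lipschitz_on_continuous_on)
  moreover have "compact {-?R..?R}" "{-?R..?R} \<noteq> {}" by auto
  ultimately obtain a where a: "a \<in> {-?R..?R}" "\<And>t. t \<in> {-?R..?R} \<Longrightarrow> ?f a \<le> ?f t"
    using continuous_attains_inf[of "{-?R..?R}" ?f] by blast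
  have "?f a \<le> ?f t" for t
  proof (cases "t \<in> {-?R..?R}")
    case False
    then have "?R \<le> \<bar>t\<bar>" by auto
    also have "\<bar>t\<bar> \<le> d x (\<sigma> 0) + ?f t"
      using mdist_triangle[of "\<sigma> 0" Y x "\<sigma> t"] x by (simp add: line_dist mdist_commute)
    finally show ?thesis using a(2)[of 0] by simp
  qed (use a in auto)
  then show ?thesis by (auto simp: foot_def)
qed

text \<open>Between the quadrilateral inequality and two uses of \<open>foot_pythagoras\<close> the
  heights cancel.\<close>

lemma foot_lipschitz:
  assumes x: "x \<in> M" and y: "y \<in> M" and a: "foot Y \<sigma> x a" and b: "foot Y \<sigma> y b"
  shows "\<bar>a - b\<bar> \<le> d x y"
proof -
  have "(d x (\<sigma> b))\<^sup>2 + (d (\<sigma> a) y)\<^sup>2 \<le> (d x (\<sigma> a))\<^sup>2 + (d (\<sigma> a) (\<sigma> b))\<^sup>2 + (d (\<sigma> b) y)\<^sup>2 + (d y x)\<^sup>2"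
    using quadrilateral[of x "\<sigma> a" "\<sigma> b" y] x y by simp
  moreover have "(d x (\<sigma> a))\<^sup>2 + (b - a)\<^sup>2 \<le> (d x (\<sigma> b))\<^sup>2" "(d y (\<sigma> b))\<^sup>2 + (a - b)\<^sup>2 \<le> (d y (\<sigma> a))\<^sup>2"
    using foot_pythagoras x y a b by auto
  ultimately have "(a - b)\<^sup>2 \<le> (d x y)\<^sup>2"
    by (simp add: line_dist mdist_commute power2_commute)
  then show ?thesis using abs_le_square_iff[of "a - b" "d x y"] by simp
qed

lemma foot_line: "foot Y \<sigma> (\<sigma> t) t"
  by (simp add: foot_def)

lemma reverse: "cat0_line Y (\<lambda>t. \<sigma> (- t))"
  by unfold_locales (auto simp: geodesic_on_def line_dist)

lemma foot_reverse: "foot Y (\<lambda>t. \<sigma> (- t)) x a \<longleftrightarrow> foot Y \<sigma> x (- a)"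
  unfolding foot_def by (metis add.inverse_inverse)

end

section \<open>Limits along ultrafilters\<close>

text \<open>A single ultrafilter yields limits of uncountably many sequences at once, here of all
  points of a half-plane, without subsequences.\<close>

definition ultra :: "'b filter \<Rightarrow> bool" where
  "ultra U \<longleftrightarrow> U \<noteq> bot \<and> (\<forall>P. eventually P U \<or> eventually (\<lambda>x. \<not> P x) U)"

text \<open>
  The indicator functions of all sets form a map into a compact power of the unit interval.
  Along any filter for which this map converges, every set is eventually decided.
\<close>

lemma ultra_exists: "\<exists>U :: nat filter. ultra U \<and> U \<le> sequentially"
proof -
  define ind :: "nat \<Rightarrow> nat set \<Rightarrow> real" where "ind n P = indicator P n" for n P
  let ?K = "Pi\<^sub>E UNIV (\<lambda>_::nat set. {0..1::real})"
  have "compactin (product_topology (\<lambda>_::nat set. euclidean :: real topology) UNIV) ?K"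
    by (subst compactin_PiE) auto
  then have K: "compact ?K"
    by (simp add: euclidean_product_topology)
  have ev: "eventually (\<lambda>f. f \<in> ?K) (filtermap ind sequentially)"
    unfolding eventually_filtermap by (intro always_eventually) (auto simp: ind_def indicator_def)
  have nb: "filtermap ind sequentially \<noteq> bot" by (simp add: filtermap_bot_iff)
  obtain f where f: "inf (nhds f) (filtermap ind sequentially) \<noteq> bot"
    using K[unfolded compact_filter, rule_format, OF nb ev] by blast
  define U where "U = inf (filtercomap ind (nhds f)) sequentially"
  have lim: "(ind \<longlongrightarrow> f) U"
    unfolding U_def filterlim_def
    by (rule order_trans[OF filtermap_mono[OF inf_le1]]) (rule filtermap_filtercomap)
  have "U \<noteq> bot"
  proof
    assume "U = bot"
    then have "eventually (\<lambda>_. False) (inf (filtercomap ind (nhds f)) sequentially)"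
      by (simp add: U_def)
    then obtain P Q where PQ: "eventually P (filtercomap ind (nhds f))" "eventually Q sequentially"
        "\<And>n. P n \<Longrightarrow> Q n \<Longrightarrow> False"
      by (auto simp: eventually_inf)
    then obtain R where R: "eventually R (nhds f)" "\<And>n. R (ind n) \<Longrightarrow> P n"
      by (auto simp: eventually_filtercomap)
    have "eventually (\<lambda>g. \<not> R g) (filtermap ind sequentially)"
      unfolding eventually_filtermap using PQ(2) by eventually_elim (use PQ R in blast)
    then have "eventually (\<lambda>_. False) (inf (nhds f) (filtermap ind sequentially))"
      unfolding eventually_inf using R(1) by blast
    then show False using f by (simp add: trivial_limit_def)
  qed
  moreover have "eventually P U \<or> eventually (\<lambda>n. \<not> P n) U" for P
  proof -
    have "continuous_on UNIV (\<lambda>g :: nat set \<Rightarrow> real. g {n. P n})"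
      by (rule continuous_on_product_coordinates)
    then have "((\<lambda>n. ind n {n. P n}) \<longlongrightarrow> f {n. P n}) U"
      using lim by (rule continuous_on_tendsto_compose) auto
    then have c: "((\<lambda>n. indicator {n. P n} n) \<longlongrightarrow> f {n. P n}) U" by (simp add: ind_def)
    show ?thesis
    proof (cases "f {n. P n} > 0")
      case True
      show ?thesis
        by (rule disjI1, rule eventually_mono[OF order_tendstoD(1)[OF c True]])
          (auto simp: indicator_def split: if_splits)
    next
      case False
      then have "f {n. P n} < 1" by simp
      show ?thesis
        by (rule disjI2, rule eventually_mono[OF order_tendstoD(2)[OF c \<open>f {n. P n} < 1\<close>]])
          (auto simp: indicator_def split: if_splits)
    qed
  qed
  ultimately have "ultra U" by (simp add: ultra_def)
  moreover have "U \<le> sequentially" by (simp add: U_def)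
  ultimately show ?thesis by blast
qed

text \<open>If no point of \<open>K\<close> were a limit, each would have a neighbourhood that
  \<open>f\<close> eventually avoids, because \<open>U\<close> decides every set; finitely many of
  them cover \<open>K\<close>.\<close>

lemma ultra_limit:
  assumes U: "ultra U" and K: "compactin T K" and ev: "eventually (\<lambda>n. f n \<in> K) U"
  shows "\<exists>l\<in>K. limitin T f l U"
proof (rule ccontr)
  assume no: "\<not> (\<exists>l\<in>K. limitin T f l U)"
  have KT: "K \<subseteq> topspace T" using K by (simp add: compactin_def)
  have "\<exists>V. openin T V \<and> l \<in> V \<and> eventually (\<lambda>n. f n \<notin> V) U" if "l \<in> K" for l
    using no that KT U unfolding limitin_def ultra_def by blast
  then obtain V where V: "\<And>l. l \<in> K \<Longrightarrow> openin T (V l)" "\<And>l. l \<in> K \<Longrightarrow> l \<in> V l"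
      "\<And>l. l \<in> K \<Longrightarrow> eventually (\<lambda>n. f n \<notin> V l) U"
    by metis
  have "(\<forall>W\<in>V ` K. openin T W) \<and> K \<subseteq> \<Union>(V ` K)" using V by auto
  then obtain \<F> where F: "finite \<F>" "\<F> \<subseteq> V ` K" "K \<subseteq> \<Union>\<F>"
    using K unfolding compactin_def by meson
  have "eventually (\<lambda>n. \<forall>W\<in>\<F>. f n \<notin> W) U"
    using F(1,2) V(3) by (intro eventually_ball_finite) auto
  with ev have "eventually (\<lambda>_. False) U"
    by eventually_elim (use F(3) in blast)
  then show False using U by (simp add: ultra_def)
qed

lemma ultra_tendsto:
  fixes f :: "nat \<Rightarrow> real"
  assumes "ultra U" "\<And>n. a \<le> f n" "\<And>n. f n \<le> b"
  obtains l where "a \<le> l" "l \<le> b" "(f \<longlongrightarrow> l) U"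
  using ultra_limit[of U euclidean "{a..b}" f] assms by auto


section \<open>Local compactness implies properness\<close>

definition proper_metric :: "'a metric \<Rightarrow> bool" where
  "proper_metric Y \<longleftrightarrow> (\<forall>x\<in>mspace Y. \<forall>r. compactin (mtopology_of Y) (mcball_of Y x r))"

lemma (in cat0) shrink:
  assumes x: "x \<in> M" and z: "z \<in> M" and r: "0 \<le> r" and e: "0 \<le> e" "d x z \<le> r + e"
  shows "\<exists>w\<in>M. d x w \<le> r \<and> d w z \<le> e"
proof (cases "d x z \<le> r")
  case True
  then show ?thesis using z e by (intro bexI[of _ z]) auto
next
  case False
  then have q: "0 \<le> r / d x z" "r / d x z \<le> 1" "d x z > 0" using r by (auto simp: field_simps)
  show ?thesis
    using point_at[OF x z q(1,2)] q(3) e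
    by (intro bexI[of _ "point_at Y x z (r / d x z)"]) (auto simp: left_diff_distrib)
qed

text \<open>The radii with compact ball form an interval. It contains its finite supremum: along
  geodesics, points of the larger ball are close to a smaller compact ball, which gives total
  boundedness. It extends beyond it: a Lebesgue number for a cover by compact neighbourhoods allows
  a slightly larger radius.\<close>

lemma (in cat0) hopf_rinow:
  assumes complete: "mcomplete_of Y" and lc: "locally_compact_space (mtopology_of Y)"
  shows "proper_metric Y"
  unfolding proper_metric_def
proof (intro ballI allI)
  interpret Y: Metric_space M d by simp
  have top: "mtopology_of Y = Y.mtopology" and cb: "mcball_of Y = Y.mcball"
    by (simp_all add: mtopology_of_def mcball_of_def)
  have compl: "Y.mcomplete" using complete by (simp add: mcomplete_of_def)
  fix x r assume x: "x \<in> M"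
  define P where "P r \<longleftrightarrow> compactin Y.mtopology (Y.mcball x r)" for r
  have mono: "P s" if "P r" "s \<le> r" for r s
    using that closed_compactin[of Y.mtopology "Y.mcball x r" "Y.mcball x s"]
      Y.mcball_subset_concentric[of s r x]
    by (simp add: P_def)
  have P0: "P 0"
  proof -
    have "Y.mcball x 0 = {x}" using x by (auto simp: antisym_conv)
    then show ?thesis using x by (simp add: P_def)
  qed
  have limit: "P R" if R: "0 < R" "\<And>r. r < R \<Longrightarrow> P r" for R
  proof -
    have "Y.mtotally_bounded (Y.mcball x R)"
      unfolding Y.mtotally_bounded_def
    proof (intro allI impI)
      fix e :: real assume e: "0 < e"
      define r where "r = max 0 (R - e/2)"
      have r: "0 \<le> r" "r < R" "R \<le> r + e/2" using R e by (auto simp: r_def)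
      have "Y.mtotally_bounded (Y.mcball x r)"
        using R(2)[OF r(2)] by (simp add: P_def Y.compactin_imp_mtotally_bounded)
      then obtain K where K: "finite K" "K \<subseteq> Y.mcball x r" "Y.mcball x r \<subseteq> (\<Union>k\<in>K. Y.mball k (e/2))"
        unfolding Y.mtotally_bounded_def using e by (metis half_gt_zero)
      have "Y.mcball x R \<subseteq> (\<Union>k\<in>K. Y.mball k e)"
      proof
        fix z assume z: "z \<in> Y.mcball x R"
        then have "z \<in> M" "d x z \<le> r + e/2" using r by auto
        then obtain w where w: "w \<in> M" "d x w \<le> r" "d w z \<le> e/2"
          using shrink[of x z r "e/2"] x r e by auto
        then obtain k where k: "k \<in> K" "w \<in> Y.mball k (e/2)" using K(3) x by auto
        then have "d k z \<le> d k w + d w z" using w \<open>z \<in> M\<close> by (intro mdist_triangle) auto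
        then show "z \<in> (\<Union>k\<in>K. Y.mball k e)" using k w \<open>z \<in> M\<close> by (auto intro!: bexI[of _ k])
      qed
      moreover have "K \<subseteq> Y.mcball x R" using K(2) r by auto
      ultimately show "\<exists>K. finite K \<and> K \<subseteq> Y.mcball x R \<and> Y.mcball x R \<subseteq> (\<Union>k\<in>K. Y.mball k e)"
        using K(1) by blast
    qed
    then have "compactin Y.mtopology (Y.mtopology closure_of (Y.mcball x R))"
      using Y.mtotally_bounded_eq_compact_closure_of[OF compl] by simp
    then show ?thesis by (simp add: P_def closure_of_closedin)
  qed
  have extend: "\<exists>e>0. P (r + e)" if r: "0 \<le> r" "P r" for r
  proof -
    let ?C = "Y.mcball x r"
    have "\<exists>V K. openin Y.mtopology V \<and> compactin Y.mtopology K \<and> z \<in> V \<and> V \<subseteq> K" if "z \<in> M" for z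
      using lc that by (simp add: locally_compact_space_def top)
    then obtain V K where VK: "\<And>z. z \<in> M \<Longrightarrow> openin Y.mtopology (V z)"
        "\<And>z. z \<in> M \<Longrightarrow> compactin Y.mtopology (K z)" "\<And>z. z \<in> M \<Longrightarrow> z \<in> V z" "\<And>z. z \<in> M \<Longrightarrow> V z \<subseteq> K z"
      by metis
    have "(\<forall>W\<in>V ` ?C. openin Y.mtopology W) \<and> ?C \<subseteq> \<Union>(V ` ?C)"
      using VK by auto
    then obtain \<F> where F: "finite \<F>" "\<F> \<subseteq> V ` ?C" "?C \<subseteq> \<Union>\<F>"
      using r(2) unfolding P_def compactin_def by meson
    obtain D where D: "finite D" "D \<subseteq> ?C" "\<F> = V ` D"
      using finite_subset_image[OF F(1,2)] by blast
    have DM: "z \<in> M" if "z \<in> D" for z using D that by auto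
    obtain e where e: "0 < e" "\<And>z. z \<in> ?C \<Longrightarrow> \<exists>W\<in>V ` D. Y.mball z e \<subseteq> W"
      using Y.lebesgue_number[of ?C "V ` D"] r(2) F(3) D VK(1) DM unfolding P_def by blast
    have sub: "Y.mcball x (r + e/2) \<subseteq> (\<Union>z\<in>D. K z)"
    proof
      fix z assume "z \<in> Y.mcball x (r + e/2)"
      then have "z \<in> M" "d x z \<le> r + e/2" by auto
      then obtain w where w: "w \<in> M" "d x w \<le> r" "d w z \<le> e/2"
        using shrink[of x z r "e/2"] x r e by auto
      then obtain W where "W \<in> V ` D" "Y.mball w e \<subseteq> W" using e(2)[of w] x by fastforce
      moreover have "z \<in> Y.mball w e" using w \<open>z \<in> M\<close> e by auto
      ultimately show "z \<in> (\<Union>z\<in>D. K z)" using VK(4) DM by blast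
    qed
    have "compactin Y.mtopology (\<Union>z\<in>D. K z)"
      using D(1) VK(2) DM by (intro compactin_Union) auto
    then have "P (r + e/2)"
      unfolding P_def using sub by (rule closed_compactin) simp
    then show ?thesis using e by (intro exI[of _ "e/2"]) auto
  qed
  have "P r" for r
  proof (rule ccontr)
    assume "\<not> P r"
    define S where "S = {s. 0 \<le> s \<and> P s}"
    have bd: "s \<le> r" if "s \<in> S" for s using that mono[of s r] \<open>\<not> P r\<close> by (force simp: S_def)
    then have bdd: "bdd_above S" by (auto simp: bdd_above_def)
    have 0: "0 \<in> S" using P0 by (simp add: S_def)
    have less: "P s" if "s < Sup S" for s
    proof -
      obtain u where "u \<in> S" "s < u" using less_cSup_iff[OF _ bdd, of s] 0 \<open>s < Sup S\<close> by blast
      then show ?thesis using mono[of u s] by (auto simp: S_def)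
    qed
    have "0 \<le> Sup S" using cSup_upper[OF 0 bdd] .
    then have "P (Sup S)" using limit[of "Sup S"] less P0 by (cases "Sup S = 0") auto
    then obtain e where "e > 0" "P (Sup S + e)" using extend \<open>0 \<le> Sup S\<close> by blast
    then have "Sup S + e \<in> S" using \<open>0 \<le> Sup S\<close> by (simp add: S_def)
    then show False using cSup_upper[OF _ bdd, of "Sup S + e"] \<open>e > 0\<close> by simp
  qed
  then show "compactin (mtopology_of Y) (mcball_of Y x r)" by (simp add: P_def top cb)
qed

section \<open>Flat half-planes\<close>

text \<open>The parameter \<open>t\<close> is the midpoint of \<open>u\<close> and its reflection
  \<open>v\<close>. A strict inequality at \<open>u\<close> or at \<open>v\<close> would, by
  \<open>CN_line\<close>, give a strict one at \<open>t\<close>.\<close>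

lemma (in cat0_line) CN_rigid:
  assumes q: "q \<in> M"
    and le: "\<And>u. (d q (\<sigma> u))\<^sup>2 \<le> E u" and eq: "(d q (\<sigma> t))\<^sup>2 = E t"
    and E: "\<And>u v. E ((u + v) / 2) = E u / 2 + E v / 2 - (u - v)\<^sup>2 / 4"
  shows "(d q (\<sigma> u))\<^sup>2 = E u"
proof -
  define v where "v = 2 * t - u"
  have uv: "(u + v) / 2 = t" by (simp add: v_def)
  have "(d q (\<sigma> ((1 - 1/2) * u + 1/2 * v)))\<^sup>2 \<le>
      (1 - 1/2) * (d q (\<sigma> u))\<^sup>2 + 1/2 * (d q (\<sigma> v))\<^sup>2 - 1/2 * (1 - 1/2) * (u - v)\<^sup>2"
    by (rule CN_line[OF q]) auto
  moreover have "(1 - 1/2) * u + 1/2 * v = t" using uv by (simp add: field_simps)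
  ultimately have "E t \<le> (d q (\<sigma> u))\<^sup>2 / 2 + (d q (\<sigma> v))\<^sup>2 / 2 - (u - v)\<^sup>2 / 4"
    using eq by simp
  moreover have "E t = E u / 2 + E v / 2 - (u - v)\<^sup>2 / 4" using E[of u v] by (simp add: uv)
  ultimately show ?thesis using le[of u] le[of v] by linarith
qed

text \<open>An isometric image of the half-plane is closed because the half-plane is complete, and
  convex because geodesics are unique.\<close>

lemma (in cat0) bounds_flat_half_planeI:
  fixes \<phi> :: "real \<times> real \<Rightarrow> 'a"
  assumes complete: "mcomplete_of Y"
    and in_M: "\<And>p. p \<in> {0..} \<times> UNIV \<Longrightarrow> \<phi> p \<in> M"
    and iso: "\<And>p q. p \<in> {0..} \<times> UNIV \<Longrightarrow> q \<in> {0..} \<times> UNIV \<Longrightarrow> d (\<phi> p) (\<phi> q) = dist p q"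
    and bd: "\<And>t. \<phi> (0, t) = \<sigma> t"
  shows "bounds_flat_half_plane Y \<sigma>"
proof -
  interpret Y: Metric_space M d by simp
  have top: "mtopology_of Y = Y.mtopology" by (simp add: mtopology_of_def)
  let ?H = "{0..} \<times> UNIV :: (real \<times> real) set"
  have "inj_on \<phi> ?H"
  proof (rule inj_onI)
    fix p q assume "p \<in> ?H" "q \<in> ?H" "\<phi> p = \<phi> q"
    then show "p = q" using iso[of p q] in_M[of q] by simp
  qed
  moreover have "closedin (mtopology_of Y) (\<phi> ` ?H)"
    unfolding top Y.metric_closedin_iff_sequentially_closed
  proof (intro conjI allI impI)
    show "\<phi> ` ?H \<subseteq> M" using in_M by blast
  next
    fix y l assume "range y \<subseteq> \<phi> ` ?H \<and> limitin Y.mtopology y l sequentially"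
    then have y: "\<And>n. \<exists>p\<in>?H. y n = \<phi> p" and lim: "limitin Y.mtopology y l sequentially"
      by (auto simp: image_iff subset_iff)
    obtain p where p: "\<And>n. p n \<in> ?H" "\<And>n. y n = \<phi> (p n)" using y by metis
    have "range y \<subseteq> M" using p(2) in_M[OF p(1)] by auto
    then have "Y.MCauchy y" using lim Y.convergent_imp_MCauchy by blast
    then have "Cauchy p"
      unfolding Y.MCauchy_def Cauchy_def using p iso by (simp add: p)
    then obtain q where q: "p \<longlonglongrightarrow> q" by (auto simp: Cauchy_convergent_iff convergent_def)
    have "closed ?H" by (intro closed_Times) auto
    then have qH: "q \<in> ?H" using p(1) q by (rule closed_sequentially)
    have "(\<lambda>n. dist (p n) q) \<longlonglongrightarrow> 0" using q by (rule tendsto_dist_iff[THEN iffD1])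
    then have "(\<lambda>n. d (y n) (\<phi> q)) \<longlonglongrightarrow> 0" using p iso qH by simp
    then have "limitin Y.mtopology y (\<phi> q) sequentially"
      unfolding Y.limitin_metric_dist_null using in_M qH p by auto
    then have "l = \<phi> q" using lim Y.limitin_metric_unique by (metis sequentially_bot)
    then show "l \<in> \<phi> ` ?H" using qH by blast
  qed
  moreover have "geodesically_convex Y (\<phi> ` ?H)"
    unfolding geodesically_convex_def
  proof (intro ballI allI impI)
    fix x y \<tau> assume "x \<in> \<phi> ` ?H" "y \<in> \<phi> ` ?H" and t: "geodesic_joining Y x y \<tau>"
    then obtain p q where p: "p \<in> ?H" "x = \<phi> p" and q: "q \<in> ?H" "y = \<phi> q" by blast
    have xy: "x \<in> M" "y \<in> M" using p q in_M by auto
    show "\<tau> ` {0..d x y} \<subseteq> \<phi> ` ?H"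
    proof
      fix z assume "z \<in> \<tau> ` {0..d x y}"
      then obtain s where s: "0 \<le> s" "s \<le> d x y" "z = \<tau> s" by auto
      define r where "r = (if d x y = 0 then 0 else s / d x y)"
      have r: "0 \<le> r" "r \<le> 1" "s = r * d x y" using s by (auto simp: r_def field_simps)
      define m where "m = (1 - r) *\<^sub>R p + r *\<^sub>R q"
      have "convex ?H" by (intro convex_Times) (auto intro: convex_real_interval)
      then have m: "m \<in> ?H"
        unfolding m_def using p q r by (intro convexD) auto
      have pm: "p - m = r *\<^sub>R (p - q)" and mq: "m - q = (1 - r) *\<^sub>R (p - q)"
        by (auto simp: m_def algebra_simps)
      have "\<phi> m = point_at Y x y r"
      proof (rule point_at_unique)
        show "d x (\<phi> m) = r * d x y" "d (\<phi> m) y = (1 - r) * d x y"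
          using p q m r iso by (simp_all add: dist_norm pm mq)
      qed (use xy m in_M r in auto)
      also have "\<dots> = z" using geodesic_joining_point_at[OF t xy r(1,2)] r s by simp
      finally show "z \<in> \<phi> ` ?H" using m by blast
    qed
  qed
  moreover have "\<phi> ` ({0} \<times> UNIV) = range \<sigma>"
  proof -
    have "({0} \<times> UNIV :: (real \<times> real) set) = range (Pair 0)" by auto
    then show ?thesis using bd by (simp add: image_image)
  qed
  ultimately show ?thesis
    unfolding bounds_flat_half_plane_def bij_betw_def using iso by blast
qed

text \<open>
  Euclidean squared distance of the points at height \<open>s\<close> and \<open>s'\<close> on parallel rays that start
  at the points \<open>t\<close> and \<open>t'\<close> of a line; \<open>- L\<close> is the cosine of their angle with the line.
\<close>

definition sector :: "real \<Rightarrow> real \<Rightarrow> real \<Rightarrow> real \<Rightarrow> real \<Rightarrow> real" where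
  "sector L t s t' s' = (L * (t - t') - s + s')\<^sup>2 + (t - t')\<^sup>2 - (L * (t - t'))\<^sup>2"

lemma sector_line: "sector L t s ((u + v) / 2) s' = sector L t s u s' / 2 + sector L t s v s' / 2 - (u - v)\<^sup>2 / 4"
  unfolding sector_def by (simp add: power2_eq_square field_simps)

lemma sector_same: "sector L t s t s' = (s - s')\<^sup>2"
  by (simp add: sector_def power2_commute)

text \<open>
  The limits \<open>\<rho> t\<close> of the geodesics from \<open>\<sigma> t\<close> to \<open>x n\<close> then sweep out a flat
  half-plane: comparison triangles with apex \<open>x n\<close> bound the distances from above, and
  rigidity in the inequality of Bruhat and Tits gives equality.
\<close>

theorem (in cat0_line) flat_half_plane_limit:
  assumes complete: "mcomplete_of Y" and proper: "proper_metric Y" and U: "ultra U"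
    and x: "\<And>n. x n \<in> M"
    and far: "filterlim (\<lambda>n. d (x n) (\<sigma> 0)) at_top U"
    and slope: "\<And>t. ((\<lambda>n. d (x n) (\<sigma> t) - d (x n) (\<sigma> 0)) \<longlongrightarrow> L * t) U"
    and L: "\<bar>L\<bar> < 1"
  shows "bounds_flat_half_plane Y \<sigma>"
proof -
  interpret Y: Metric_space M d by simp
  have top: "mtopology_of Y = Y.mtopology" by (simp add: mtopology_of_def)
  have Ub: "U \<noteq> bot" using U by (simp add: ultra_def)
  define D where "D n t = d (\<sigma> t) (x n)" for n t
  have far': "filterlim (\<lambda>n. D n t) at_top U" for t
  proof -
    have "filterlim (\<lambda>n. (d (x n) (\<sigma> t) - d (x n) (\<sigma> 0)) + d (x n) (\<sigma> 0)) at_top U"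
      by (rule filterlim_tendsto_add_at_top[OF slope far])
    then show ?thesis by (simp add: D_def mdist_commute)
  qed
  have ev: "eventually (\<lambda>n. D n t > B) U" for t B
    using far'[of t] by (simp add: filterlim_at_top_dense)
  have slope': "((\<lambda>n. D n t - D n t') \<longlongrightarrow> L * (t - t')) U" for t t'
    using tendsto_diff[OF slope[of t] slope[of t']] by (simp add: D_def mdist_commute algebra_simps)
  \<comment> \<open>The point at distance \<open>s\<close> from \<open>\<sigma> t\<close> towards
    \<open>x n\<close>. The default \<open>\<sigma> t\<close> keeps it in the ball of radius
    \<open>\<bar>s\<bar>\<close> for every \<open>n\<close>; for nonnegative \<open>s\<close> it no
    longer matters along \<open>U\<close>, as \<open>D n t\<close> tends to infinity.\<close>
  define pt where "pt n t s = (if s \<le> D n t \<and> 0 \<le> s then point_at Y (\<sigma> t) (x n) (s / D n t) else \<sigma> t)" for n t s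
  have pt_in: "pt n t s \<in> M" for n t s
    using x by (auto simp: pt_def D_def intro!: point_at_in divide_le_eq_1[THEN iffD2])
  have pt_dist: "d (\<sigma> t) (pt n t s) = s" if "s < D n t" "0 \<le> s" for n t s
  proof -
    have "0 < D n t" using that by simp
    then have "d (\<sigma> t) (point_at Y (\<sigma> t) (x n) (s / D n t)) = s / D n t * D n t"
      using that dist_point_at_left[of "\<sigma> t" "x n" "s / D n t"] x by (simp add: D_def)
    then show ?thesis using that \<open>0 < D n t\<close> by (simp add: pt_def)
  qed
  have pt_far: "d (\<sigma> t) (pt n t s) \<le> \<bar>s\<bar>" for n t s
    using dist_point_at_left[of "\<sigma> t" "x n" "s / D n t"] x
    by (cases "D n t = 0") (auto simp: pt_def D_def)
  have "\<exists>l. limitin Y.mtopology (\<lambda>n. pt n t s) l U" for t s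
  proof -
    have "compactin (mtopology_of Y) (mcball_of Y (\<sigma> t) \<bar>s\<bar>)" using proper by (simp add: proper_metric_def)
    moreover have "eventually (\<lambda>n. pt n t s \<in> mcball_of Y (\<sigma> t) \<bar>s\<bar>) U"
      using pt_in pt_far by simp
    ultimately show ?thesis
      using ultra_limit[OF U, of "mtopology_of Y" "mcball_of Y (\<sigma> t) \<bar>s\<bar>" "\<lambda>n. pt n t s"]
      unfolding top by blast
  qed
  then obtain \<rho> where \<rho>: "\<And>t s. limitin Y.mtopology (\<lambda>n. pt n t s) (\<rho> t s) U" by metis
  have \<rho>_in [simp]: "\<rho> t s \<in> M" for t s using \<rho> Y.limitin_mspace by blast
  have null: "((\<lambda>n. d (pt n t s) (\<rho> t s)) \<longlongrightarrow> 0) U" for t s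
    using \<rho>[of t s] by (simp add: Y.limitin_metric_dist_null)
  have lim: "((\<lambda>n. d (pt n t s) (pt n t' s')) \<longlongrightarrow> d (\<rho> t s) (\<rho> t' s')) U" for t s t' s'
  proof -
    have "\<bar>d (pt n t s) (pt n t' s') - d (\<rho> t s) (\<rho> t' s')\<bar> \<le> d (pt n t s) (\<rho> t s) + d (pt n t' s') (\<rho> t' s')" for n
      using mdist_triangle[of "pt n t s" Y "\<rho> t s" "pt n t' s'"] mdist_triangle[of "\<rho> t s" Y "\<rho> t' s'" "pt n t' s'"]
        mdist_triangle[of "\<rho> t s" Y "pt n t s" "\<rho> t' s'"] mdist_triangle[of "pt n t s" Y "pt n t' s'" "\<rho> t' s'"] pt_in
      by (simp add: mdist_commute abs_le_iff)
    then have le: "\<forall>\<^sub>F n in U. norm (d (pt n t s) (pt n t' s') - d (\<rho> t s) (\<rho> t' s'))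
        \<le> norm (d (pt n t s) (\<rho> t s) + d (pt n t' s') (\<rho> t' s')) * 1"
      by (intro always_eventually allI) simp
    have "((\<lambda>n. d (pt n t s) (\<rho> t s) + d (pt n t' s') (\<rho> t' s')) \<longlongrightarrow> 0) U"
      using tendsto_add[OF null[of t s] null[of t' s']] by simp
    then have "((\<lambda>n. d (pt n t s) (pt n t' s') - d (\<rho> t s) (\<rho> t' s')) \<longlongrightarrow> 0) U"
      using le by (rule tendsto_0_le)
    then show ?thesis by (rule Lim_null[THEN iffD2])
  qed
  have \<rho>0: "\<rho> t 0 = \<sigma> t" for t
  proof -
    have "pt n t 0 = \<sigma> t" for n
      using x by (simp add: pt_def)
    then have "((\<lambda>n. d (\<sigma> t) (\<rho> t 0)) \<longlongrightarrow> 0) U" using null[of t 0] by simp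
    then have "d (\<sigma> t) (\<rho> t 0) = 0" using Ub by (simp add: tendsto_const_iff)
    then show ?thesis by simp
  qed
  have ray: "d (\<sigma> t) (\<rho> t s) = s" if "0 \<le> s" for t s
  proof -
    have "((\<lambda>n. d (pt n t 0) (pt n t s)) \<longlongrightarrow> s) U"
    proof (rule tendsto_eventually)
      show "\<forall>\<^sub>F n in U. d (pt n t 0) (pt n t s) = s"
        using ev[of s t]
      proof eventually_elim
        case (elim n)
        then have "pt n t 0 = \<sigma> t" using pt_dist[of 0 n t] pt_in[of n t 0] that by auto
        then show ?case using pt_dist elim that by simp
      qed
    qed
    then show ?thesis using lim[of t 0 t s] Ub by (simp add: \<rho>0 tendsto_unique)
  qed
  have upper: "(d (\<rho> t s) (\<rho> t' s'))\<^sup>2 \<le> sector L t s t' s'" if s: "0 \<le> s" "0 \<le> s'" for t s t' s'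
  proof (rule tendsto_le[OF Ub])
    show "((\<lambda>n. (d (pt n t s) (pt n t' s'))\<^sup>2) \<longlongrightarrow> (d (\<rho> t s) (\<rho> t' s'))\<^sup>2) U"
      by (intro tendsto_intros lim)
    have frac: "((\<lambda>n. 1 - s / D n t) \<longlongrightarrow> 1 - 0) U" for s t
      by (intro tendsto_diff tendsto_const real_tendsto_divide_at_top[OF tendsto_const far'])
    have "((\<lambda>n. (D n t - D n t' - s + s')\<^sup>2 + (1 - s / D n t) * (1 - s' / D n t') * ((t - t')\<^sup>2 - (D n t - D n t')\<^sup>2))
      \<longlongrightarrow> (L * (t - t') - s + s')\<^sup>2 + (1 - 0) * (1 - 0) * ((t - t')\<^sup>2 - (L * (t - t'))\<^sup>2)) U"
      by (intro tendsto_intros slope' frac)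
    then show "((\<lambda>n. (D n t - D n t' - s + s')\<^sup>2 + (1 - s / D n t) * (1 - s' / D n t') * ((t - t')\<^sup>2 - (D n t - D n t')\<^sup>2))
      \<longlongrightarrow> sector L t s t' s') U"
      by (simp add: sector_def add_diff_eq)
    show "\<forall>\<^sub>F n in U. (d (pt n t s) (pt n t' s'))\<^sup>2 \<le> (D n t - D n t' - s + s')\<^sup>2
        + (1 - s / D n t) * (1 - s' / D n t') * ((t - t')\<^sup>2 - (D n t - D n t')\<^sup>2)"
      using ev[of s t] ev[of s' t']
    proof eventually_elim
      case (elim n)
      \<comment> \<open>Fractions measured from \<open>x n\<close>, which is the centre of the hinge
        in \<open>fan\<close>; both tend to 1 along \<open>U\<close>.\<close>
      define a b where "a = 1 - s / D n t" and "b = 1 - s' / D n t'"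
      have pos: "D n t > 0" "D n t' > 0" using elim s by auto
      have ab: "0 \<le> a" "a \<le> 1" "0 \<le> b" "b \<le> 1" using elim s pos by (auto simp: a_def b_def)
      have aD: "a * D n t = D n t - s" and bD: "b * D n t' = D n t' - s'"
        using pos by (auto simp: a_def b_def left_diff_distrib)
      have "pt n t s = point_at Y (x n) (\<sigma> t) a" "pt n t' s' = point_at Y (x n) (\<sigma> t') b"
        using elim s pos x by (auto simp: pt_def a_def b_def intro!: point_at_commute)
      then have "(d (pt n t s) (pt n t' s'))\<^sup>2 \<le> (a * D n t)\<^sup>2 + (b * D n t')\<^sup>2
          - a * b * ((D n t)\<^sup>2 + (D n t')\<^sup>2 - (t - t')\<^sup>2)"
        using fan[OF x line_in line_in ab, of n t t'] unfolding D_def line_dist power2_abs mdist_commute[of Y "x n"]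
        by simp
      also have "\<dots> = (a * D n t - b * D n t')\<^sup>2 + a * b * ((t - t')\<^sup>2 - (D n t - D n t')\<^sup>2)"
        by algebra
      also have "a * D n t - b * D n t' = D n t - D n t' - s + s'" using aD bD by simp
      finally show ?case by (simp add: a_def b_def)
    qed
  qed
  \<comment> \<open>The upper bound is attained at the start \<open>\<sigma> t\<close> of the ray,
    hence by rigidity on the whole line.\<close>
  have base: "(d (\<rho> t s) (\<sigma> u))\<^sup>2 = sector L t s u 0" if s: "0 \<le> s" for t s u
  proof (rule CN_rigid[where t = t and E = "\<lambda>u. sector L t s u 0"])
    show "(d (\<rho> t s) (\<sigma> u))\<^sup>2 \<le> sector L t s u 0" for u using upper[OF s, of 0 t u] by (simp add: \<rho>0)
    show "(d (\<rho> t s) (\<sigma> t))\<^sup>2 = sector L t s t 0"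
      using ray[OF s, of t] by (simp add: mdist_commute sector_same)
  qed (simp_all add: sector_line)
  \<comment> \<open>Both diagonals and three sides of the quadrilateral over
    \<open>\<sigma> t\<close> and \<open>\<sigma> t'\<close> are known, so
    \<open>quadrilateral\<close> bounds the fourth side from below. Now rigidity applies along lines
    at any height.\<close>
  have lines: "geodesic_on Y UNIV (\<lambda>u. \<rho> u s)" if s: "0 \<le> s" for s
    unfolding geodesic_on_def
  proof (intro conjI ballI)
    fix t t'
    have "(d (\<rho> t s) (\<sigma> t'))\<^sup>2 + (d (\<rho> t' s) (\<sigma> t))\<^sup>2 \<le>
      (d (\<rho> t s) (\<rho> t' s))\<^sup>2 + (d (\<rho> t' s) (\<sigma> t'))\<^sup>2 + (d (\<sigma> t') (\<sigma> t))\<^sup>2 + (d (\<sigma> t) (\<rho> t s))\<^sup>2"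
      using quadrilateral[of "\<rho> t s" "\<rho> t' s" "\<sigma> t'" "\<sigma> t"] by simp
    moreover have "(d (\<rho> t s) (\<sigma> t'))\<^sup>2 + (d (\<rho> t' s) (\<sigma> t))\<^sup>2 = 2 * s\<^sup>2 + 2 * (t - t')\<^sup>2"
      unfolding base[OF s] sector_def by (simp add: power2_eq_square algebra_simps)
    moreover have "(d (\<rho> t' s) (\<sigma> t'))\<^sup>2 = s\<^sup>2" "(d (\<sigma> t) (\<rho> t s))\<^sup>2 = s\<^sup>2"
      using ray[OF s] by (simp_all add: mdist_commute[of Y "\<rho> t' s"])
    ultimately have "(t - t')\<^sup>2 \<le> (d (\<rho> t s) (\<rho> t' s))\<^sup>2"
      by (simp add: line_dist power2_commute)
    moreover have "(d (\<rho> t s) (\<rho> t' s))\<^sup>2 \<le> (t - t')\<^sup>2" using upper[OF s s, of t t'] by (simp add: sector_def)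
    ultimately have "(d (\<rho> t s) (\<rho> t' s))\<^sup>2 = \<bar>t - t'\<bar>\<^sup>2" by simp
    then show "d (\<rho> t s) (\<rho> t' s) = \<bar>t - t'\<bar>" by (subst (asm) power2_eq_iff_nonneg) auto
  qed auto
  have all: "(d (\<rho> t s) (\<rho> t' s'))\<^sup>2 = sector L t s t' s'" if s: "0 \<le> s" "0 \<le> s'" for t s t' s'
  proof -
    interpret l: cat0_line Y "\<lambda>u. \<rho> u s'" using lines s by unfold_locales auto
    show ?thesis
    proof (rule l.CN_rigid[where t = t and E = "\<lambda>u. sector L t s u s'"])
      show "(d (\<rho> t s) (\<rho> t s'))\<^sup>2 = sector L t s t s'"
      proof -
        have "\<bar>s - s'\<bar> \<le> d (\<rho> t s) (\<rho> t s')"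
          using mdist_triangle[of "\<sigma> t" Y "\<rho> t s" "\<rho> t s'"] mdist_triangle[of "\<sigma> t" Y "\<rho> t s'" "\<rho> t s"] ray s
          by (simp add: mdist_commute abs_le_iff)
        then have "(s - s')\<^sup>2 \<le> (d (\<rho> t s) (\<rho> t s'))\<^sup>2" using abs_le_square_iff[of "s - s'" "d (\<rho> t s) (\<rho> t s')"] by simp
        then show ?thesis using upper[OF s, of t t] by (simp add: sector_same)
      qed
    qed (use upper s in \<open>auto simp: sector_line\<close>)
  qed
  define c where "c = sqrt (1 - L\<^sup>2)"
  have "L\<^sup>2 < 1" using L by (simp add: abs_square_less_1)
  then have c: "c > 0" "c\<^sup>2 = 1 - L\<^sup>2" by (auto simp: c_def)
  \<comment> \<open>Orthogonal coordinates: the ray from \<open>\<sigma> t\<close> drifts by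
    \<open>- L * s\<close> along the line and rises by \<open>c * s\<close>, so the point at
    position \<open>v\<close> and height \<open>u\<close> lies on the ray that starts at
    \<open>v + L * (u / c)\<close>.\<close>
  define \<phi> where "\<phi> p = \<rho> (snd p + L * (fst p / c)) (fst p / c)" for p
  show ?thesis
  proof (rule bounds_flat_half_planeI[OF complete, of \<phi>])
    show "\<phi> p \<in> M" for p by (simp add: \<phi>_def)
    show "\<phi> (0, t) = \<sigma> t" for t by (simp add: \<phi>_def \<rho>0)
    fix p q :: "real \<times> real" assume "p \<in> {0..} \<times> UNIV" "q \<in> {0..} \<times> UNIV"
    then obtain u v u' v' where p: "p = (u, v)" "u \<ge> 0" and q: "q = (u', v')" "u' \<ge> 0" by auto
    define e where "e = (u - u') / c"
    have "(d (\<phi> p) (\<phi> q))\<^sup>2 = sector L (v + L * (u / c)) (u / c) (v' + L * (u' / c)) (u' / c)"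
      using p q c by (simp add: \<phi>_def all)
    also have "\<dots> = (L * (v - v' + L * e) - e)\<^sup>2 + (v - v' + L * e)\<^sup>2 - (L * (v - v' + L * e))\<^sup>2"
      unfolding sector_def e_def by (simp add: diff_divide_distrib algebra_simps)
    also have "\<dots> = (v - v')\<^sup>2 + (1 - L\<^sup>2) * e\<^sup>2" by algebra
    also have "(1 - L\<^sup>2) * e\<^sup>2 = (u - u')\<^sup>2" using c by (simp add: e_def power_divide flip: c(2))
    finally have "d (\<phi> p) (\<phi> q) = sqrt ((u - u')\<^sup>2 + (v - v')\<^sup>2)"
      by (simp add: real_sqrt_unique add.commute)
    then show "d (\<phi> p) (\<phi> q) = dist p q"
      by (simp add: p q dist_Pair_Pair dist_real_def)
  qed
qed

section \<open>Rank one axes are contracting\<close>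

lemma chord_mono:
  fixes f :: "real \<Rightarrow> real"
  assumes f: "convex_on UNIV f" and "a < b" "c < e" "a \<le> c" "b \<le> e"
  shows "(f b - f a) / (b - a) \<le> (f e - f c) / (e - c)"
proof -
  have sl: "(f y - f x) / (y - x) = (f x - f y) / (x - y)" for x y
    by (metis minus_diff_eq minus_divide_divide)
  have "(f b - f a) / (b - a) \<le> (f e - f a) / (e - a)"
    using convex_on_slope_le(1)[OF f, of a e b] assms unfolding sl[of b] sl[of e]
    by (cases "b = e") auto
  also have "\<dots> \<le> (f e - f c) / (e - c)"
    using convex_on_slope_le(2)[OF f, of a e c] assms unfolding sl[of e]
    by (cases "a = c") auto
  finally show ?thesis .
qed

text \<open>Right of the minimum, each step of length \<open>N\<close> either raises the increment
  over the next step by 1 or shows that it already exceeds \<open>q * N\<close>; the third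
  alternative would mean a decrease. Convexity preserves what has been reached.\<close>

lemma convex_slope_growth:
  fixes f :: "real \<Rightarrow> real"
  assumes f: "convex_on UNIV f" and N: "0 < N" and q: "0 \<le> q" "q \<le> 1" and min: "\<And>t. f p \<le> f t"
    and step: "\<And>t. 1 \<le> f (t + real N) + f (t - real N) - 2 * f t
      \<or> q * real N < f (t + real N) - f t \<or> q * real N < f (t - real N) - f t"
    and t: "p + real N * (real N + 1) \<le> t1" "t1 \<le> t2"
  shows "q * (t2 - t1) \<le> f t2 - f t1"
proof -
  define S where "S t = f (t + real N) - f t" for t
  have Sp: "0 \<le> S t" if "p \<le> t" for t
  proof -
    have "0 \<le> (f (p + real N) - f p) / real N" using min N by simp
    also have "\<dots> \<le> S t / real N"
      using chord_mono[OF f, of p "p + real N" t "t + real N"] that N by (simp add: S_def)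
    finally show ?thesis using N by (simp add: zero_le_divide_iff)
  qed
  have grow: "min (real j) (q * real N) \<le> S (p + real j * real N)" for j
  proof (induction j)
    case 0
    then show ?case using Sp[of p] by simp
  next
    case (Suc j)
    define t where "t = p + real (Suc j) * real N"
    have e: "t - real N = p + real j * real N" by (simp add: t_def algebra_simps)
    have "0 \<le> S (t - real N)" using Sp e by simp
    moreover have "0 \<le> q * real N" using q by simp
    moreover have "min (real j) (q * real N) \<le> S (t - real N)" using Suc e by simp
    ultimately show ?case
      using step[of t] by (auto simp: S_def t_def min_def split: if_splits)
  qed
  show ?thesis
  proof (cases "t1 = t2")
    case False
    \<comment> \<open>After \<open>N\<close> steps the increment is at least \<open>q * N\<close>,
      because \<open>q\<close> is at most 1. One more step of length \<open>N\<close> is the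
      remainder of the constant \<open>N * (N + 1)\<close>.\<close>
    define u where "u = p + real N * real N"
    have "q * real N \<le> S u" using grow[of N] q N by (simp add: u_def min_def mult_left_le_one_le split: if_splits)
    then have "q \<le> (f (u + real N) - f u) / (u + real N - u)"
      using N by (simp add: S_def field_simps)
    also have "\<dots> \<le> (f t2 - f t1) / (t2 - t1)"
      using t False N by (intro chord_mono[OF f]) (auto simp: u_def algebra_simps)
    finally show ?thesis using t False by (simp add: field_simps)
  qed simp
qed

section \<open>Uniform convexity of distance functions along an axis\<close>

locale axial = cat0_line +
  fixes h :: "'a \<Rightarrow> 'a" and l :: real
  assumes iso: "isometry_on Y h" and onto: "h ` mspace Y = mspace Y" and ax: "axis_of Y h l \<sigma>"
begin

lemma h_dist: "x \<in> M \<Longrightarrow> y \<in> M \<Longrightarrow> d (h x) (h y) = d x y"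
  using iso by (simp add: isometry_on_def)

lemma h_in: "x \<in> M \<Longrightarrow> h x \<in> M"
  using onto by blast

lemma h_line: "h (\<sigma> t) = \<sigma> (t + l)"
  using ax by (simp add: axis_of_def)

lemma l_pos: "0 < l"
  using ax by (simp add: axis_of_def)

text \<open>Only the distances to the axis are kept. For positive \<open>k\<close> the new point is
  a preimage, provided by surjectivity of \<open>h\<close>.\<close>

lemma translate:
  assumes "x \<in> M"
  shows "\<exists>y\<in>M. \<forall>t. d y (\<sigma> t) = d x (\<sigma> (t + of_int k * l))"
proof (induction k rule: int_induct[where k = 0])
  case base
  show ?case using assms by auto
next
  case (step1 i)
  then obtain y where y: "y \<in> M" "\<And>t. d y (\<sigma> t) = d x (\<sigma> (t + of_int i * l))" by blast
  obtain z where z: "z \<in> M" "y = h z" using y(1) onto by blast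
  have "d z (\<sigma> t) = d y (\<sigma> (t + l))" for t
    using h_dist[OF z(1) line_in] z by (simp add: h_line)
  then show ?case using z(1) y(2) by (intro bexI[of _ z]) (auto simp: algebra_simps)
next
  case (step2 i)
  then obtain y where y: "y \<in> M" "\<And>t. d y (\<sigma> t) = d x (\<sigma> (t + of_int i * l))" by blast
  have "d (h y) (\<sigma> t) = d y (\<sigma> (t - l))" for t
    using h_dist[OF y(1) line_in[of "t - l"]] by (simp add: h_line)
  then show ?case using h_in[OF y(1)] y(2) by (intro bexI[of _ "h y"]) (auto simp: algebra_simps)
qed

text \<open>
  If the distance functions to the axis were almost affine with slope bounded away from \<open>\<plusminus>1\<close> on
  long intervals, then translates of the base points and a limit would yield a flat half-plane.
\<close>

lemma uniform_convexity:
  assumes complete: "mcomplete_of Y" and proper: "proper_metric Y"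
    and nb: "\<not> bounds_flat_half_plane Y \<sigma>" and q: "0 \<le> q" "q < 1"
  shows "\<exists>N>0. \<forall>x\<in>M. \<forall>t. 1 \<le> d x (\<sigma> (t + real N)) + d x (\<sigma> (t - real N)) - 2 * d x (\<sigma> t)
      \<or> q * real N < d x (\<sigma> (t + real N)) - d x (\<sigma> t) \<or> q * real N < d x (\<sigma> (t - real N)) - d x (\<sigma> t)"
proof (rule ccontr)
  assume no: "\<not> ?thesis"
  have "\<exists>x\<in>M. \<exists>t. 0 \<le> t \<and> t \<le> l \<and> d x (\<sigma> (t + real (Suc n))) + d x (\<sigma> (t - real (Suc n))) - 2 * d x (\<sigma> t) < 1
      \<and> d x (\<sigma> (t + real (Suc n))) - d x (\<sigma> t) \<le> q * real (Suc n)
      \<and> d x (\<sigma> (t - real (Suc n))) - d x (\<sigma> t) \<le> q * real (Suc n)" for n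
  proof -
    obtain x t where x: "x \<in> M" and t: "d x (\<sigma> (t + real (Suc n))) + d x (\<sigma> (t - real (Suc n))) - 2 * d x (\<sigma> t) < 1"
      "d x (\<sigma> (t + real (Suc n))) - d x (\<sigma> t) \<le> q * real (Suc n)"
      "d x (\<sigma> (t - real (Suc n))) - d x (\<sigma> t) \<le> q * real (Suc n)"
      using no by (metis not_le zero_less_Suc)
    \<comment> \<open>A power of \<open>h\<close> moves the parameter into one period
      \<open>[0, l]\<close>, so that the flat intervals grow around a fixed part of the
      axis.\<close>
    define k where "k = \<lfloor>t / l\<rfloor>"
    define u where "u = t - of_int k * l"
    have u: "0 \<le> u" "u \<le> l"
      using floor_divide_lower[OF l_pos, of t] floor_divide_upper[OF l_pos, of t]
      by (simp_all add: u_def k_def algebra_simps)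
    obtain y where y: "y \<in> M" "\<And>s. d y (\<sigma> s) = d x (\<sigma> (s + of_int k * l))" using translate[OF x] by blast
    have "d y (\<sigma> (u + s)) = d x (\<sigma> (t + s))" for s by (simp add: y(2) u_def algebra_simps)
    from this[of "real (Suc n)"] this[of "- real (Suc n)"] this[of 0]
    have "d y (\<sigma> (u + real (Suc n))) = d x (\<sigma> (t + real (Suc n)))"
      "d y (\<sigma> (u - real (Suc n))) = d x (\<sigma> (t - real (Suc n)))" "d y (\<sigma> u) = d x (\<sigma> t)"
      by (simp_all del: of_nat_Suc)
    then show ?thesis using y(1) u t by metis
  qed
  then obtain x t where x: "\<And>n. x n \<in> M" and t: "\<And>n. 0 \<le> t n" "\<And>n. t n \<le> l"
    and flat: "\<And>n. d (x n) (\<sigma> (t n + real (Suc n))) + d (x n) (\<sigma> (t n - real (Suc n))) - 2 * d (x n) (\<sigma> (t n)) < 1"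
    and right: "\<And>n. d (x n) (\<sigma> (t n + real (Suc n))) - d (x n) (\<sigma> (t n)) \<le> q * real (Suc n)"
    and left: "\<And>n. d (x n) (\<sigma> (t n - real (Suc n))) - d (x n) (\<sigma> (t n)) \<le> q * real (Suc n)"
    by metis
  define f where "f n s = d (x n) (\<sigma> s)" for n s
  \<comment> \<open>Secant slopes on both sides of \<open>t n\<close> at scale \<open>Suc n\<close>.
    They lie in \<open>[-q, q]\<close> and differ by at most \<open>1 / Suc n\<close>, as the second
    difference is below 1.\<close>
  define b where "b n = (f n (t n + real (Suc n)) - f n (t n)) / real (Suc n)" for n
  define a where "a n = (f n (t n) - f n (t n - real (Suc n))) / real (Suc n)" for n
  have cf: "convex_on UNIV (f n)" for n unfolding f_def using convex_dist_line[OF x] .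
  have ab: "a n \<le> b n" for n
    using chord_mono[OF cf, of "t n - real (Suc n)" "t n" "t n" "t n + real (Suc n)" n]
    by (simp add: a_def b_def)
  have ba: "b n - a n \<le> 1 / real (Suc n)" for n
  proof -
    have "b n - a n = (f n (t n + real (Suc n)) + f n (t n - real (Suc n)) - 2 * f n (t n)) / real (Suc n)"
      by (simp add: a_def b_def diff_divide_distrib add_divide_distrib)
    also have "\<dots> \<le> 1 / real (Suc n)" using flat[of n] by (intro divide_right_mono) (auto simp: f_def)
    finally show ?thesis .
  qed
  have bq: "b n \<le> q" and aq: "- q \<le> a n" for n
    using right[of n] left[of n] by (auto simp: b_def a_def f_def field_simps simp del: of_nat_Suc)
  \<comment> \<open>Convexity squeezes every shorter secant through \<open>t n\<close> between the
    slopes \<open>a n\<close> and \<open>b n\<close>.\<close>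
  have near: "\<bar>f n s - f n (t n) - b n * (s - t n)\<bar> \<le> \<bar>s - t n\<bar> / real (Suc n)"
    if s: "\<bar>s - t n\<bar> < real (Suc n)" for n s
  proof (cases s "t n" rule: linorder_cases)
    case equal
    then show ?thesis by simp
  next
    case less
    have "a n \<le> (f n (t n) - f n s) / (t n - s)"
      using chord_mono[OF cf, of "t n - real (Suc n)" "t n" s "t n" n] less s by (simp add: a_def)
    moreover have "(f n (t n) - f n s) / (t n - s) \<le> b n"
      using chord_mono[OF cf, of s "t n" "t n" "t n + real (Suc n)" n] less by (simp add: b_def)
    ultimately have "\<bar>(f n (t n) - f n s) / (t n - s) - b n\<bar> \<le> 1 / real (Suc n)"
      using ba[of n] by simp
    then have "\<bar>(f n (t n) - f n s) / (t n - s) - b n\<bar> * (t n - s) \<le> 1 / real (Suc n) * (t n - s)"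
      using less by (intro mult_right_mono) auto
    moreover have "\<bar>(f n (t n) - f n s) / (t n - s) - b n\<bar> * (t n - s) = \<bar>((f n (t n) - f n s) / (t n - s) - b n) * (t n - s)\<bar>"
      using less by (simp add: abs_mult)
    moreover have "((f n (t n) - f n s) / (t n - s) - b n) * (t n - s) = - (f n s - f n (t n) - b n * (s - t n))"
      using less by (simp add: field_simps)
    ultimately show ?thesis using less by (simp only: abs_minus_cancel) simp
  next
    case greater
    have "(f n s - f n (t n)) / (s - t n) \<le> b n"
      using chord_mono[OF cf, of "t n" s "t n" "t n + real (Suc n)" n] greater s by (simp add: b_def)
    moreover have "a n \<le> (f n s - f n (t n)) / (s - t n)"
      using chord_mono[OF cf, of "t n - real (Suc n)" "t n" "t n" s n] greater by (simp add: a_def)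
    ultimately have "\<bar>(f n s - f n (t n)) / (s - t n) - b n\<bar> \<le> 1 / real (Suc n)"
      using ba[of n] by simp
    then have "\<bar>(f n s - f n (t n)) / (s - t n) - b n\<bar> * (s - t n) \<le> 1 / real (Suc n) * (s - t n)"
      using greater by (intro mult_right_mono) auto
    moreover have "\<bar>(f n s - f n (t n)) / (s - t n) - b n\<bar> * (s - t n) = \<bar>((f n s - f n (t n)) / (s - t n) - b n) * (s - t n)\<bar>"
      using greater by (simp add: abs_mult)
    moreover have "((f n s - f n (t n)) / (s - t n) - b n) * (s - t n) = f n s - f n (t n) - b n * (s - t n)"
      using greater by (simp add: field_simps)
    ultimately show ?thesis using greater by simp
  qed
  obtain U :: "nat filter" where U: "ultra U" "U \<le> sequentially" using ultra_exists by blast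
  obtain L where L: "- q \<le> L" "L \<le> q" "(b \<longlongrightarrow> L) U"
  proof (rule ultra_tendsto[OF U(1), of "- q" b q])
    show "- q \<le> b n" for n using ab[of n] aq[of n] by linarith
  qed (use bq in auto)
  have null: "((\<lambda>n. c / real (Suc n)) \<longlongrightarrow> 0) U" for c
    by (rule tendsto_mono[OF U(2)]) (rule LIMSEQ_Suc[OF lim_const_over_n])
  have slope: "((\<lambda>n. f n s - f n 0) \<longlongrightarrow> L * s) U" for s
  proof -
    have "((\<lambda>n. f n s - f n 0 - b n * s) \<longlongrightarrow> 0) U"
    proof (rule tendsto_0_le[OF null[of "\<bar>s\<bar> + 2 * l"], where K = 1])
      have "eventually (\<lambda>n. \<bar>s\<bar> + l < real (Suc n)) sequentially"
        by (meson eventually_sequentiallyI less_le_trans less_Suc_eq_le of_nat_le_iff order_less_imp_le reals_Archimedean2 le_SucI order_trans)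
      then have "eventually (\<lambda>n. \<bar>s\<bar> + l < real (Suc n)) U" using U(2) by (simp add: filter_leD)
      then show "\<forall>\<^sub>F n in U. norm (f n s - f n 0 - b n * s) \<le> norm ((\<bar>s\<bar> + 2 * l) / real (Suc n)) * 1"
      proof eventually_elim
        case (elim n)
        have "\<bar>s - t n\<bar> \<le> \<bar>s\<bar> + l" "\<bar>0 - t n\<bar> \<le> l" using t[of n] by auto
        then have "\<bar>s - t n\<bar> < real (Suc n)" "\<bar>0 - t n\<bar> < real (Suc n)" using elim by auto
        then have 1: "\<bar>f n s - f n (t n) - b n * (s - t n)\<bar> \<le> \<bar>s - t n\<bar> / real (Suc n)"
          "\<bar>f n 0 - f n (t n) - b n * (0 - t n)\<bar> \<le> \<bar>0 - t n\<bar> / real (Suc n)"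
          using near by blast+
        have "f n s - f n 0 - b n * s = (f n s - f n (t n) - b n * (s - t n)) - (f n 0 - f n (t n) - b n * (0 - t n))"
          by (simp add: algebra_simps)
        then have "\<bar>f n s - f n 0 - b n * s\<bar> \<le> \<bar>s - t n\<bar> / real (Suc n) + \<bar>0 - t n\<bar> / real (Suc n)"
          using 1 by linarith
        also have "\<dots> \<le> (\<bar>s\<bar> + 2 * l) / real (Suc n)"
          using t[of n] by (simp add: add_divide_distrib[symmetric] divide_right_mono)
        finally show ?case using l_pos by simp
      qed
    qed
    from tendsto_add[OF this tendsto_mult[OF L(3) tendsto_const[of s]]] show ?thesis by simp
  qed
  have far: "filterlim (\<lambda>n. f n 0) at_top U"
  proof (rule filterlim_at_top_mono)
    show "filterlim (\<lambda>n. - l + real n) at_top U"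
      by (rule filterlim_mono[OF _ order_refl U(2)])
        (rule filterlim_tendsto_add_at_top[OF tendsto_const filterlim_real_sequentially])
    \<comment> \<open>The points at \<open>t n + Suc n\<close> and \<open>t n - Suc n\<close> are
      \<open>2 * Suc n\<close> apart, and the mean of their distances from \<open>x n\<close>
      exceeds the distance at \<open>t n\<close> by less than 1/2.\<close>
    have "- l + real n \<le> f n 0" for n
    proof -
      have "2 * real (Suc n) \<le> f n (t n + real (Suc n)) + f n (t n - real (Suc n))"
        using mdist_triangle[of "\<sigma> (t n + real (Suc n))" Y "x n" "\<sigma> (t n - real (Suc n))"] x
        by (simp add: line_dist f_def mdist_commute)
      then have "real n \<le> f n (t n)" using flat[of n] by (simp add: f_def)
      moreover have "f n (t n) \<le> f n 0 + l"
        using lipschitz_line[OF x, of n "t n" 0] t[of n] by (simp add: f_def)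
      ultimately show ?thesis by simp
    qed
    then show "\<forall>\<^sub>F n in U. - l + real n \<le> f n 0" by (intro always_eventually) simp
  qed
  have "bounds_flat_half_plane Y \<sigma>"
    by (rule flat_half_plane_limit[OF complete proper U(1) x far[unfolded f_def] slope[unfolded f_def]])
      (use L q in auto)
  with nb show False by simp
qed

end

section \<open>Slopes of distance functions far from the foot\<close>

definition steep :: "'a metric \<Rightarrow> (real \<Rightarrow> 'a) \<Rightarrow> real \<Rightarrow> real \<Rightarrow> bool" where
  "steep Y \<sigma> q T \<longleftrightarrow> (\<forall>x\<in>mspace Y. \<forall>a s t. foot Y \<sigma> x a \<and>
     (a + T \<le> s \<and> s \<le> t \<or> t \<le> s \<and> s \<le> a - T) \<longrightarrow> q * \<bar>t - s\<bar> \<le> mdist Y x (\<sigma> t) - mdist Y x (\<sigma> s))"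

lemma steep_right:
  assumes "steep Y \<sigma> q T" "x \<in> mspace Y" "foot Y \<sigma> x a" "a + T \<le> s" "s \<le> t"
  shows "q * (t - s) \<le> mdist Y x (\<sigma> t) - mdist Y x (\<sigma> s)"
  using assms(1)[unfolded steep_def, rule_format, of x a s t] assms by simp

lemma steep_left:
  assumes "steep Y \<sigma> q T" "x \<in> mspace Y" "foot Y \<sigma> x a" "t \<le> s" "s \<le> a - T"
  shows "q * (s - t) \<le> mdist Y x (\<sigma> t) - mdist Y x (\<sigma> s)"
  using assms(1)[unfolded steep_def, rule_format, of x a s t] assms by simp

lemma (in axial) steep_ex:
  assumes "mcomplete_of Y" "proper_metric Y" "\<not> bounds_flat_half_plane Y \<sigma>" and q: "0 \<le> q" "q < 1"
  shows "\<exists>T\<ge>0. steep Y \<sigma> q T"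
proof -
  obtain N where N: "N > 0" and step: "\<And>x t. x \<in> M \<Longrightarrow>
      1 \<le> d x (\<sigma> (t + real N)) + d x (\<sigma> (t - real N)) - 2 * d x (\<sigma> t)
      \<or> q * real N < d x (\<sigma> (t + real N)) - d x (\<sigma> t) \<or> q * real N < d x (\<sigma> (t - real N)) - d x (\<sigma> t)"
    using uniform_convexity[OF assms] by blast
  interpret r: cat0_line Y "\<lambda>t. \<sigma> (- t)" by (rule reverse)
  have "steep Y \<sigma> q (real N * (real N + 1))"
    unfolding steep_def
  proof (intro ballI allI impI, elim conjE disjE)
    fix x a s t assume x: "x \<in> M" and a: "foot Y \<sigma> x a" and s: "a + real N * (real N + 1) \<le> s" "s \<le> t"
    show "q * \<bar>t - s\<bar> \<le> d x (\<sigma> t) - d x (\<sigma> s)"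
      using convex_slope_growth[OF convex_dist_line[OF x] N q(1) less_imp_le[OF q(2)] _ step[OF x] s]
        a s by (simp add: foot_def)
  next
    fix x a s t assume x: "x \<in> M" and a: "foot Y \<sigma> x a" and s: "t \<le> s" "s \<le> a - real N * (real N + 1)"
    have step': "1 \<le> d x (\<sigma> (- (t + real N))) + d x (\<sigma> (- (t - real N))) - 2 * d x (\<sigma> (- t))
      \<or> q * real N < d x (\<sigma> (- (t + real N))) - d x (\<sigma> (- t)) \<or> q * real N < d x (\<sigma> (- (t - real N))) - d x (\<sigma> (- t))" for t
      using step[OF x, of "- t"] by (auto simp: algebra_simps)
    have "q * (- t - (- s)) \<le> d x (\<sigma> (- (- t))) - d x (\<sigma> (- (- s)))"
    proof (rule convex_slope_growth[OF r.convex_dist_line[OF x] N q(1) less_imp_le[OF q(2)] _ step'])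
      show "d x (\<sigma> (- (- a))) \<le> d x (\<sigma> (- t))" for t using a by (simp add: foot_def)
    qed (use s in auto)
    then show "q * \<bar>t - s\<bar> \<le> d x (\<sigma> t) - d x (\<sigma> s)" using s by simp
  qed
  then show ?thesis by (intro exI[of _ "real N * (real N + 1)"]) simp
qed

text \<open>
  A formulation, by distances only, of the usual condition that the projections of balls
  disjoint from the line have bounded diameter.
\<close>

definition contracting :: "'a metric \<Rightarrow> (real \<Rightarrow> 'a) \<Rightarrow> real \<Rightarrow> bool" where
  "contracting Y \<sigma> K \<longleftrightarrow> (\<forall>x\<in>mspace Y. \<forall>y\<in>mspace Y. \<forall>a b. foot Y \<sigma> x a \<and> foot Y \<sigma> y b \<and> K \<le> \<bar>a - b\<bar> \<longrightarrow>
     mdist Y x (\<sigma> a) + \<bar>a - b\<bar> + mdist Y y (\<sigma> b) - K \<le> mdist Y x y)"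

section \<open>From slopes to contraction\<close>

context cat0_line
begin

text \<open>
  In Euclidean terms, the conclusion says that the comparison angle at \<open>\<sigma> c\<close> has cosine at most
  \<open>- 7/8\<close>: the directions from \<open>\<sigma> c\<close> to \<open>x\<close> and \<open>z\<close> are almost those of the line.
\<close>

lemma straight_at_line:
  assumes st: "steep Y \<sigma> (2047/2048) T" and T: "0 \<le> T" and x: "x \<in> M" and z: "z \<in> M"
    and a: "foot Y \<sigma> x a" and b: "foot Y \<sigma> z b" and c: "a + T + 1 \<le> c" "c + T + 1 \<le> b"
  shows "(d x (\<sigma> c))\<^sup>2 + (d z (\<sigma> c))\<^sup>2 + 7/4 * (d x (\<sigma> c) * d z (\<sigma> c)) \<le> (d x z)\<^sup>2"
proof -
  \<comment> \<open>With slope \<open>q\<close>, the squared chord at distance 1 from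
    \<open>\<sigma> c\<close> is at most \<open>2 * (1 - q)\<close>, which is
    \<open>(1/32)\<^sup>2\<close> for this value.\<close>
  define q :: real where "q = 2047/2048"
  have dir: "d (point_at Y (\<sigma> c) w (1 / d (\<sigma> c) w)) (\<sigma> s) \<le> 1/32 \<and> 1 \<le> d (\<sigma> c) w"
    if w: "w \<in> M" and f: "foot Y \<sigma> w e" and ec: "1 \<le> \<bar>c - e\<bar>" and s: "\<bar>c - s\<bar> = 1"
      and le: "d w (\<sigma> s) \<le> d w (\<sigma> c) - q" for w e s
  proof -
    let ?A = "d (\<sigma> c) w"
    have "1 \<le> \<bar>c - e\<bar>\<^sup>2" using ec by (rule one_le_power)
    then have "1\<^sup>2 \<le> (d w (\<sigma> c))\<^sup>2"
      using foot_pythagoras[OF w f, of c] zero_le_power2[of "d w (\<sigma> e)"]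
      unfolding power2_abs power_one by linarith
    then have "1 \<le> d w (\<sigma> c)" by (rule power2_le_imp_le) simp
    then have A: "1 \<le> ?A" by (simp add: mdist_commute)
    have s1: "d (\<sigma> c) (\<sigma> s) = 1" using s by (simp add: line_dist)
    let ?e = "d (point_at Y (\<sigma> c) w (1 / ?A)) (\<sigma> s)"
    have "?e\<^sup>2 * ?A \<le> 2 * ?A - (?A\<^sup>2 + 1 - (d w (\<sigma> s))\<^sup>2)"
      using fan_equal_length[OF line_in w line_in, of 1 c s] A by (simp add: s1)
    also have "\<dots> \<le> 2 * ?A - (?A\<^sup>2 + 1 - (?A - q)\<^sup>2)"
      using power_mono[OF le, of 2] by (simp add: mdist_commute)
    also have "\<dots> = 2 * (1 - q) * ?A + (q\<^sup>2 - 1)" by algebra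
    also have "\<dots> \<le> (1/32)\<^sup>2 * ?A" by (simp add: q_def power2_eq_square)
    finally have "?e\<^sup>2 \<le> (1/32)\<^sup>2" using A by simp
    then have "?e \<le> 1/32" by (rule power2_le_imp_le) simp
    then show ?thesis using A by simp
  qed
  have "q * (c - (c - 1)) \<le> d x (\<sigma> c) - d x (\<sigma> (c - 1))"
    using c unfolding q_def by (intro steep_right[OF st x a]) auto
  then have 1: "d (point_at Y (\<sigma> c) x (1 / d (\<sigma> c) x)) (\<sigma> (c - 1)) \<le> 1/32 \<and> 1 \<le> d (\<sigma> c) x"
    using dir[OF x a, of "c - 1"] c T by simp
  have "q * (c + 1 - c) \<le> d z (\<sigma> c) - d z (\<sigma> (c + 1))"
    using c unfolding q_def by (intro steep_left[OF st z b]) auto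
  then have 2: "d (point_at Y (\<sigma> c) z (1 / d (\<sigma> c) z)) (\<sigma> (c + 1)) \<le> 1/32 \<and> 1 \<le> d (\<sigma> c) z"
    using dir[OF z b, of "c + 1"] c T by simp
  let ?A = "d (\<sigma> c) x" and ?C = "d (\<sigma> c) z"
  let ?x = "point_at Y (\<sigma> c) x (1 / ?A)" and ?z = "point_at Y (\<sigma> c) z (1 / ?C)"
  have M: "?x \<in> M" "?z \<in> M" using 1 2 x z by (auto intro!: point_at_in)
  have "d (\<sigma> (c - 1)) (\<sigma> (c + 1)) \<le> d (\<sigma> (c - 1)) ?x + (d ?x ?z + d ?z (\<sigma> (c + 1)))"
    using mdist_triangle[of "\<sigma> (c - 1)" Y ?x "\<sigma> (c + 1)"] mdist_triangle[of ?x Y ?z "\<sigma> (c + 1)"] M by simp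
  \<comment> \<open>Here \<open>31/16\<close> is \<open>2 - 2/32\<close>. Its square exceeds
    \<open>15/4 = 2 + 2 * (7/8)\<close>, and this is the bound \<open>- 7/8\<close> for the
    cosine.\<close>
  then have "31/16 \<le> d ?x ?z"
    using 1 2 by (simp add: line_dist mdist_commute[of Y "\<sigma> (c - 1)"])
  then have "(31/16)\<^sup>2 \<le> (d ?x ?z)\<^sup>2" by (intro power_mono) auto
  then have "15/4 * (?A * ?C) \<le> (d ?x ?z)\<^sup>2 * (?A * ?C)"
    by (intro mult_right_mono) (auto simp: power2_eq_square)
  also have "\<dots> \<le> 2 * (?A * ?C) - (?A\<^sup>2 + ?C\<^sup>2 - (d x z)\<^sup>2)"
    using fan_equal_length[OF line_in x z, of 1 c] 1 2 by simp
  finally show ?thesis by (simp add: mdist_commute)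
qed

text \<open>
  If \<open>z\<close> is high above the line, then, seen from \<open>z\<close>, both \<open>x\<close> and \<open>y\<close> lie almost in the
  direction of the foot of \<open>z\<close>, although \<open>z\<close> lies between them.
\<close>

lemma geodesic_near_line:
  assumes st: "steep Y \<sigma> (2047/2048) T" and T: "0 \<le> T" and x: "x \<in> M" and y: "y \<in> M" and z: "z \<in> M"
    and a: "foot Y \<sigma> x a" and b: "foot Y \<sigma> y b" and c: "foot Y \<sigma> z c"
    and between: "d x z + d z y = d x y" and ac: "a + 2 * T + 2 \<le> c" and cb: "c + 2 * T + 2 \<le> b"
  shows "d z (\<sigma> c) \<le> 4 * (T + 1)"
proof (cases "d z (\<sigma> c) = 0")
  case True
  then show ?thesis using T by simp
next
  case False
  let ?h = "d z (\<sigma> c)"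
  have h: "?h > 0" using False by (simp add: less_le)
  \<comment> \<open>Straightness at \<open>\<sigma> e\<close> leaves a comparison angle at
    \<open>z\<close> of cosine at least \<open>7/8\<close>. So at distance \<open>?h\<close> from
    \<open>z\<close>, the segments to \<open>w\<close> and to \<open>\<sigma> e\<close> are at most
    \<open>?h / 2\<close> apart, and the second is there within \<open>T + 1\<close> of
    \<open>\<sigma> e\<close>.\<close>
  have dir: "\<exists>v\<in>M. d z v = ?h \<and> d v w = d z w - ?h \<and> d v (\<sigma> c) \<le> ?h / 2 + 2 * (T + 1)"
    if w: "w \<in> M" and e: "\<bar>c - e\<bar> = T + 1"
      and st: "(d w (\<sigma> e))\<^sup>2 + (d z (\<sigma> e))\<^sup>2 + 7/4 * (d w (\<sigma> e) * d z (\<sigma> e)) \<le> (d w z)\<^sup>2" for w e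
  proof -
    let ?A = "d w (\<sigma> e)" and ?B = "d z w" and ?C = "d z (\<sigma> e)"
    have C: "?h \<le> ?C" using c by (simp add: foot_def)
    have st': "?A\<^sup>2 + ?C\<^sup>2 + 7/4 * (?A * ?C) \<le> ?B\<^sup>2" using st by (simp add: mdist_commute)
    have "0 \<le> ?A\<^sup>2 + 7/4 * (?A * ?C)" by simp
    then have "?C\<^sup>2 \<le> ?B\<^sup>2" using st' by linarith
    then have CB: "?C \<le> ?B" by (rule power2_le_imp_le) simp
    have tri: "?B \<le> ?C + ?A" using mdist_triangle[of z Y "\<sigma> e" w] z w by (simp add: mdist_commute)
    let ?v = "point_at Y z w (?h / ?B)" and ?u = "point_at Y z (\<sigma> e) (?h / ?C)"
    have fr: "0 \<le> ?h / ?B" "?h / ?B \<le> 1" "0 \<le> ?h / ?C" "?h / ?C \<le> 1" using h C CB by auto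
    have v: "?v \<in> M" "d z ?v = ?h" "d ?v w = ?B - ?h"
      using point_at[OF z w fr(1,2)] h C CB by (auto simp: left_diff_distrib)
    have u: "?u \<in> M" "d ?u (\<sigma> e) = ?C - ?h"
      using point_at[OF z line_in fr(3,4)] h C CB by (auto simp: left_diff_distrib)
    have "(d ?v ?u)\<^sup>2 * (?B * ?C) \<le> ?h\<^sup>2 * (2 * (?B * ?C) - (?B\<^sup>2 + ?C\<^sup>2 - ?A\<^sup>2))"
      using fan_equal_length[OF z w line_in, of ?h e] h C CB by simp
    also have "\<dots> \<le> ?h\<^sup>2 * (1/4 * (?B * ?C))"
    proof (rule mult_left_mono)
      have "7/4 * (?B * ?C) \<le> 7/4 * ((?C + ?A) * ?C)"
        using mult_right_mono[OF tri, of ?C] by simp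
      also have "\<dots> \<le> 2 * ?C\<^sup>2 + 7/4 * (?A * ?C)" by (simp add: power2_eq_square algebra_simps)
      finally show "2 * (?B * ?C) - (?B\<^sup>2 + ?C\<^sup>2 - ?A\<^sup>2) \<le> 1/4 * (?B * ?C)" using st' by simp
    qed simp
    finally have "(d ?v ?u)\<^sup>2 * (?B * ?C) \<le> (?h / 2)\<^sup>2 * (?B * ?C)" by (simp add: power_divide)
    moreover have "0 < ?B * ?C" using h C CB by simp
    ultimately have "(d ?v ?u)\<^sup>2 \<le> (?h / 2)\<^sup>2" using mult_le_cancel_right_pos by blast
    then have vu: "d ?v ?u \<le> ?h / 2" by (rule power2_le_imp_le) simp
    have "?C \<le> ?h + (T + 1)" using mdist_triangle[of z Y "\<sigma> c" "\<sigma> e"] z e by (simp add: line_dist)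
    then have "d ?u (\<sigma> e) \<le> T + 1" using u by simp
    moreover have "d ?v (\<sigma> c) \<le> d ?v ?u + (d ?u (\<sigma> e) + d (\<sigma> e) (\<sigma> c))"
      using mdist_triangle[of ?v Y ?u "\<sigma> c"] mdist_triangle[of ?u Y "\<sigma> e" "\<sigma> c"] u v by simp
    moreover have "d (\<sigma> e) (\<sigma> c) = T + 1" using e by (simp add: line_dist abs_minus_commute)
    ultimately have "d ?v (\<sigma> c) \<le> ?h / 2 + 2 * (T + 1)" using vu by (simp add: field_simps)
    then show ?thesis using v by blast
  qed
  have "(d x (\<sigma> (c - (T + 1))))\<^sup>2 + (d z (\<sigma> (c - (T + 1))))\<^sup>2
      + 7/4 * (d x (\<sigma> (c - (T + 1))) * d z (\<sigma> (c - (T + 1)))) \<le> (d x z)\<^sup>2"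
    using ac by (intro straight_at_line[OF st T x z a c]) auto
  then obtain v where v: "v \<in> M" "d z v = ?h" "d v x = d z x - ?h" "d v (\<sigma> c) \<le> ?h / 2 + 2 * (T + 1)"
    using dir[OF x, of "c - (T + 1)"] T by auto
  have "(d z (\<sigma> (c + (T + 1))))\<^sup>2 + (d y (\<sigma> (c + (T + 1))))\<^sup>2
      + 7/4 * (d z (\<sigma> (c + (T + 1))) * d y (\<sigma> (c + (T + 1)))) \<le> (d z y)\<^sup>2"
    using cb by (intro straight_at_line[OF st T z y c b]) auto
  then obtain w where w: "w \<in> M" "d z w = ?h" "d w y = d z y - ?h" "d w (\<sigma> c) \<le> ?h / 2 + 2 * (T + 1)"
    using dir[OF y, of "c + (T + 1)"] T by (auto simp: mdist_commute[of Y y z] mult.commute add.commute)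
  \<comment> \<open>The points \<open>v\<close> and \<open>w\<close> are cut off at distance
    \<open>?h\<close> from \<open>z\<close> on both sides, which accounts for length
    \<open>2 * ?h\<close> of the geodesic. The detour through \<open>\<sigma> c\<close> costs at
    most \<open>?h + 4 * (T + 1)\<close>.\<close>
  have "d x y \<le> d x v + (d v (\<sigma> c) + d (\<sigma> c) w) + d w y"
    using mdist_triangle[of x Y v y] mdist_triangle[of v Y w y] mdist_triangle[of v Y "\<sigma> c" w] x y v w by simp
  moreover have "d x v = d x z - ?h" "d (\<sigma> c) w = d w (\<sigma> c)" using v(3) by (simp_all add: mdist_commute)
  ultimately show ?thesis using between v w by linarith
qed

text \<open>Feet move continuously along a geodesic by \<open>foot_lipschitz\<close>, so the
  intermediate value theorem applies.\<close>

lemma ex_point_over: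
  assumes x: "x \<in> M" and y: "y \<in> M" and a: "foot Y \<sigma> x a" and b: "foot Y \<sigma> y b" and c: "a \<le> c" "c \<le> b"
  shows "\<exists>z\<in>M. d x z + d z y = d x y \<and> foot Y \<sigma> z c"
proof -
  define p where "p r = (SOME e. foot Y \<sigma> (point_at Y x y r) e)" for r
  have p: "foot Y \<sigma> (point_at Y x y r) (p r)" if "r \<in> {0..1}" for r
  proof -
    have "point_at Y x y r \<in> M" using that by (intro point_at_in x y) auto
    from foot_ex[OF this] show ?thesis unfolding p_def by (rule someI_ex)
  qed
  have "foot Y \<sigma> x (p 0)" "foot Y \<sigma> y (p 1)" using p[of 0] p[of 1] x y by simp_all
  then have p01: "p 0 = a" "p 1 = b" using foot_unique[OF x _ a] foot_unique[OF y _ b] by blast+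
  have "(d x y)-lipschitz_on {0..1} p"
  proof (rule lipschitz_onI)
    fix r s :: real assume rs: "r \<in> {0..1}" "s \<in> {0..1}"
    have "(d (point_at Y x y r) (point_at Y x y s))\<^sup>2 \<le> (r * d x y)\<^sup>2 + (s * d x y)\<^sup>2 - r * s * ((d x y)\<^sup>2 + (d x y)\<^sup>2 - (d y y)\<^sup>2)"
      using rs by (intro fan x y) auto
    also have "\<dots> = (d x y * \<bar>r - s\<bar>)\<^sup>2"
      using y by (simp add: power_mult_distrib) algebra
    finally have "d (point_at Y x y r) (point_at Y x y s) \<le> d x y * \<bar>r - s\<bar>" by (rule power2_le_imp_le) simp
    moreover have "\<bar>p r - p s\<bar> \<le> d (point_at Y x y r) (point_at Y x y s)"
      using rs by (intro foot_lipschitz p point_at_in x y) auto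
    ultimately show "dist (p r) (p s) \<le> d x y * dist r s" by (simp add: dist_real_def)
  qed simp
  then have "continuous_on {0..1} p" by (rule lipschitz_on_continuous_on)
  then obtain r where r: "0 \<le> r" "r \<le> 1" "p r = c"
    using IVT'[of p 0 c 1] c p01 by auto
  show ?thesis
  proof (intro bexI conjI)
    show "foot Y \<sigma> (point_at Y x y r) c" using p[of r] r by simp
    show "d x (point_at Y x y r) + d (point_at Y x y r) y = d x y"
      using point_at[OF x y r(1,2)] by (simp add: algebra_simps)
  qed (use point_at[OF x y r(1,2)] in auto)
qed

text \<open>A detour through a point of the line well between the feet costs at most
  \<open>8 * (T + 1)\<close>, twice the height of the geodesic there. Two such detours, one near
  each foot, and the two gaps to the feet lose \<open>20 * (T + 1)\<close> together; the constant
  leaves room.\<close>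

lemma steep_imp_contracting:
  assumes st: "steep Y \<sigma> (2047/2048) T" and T: "0 \<le> T"
  shows "contracting Y \<sigma> (40 * (T + 1))"
proof -
  have mid: "d x (\<sigma> c) + d (\<sigma> c) y \<le> d x y + 8 * (T + 1)"
    if x: "x \<in> M" and y: "y \<in> M" and a: "foot Y \<sigma> x a" and b: "foot Y \<sigma> y b"
      and c: "a + 2 * T + 2 \<le> c" "c + 2 * T + 2 \<le> b" for x y a b c
  proof -
    obtain z where z: "z \<in> M" "d x z + d z y = d x y" "foot Y \<sigma> z c"
      using ex_point_over[OF x y a b, of c] c T by auto
    have "d z (\<sigma> c) \<le> 4 * (T + 1)"
      using geodesic_near_line[OF st T x y z(1) a b z(3,2) c] .
    then show ?thesis
      using mdist_triangle[of x Y z "\<sigma> c"] mdist_triangle[of "\<sigma> c" Y z y] x y z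
      by (simp add: mdist_commute[of Y "\<sigma> c" z])
  qed
  have main: "d x (\<sigma> a) + \<bar>a - b\<bar> + d y (\<sigma> b) - 40 * (T + 1) \<le> d x y"
    if x: "x \<in> M" and y: "y \<in> M" and a: "foot Y \<sigma> x a" and b: "foot Y \<sigma> y b"
      and ab: "40 * (T + 1) \<le> b - a" for x y a b
  proof -
    define c e where "c = a + 2 * T + 2" and "e = b - 2 * T - 2"
    have "d x (\<sigma> c) + d (\<sigma> c) y \<le> d x y + 8 * (T + 1)"
      using ab T by (intro mid[OF x y a b]) (auto simp: c_def)
    moreover have "d (\<sigma> c) (\<sigma> e) + d (\<sigma> e) y \<le> d (\<sigma> c) y + 8 * (T + 1)"
      using ab T by (intro mid[OF line_in y foot_line b]) (auto simp: c_def e_def)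
    moreover have "d (\<sigma> c) (\<sigma> e) = b - a - 4 * (T + 1)" using ab T by (simp add: line_dist c_def e_def)
    moreover have "d x (\<sigma> a) \<le> d x (\<sigma> c)" "d y (\<sigma> b) \<le> d (\<sigma> e) y"
      using a b by (auto simp: foot_def mdist_commute)
    moreover have "\<bar>a - b\<bar> = b - a" using ab T by simp
    ultimately show ?thesis using T by (simp add: algebra_simps)
  qed
  show ?thesis
    unfolding contracting_def
  proof (intro ballI allI impI, elim conjE)
    fix x y a b assume *: "x \<in> M" "y \<in> M" "foot Y \<sigma> x a" "foot Y \<sigma> y b" "40 * (T + 1) \<le> \<bar>a - b\<bar>"
    show "d x (\<sigma> a) + \<bar>a - b\<bar> + d y (\<sigma> b) - 40 * (T + 1) \<le> d x y"
    proof (cases "a \<le> b")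
      case True
      then show ?thesis using main[OF *(1-4)] * by simp
    next
      case False
      then show ?thesis using main[OF *(2,1,4,3)] * by (simp add: mdist_commute algebra_simps)
    qed
  qed
qed

end

theorem (in axial) contracting_ex:
  assumes "mcomplete_of Y" "proper_metric Y" "\<not> bounds_flat_half_plane Y \<sigma>"
  shows "\<exists>K>0. contracting Y \<sigma> K"
proof -
  obtain T where T: "0 \<le> T" "steep Y \<sigma> (2047/2048) T"
    using steep_ex[OF assms, of "2047/2048"] by auto
  show ?thesis
    using steep_imp_contracting[OF T(2,1)] T(1) by (intro exI[of _ "40 * (T + 1)"] conjI) auto
qed

section \<open>Rays and contracting lines\<close>

definition asymptotic :: "'a metric \<Rightarrow> (real \<Rightarrow> 'a) \<Rightarrow> (real \<Rightarrow> 'a) \<Rightarrow> bool" where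
  "asymptotic Y \<alpha> \<beta> \<longleftrightarrow> (\<exists>B. \<forall>t\<ge>0. mdist Y (\<alpha> t) (\<beta> t) \<le> B)"

lemma asymptotic_sym: "asymptotic Y \<alpha> \<beta> \<Longrightarrow> asymptotic Y \<beta> \<alpha>"
  by (simp add: asymptotic_def mdist_commute)

lemma asymptotic_trans:
  assumes "geodesic_on Y {0..} \<alpha>" "geodesic_on Y {0..} \<beta>" "geodesic_on Y {0..} \<gamma>"
    and "asymptotic Y \<alpha> \<beta>" "asymptotic Y \<beta> \<gamma>"
  shows "asymptotic Y \<alpha> \<gamma>"
proof -
  obtain B C where B: "\<And>t. t \<ge> 0 \<Longrightarrow> mdist Y (\<alpha> t) (\<beta> t) \<le> B" "\<And>t. t \<ge> 0 \<Longrightarrow> mdist Y (\<beta> t) (\<gamma> t) \<le> C"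
    using assms(4,5) by (auto simp: asymptotic_def)
  have "mdist Y (\<alpha> t) (\<gamma> t) \<le> B + C" if t: "t \<ge> 0" for t
  proof -
    have "\<alpha> t \<in> mspace Y" "\<beta> t \<in> mspace Y" "\<gamma> t \<in> mspace Y"
      using assms(1-3) t by (auto simp: geodesic_on_def)
    then show ?thesis using mdist_triangle[of "\<alpha> t" Y "\<beta> t" "\<gamma> t"] B[OF t] by linarith
  qed
  then show ?thesis by (auto simp: asymptotic_def)
qed

lemma geodesic_on_isometry:
  assumes "geodesic_on Y I \<rho>" "isometry_on Y h" "h ` mspace Y = mspace Y"
  shows "geodesic_on Y I (\<lambda>t. h (\<rho> t))"
  using assms unfolding geodesic_on_def isometry_on_def by (auto simp: image_subset_iff)

lemma asymptotic_isometry: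
  assumes "geodesic_on Y {0..} \<alpha>" "geodesic_on Y {0..} \<beta>" "isometry_on Y h"
  shows "asymptotic Y (\<lambda>t. h (\<alpha> t)) (\<lambda>t. h (\<beta> t)) \<longleftrightarrow> asymptotic Y \<alpha> \<beta>"
proof -
  have "mdist Y (h (\<alpha> t)) (h (\<beta> t)) = mdist Y (\<alpha> t) (\<beta> t)" if "t \<ge> 0" for t
    using assms that by (simp add: geodesic_on_def isometry_on_def image_subset_iff)
  then show ?thesis by (simp add: asymptotic_def)
qed

lemma geodesic_on_line_rays:
  "geodesic_on Y UNIV \<sigma> \<Longrightarrow> geodesic_on Y I \<sigma>"
  "geodesic_on Y UNIV \<sigma> \<Longrightarrow> geodesic_on Y I (\<lambda>t. \<sigma> (- t))"
  by (auto simp: geodesic_on_def)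

locale contracting_line = cat0_line +
  fixes K :: real
  assumes contr: "contracting Y \<sigma> K" and K_pos: "0 < K"
begin

lemma contractingD:
  "x \<in> M \<Longrightarrow> y \<in> M \<Longrightarrow> foot Y \<sigma> x a \<Longrightarrow> foot Y \<sigma> y b \<Longrightarrow> K \<le> \<bar>a - b\<bar> \<Longrightarrow>
    d x (\<sigma> a) + \<bar>a - b\<bar> + d y (\<sigma> b) - K \<le> d x y"
  using contr by (simp add: contracting_def)

lemma contracting_reverse: "contracting_line Y (\<lambda>t. \<sigma> (- t)) K"
proof -
  interpret r: cat0_line Y "\<lambda>t. \<sigma> (- t)" by (rule reverse)
  have "contracting Y (\<lambda>t. \<sigma> (- t)) K"
    unfolding contracting_def foot_reverse
  proof (intro ballI allI impI, elim conjE)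
    fix x y a b assume *: "x \<in> M" "y \<in> M" "foot Y \<sigma> x (- a)" "foot Y \<sigma> y (- b)" "K \<le> \<bar>a - b\<bar>"
    then show "d x (\<sigma> (- a)) + \<bar>a - b\<bar> + d y (\<sigma> (- b)) - K \<le> d x y"
      using contractingD[OF *(1-4)] by (simp add: abs_minus_commute)
  qed
  then show ?thesis using K_pos by unfold_locales
qed

text \<open>Compare \<open>\<tau> s\<close> with a much later point of the ray. By contraction
  hardly any length is wasted between them, so the height at \<open>s\<close> and the lag
  \<open>s - (p - p0)\<close> of the foot, both nonnegative, have a bounded sum.\<close>

lemma ray_asymptotic_of_unbounded_feet:
  assumes \<tau>: "geodesic_on Y {0..} \<tau>" and unb: "\<And>B. \<exists>t\<ge>0. \<exists>a. foot Y \<sigma> (\<tau> t) a \<and> B \<le> a"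
  shows "asymptotic Y \<tau> \<sigma>"
proof -
  have \<tau>_in: "\<tau> t \<in> M" and \<tau>_d: "d (\<tau> s) (\<tau> t) = \<bar>s - t\<bar>" if "0 \<le> t" "0 \<le> s" for s t
    using \<tau> that by (auto simp: geodesic_on_def)
  obtain p0 where p0: "foot Y \<sigma> (\<tau> 0) p0" using foot_ex \<tau>_in by blast
  define D where "D = d (\<tau> 0) (\<sigma> p0)"
  have "d (\<tau> s) (\<sigma> s) \<le> (K + D) + (K + D) + \<bar>p0\<bar>" if s: "0 \<le> s" for s
  proof -
    obtain p where p: "foot Y \<sigma> (\<tau> s) p" using foot_ex \<tau>_in s by blast
    \<comment> \<open>The foot at time \<open>s\<close> is at most \<open>p0 + s\<close>, so this
      later foot is at least \<open>K\<close> ahead of it.\<close>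
    obtain t a where t: "0 \<le> t" "foot Y \<sigma> (\<tau> t) a" "p0 + s + K \<le> a" using unb by blast
    have ps: "\<bar>p0 - p\<bar> \<le> s" using foot_lipschitz[OF \<tau>_in \<tau>_in p0 p] s by (simp add: \<tau>_d)
    have ts: "\<bar>p0 - a\<bar> \<le> t" using foot_lipschitz[OF \<tau>_in \<tau>_in p0 t(2)] t(1) by (simp add: \<tau>_d)
    then have st: "s < t" using t(3) K_pos by linarith
    have "d (\<tau> s) (\<sigma> p) + \<bar>p - a\<bar> + d (\<tau> t) (\<sigma> a) - K \<le> d (\<tau> s) (\<tau> t)"
      using \<tau>_in s t p ps by (intro contractingD) auto
    moreover have "d (\<tau> s) (\<tau> t) = t - s" using \<tau>_d s t(1) st by simp
    moreover have "d (\<tau> 0) (\<tau> t) \<le> d (\<tau> 0) (\<sigma> p0) + (d (\<sigma> p0) (\<sigma> a) + d (\<sigma> a) (\<tau> t))"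
      using mdist_triangle[of "\<tau> 0" Y "\<sigma> p0" "\<tau> t"] mdist_triangle[of "\<sigma> p0" Y "\<sigma> a" "\<tau> t"] \<tau>_in t(1) by simp
    moreover have "d (\<tau> 0) (\<tau> t) = t" "d (\<sigma> p0) (\<sigma> a) = a - p0" "d (\<sigma> a) (\<tau> t) = d (\<tau> t) (\<sigma> a)" "\<bar>p - a\<bar> = a - p"
      using \<tau>_d t s K_pos ps by (auto simp: line_dist mdist_commute)
    ultimately have 1: "d (\<tau> s) (\<sigma> p) + (s - (p - p0)) \<le> K + D" by (simp add: D_def)
    have "d (\<tau> s) (\<sigma> s) \<le> d (\<tau> s) (\<sigma> p) + \<bar>p - s\<bar>"
      using mdist_triangle[of "\<tau> s" Y "\<sigma> p" "\<sigma> s"] \<tau>_in s by (simp add: line_dist)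
    moreover have "0 \<le> d (\<tau> s) (\<sigma> p)" by simp
    ultimately show ?thesis using 1 ps by linarith
  qed
  then show ?thesis by (auto simp: asymptotic_def)
qed

lemma ray_cases:
  assumes \<tau>: "geodesic_on Y {0..} \<tau>"
    and n: "\<not> asymptotic Y \<tau> \<sigma>" "\<not> asymptotic Y \<tau> (\<lambda>t. \<sigma> (- t))"
  shows "\<exists>B. \<forall>t\<ge>0. \<forall>a. foot Y \<sigma> (\<tau> t) a \<longrightarrow> \<bar>a\<bar> \<le> B"
proof -
  interpret r: contracting_line Y "\<lambda>t. \<sigma> (- t)" K by (rule contracting_reverse)
  obtain B where B: "\<And>t a. t \<ge> 0 \<Longrightarrow> foot Y \<sigma> (\<tau> t) a \<Longrightarrow> a < B"
    using ray_asymptotic_of_unbounded_feet[OF \<tau>] n(1) by (meson not_le)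
  obtain C where C: "\<And>t a. t \<ge> 0 \<Longrightarrow> foot Y (\<lambda>t. \<sigma> (- t)) (\<tau> t) a \<Longrightarrow> a < C"
    using r.ray_asymptotic_of_unbounded_feet[OF \<tau>] n(2) by (meson not_le)
  have "\<bar>a\<bar> \<le> max B C" if "t \<ge> 0" "foot Y \<sigma> (\<tau> t) a" for t a
    using B[OF that] C[of t "- a"] that by (simp add: foot_reverse)
  then show ?thesis by blast
qed

lemma bounded_feet_of_line:
  assumes \<tau>: "geodesic_on Y UNIV \<tau>"
    and n: "\<not> asymptotic Y \<tau> \<sigma>" "\<not> asymptotic Y \<tau> (\<lambda>t. \<sigma> (- t))"
      "\<not> asymptotic Y (\<lambda>t. \<tau> (- t)) \<sigma>" "\<not> asymptotic Y (\<lambda>t. \<tau> (- t)) (\<lambda>t. \<sigma> (- t))"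
  shows "\<exists>B. \<forall>t a. foot Y \<sigma> (\<tau> t) a \<longrightarrow> \<bar>a\<bar> \<le> B"
proof -
  obtain B where B: "\<And>t a. t \<ge> 0 \<Longrightarrow> foot Y \<sigma> (\<tau> t) a \<Longrightarrow> \<bar>a\<bar> \<le> B"
    using ray_cases[OF geodesic_on_line_rays(1)[OF \<tau>] n(1,2)] by blast
  obtain C where C: "\<And>t a. t \<ge> 0 \<Longrightarrow> foot Y \<sigma> (\<tau> (- t)) a \<Longrightarrow> \<bar>a\<bar> \<le> C"
    using ray_cases[OF geodesic_on_line_rays(2)[OF \<tau>] n(3,4)] by blast
  have "\<bar>a\<bar> \<le> max B C" if "foot Y \<sigma> (\<tau> t) a" for t a
    using B[of t a] C[of "- t" a] that by (cases "t \<ge> 0") (auto simp: max_def)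
  then show ?thesis by blast
qed

end

section \<open>Rays whose ends are fixed by powers of an axial isometry\<close>

lemma isometry_on_funpow:
  assumes "isometry_on Y h" "h ` mspace Y = mspace Y"
  shows "isometry_on Y (h ^^ n)" "(h ^^ n) ` mspace Y = mspace Y"
proof -
  show im: "(h ^^ n) ` mspace Y = mspace Y" for n
  proof (induction n)
    case (Suc n)
    have "(h ^^ Suc n) ` mspace Y = h ` ((h ^^ n) ` mspace Y)" by (simp add: image_comp)
    then show ?case using Suc assms by simp
  qed simp
  show "isometry_on Y (h ^^ n)"
  proof (induction n)
    case (Suc n)
    have "(h ^^ n) x \<in> mspace Y" if "x \<in> mspace Y" for x using im[of n] that by blast
    then show ?case using Suc assms(1) by (simp add: isometry_on_def)
  qed (simp add: isometry_on_def)
qed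

lemma (in axial) axis_funpow:
  assumes "0 < n"
  shows "axial Y \<sigma> (h ^^ n) (real n * l)"
proof -
  have "(h ^^ m) (\<sigma> t) = \<sigma> (t + real m * l)" for m t
    by (induction m) (auto simp: h_line algebra_simps)
  then have "axis_of Y (h ^^ n) (real n * l) \<sigma>"
    using assms l_pos line by (simp add: axis_of_def)
  then show ?thesis using isometry_on_funpow[OF iso onto] by unfold_locales auto
qed

lemma (in axial) foot_translate:
  assumes x: "x \<in> M" and a: "foot Y \<sigma> x a"
  shows "foot Y \<sigma> (h x) (a + l)"
  unfolding foot_def
proof
  fix t
  have "d (h x) (\<sigma> (a + l)) = d x (\<sigma> a)" using h_dist[OF x line_in, of a] by (simp add: h_line)
  also have "\<dots> \<le> d x (\<sigma> (t - l))" using a by (simp add: foot_def)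
  also have "\<dots> = d (h x) (\<sigma> t)" using h_dist[OF x line_in, of "t - l"] by (simp add: h_line)
  finally show "d (h x) (\<sigma> (a + l)) \<le> d (h x) (\<sigma> t)" .
qed

lemma (in axial) height_translate:
  assumes "x \<in> M"
  shows "d (h x) (\<sigma> (a + l)) = d x (\<sigma> a)"
  using h_dist[OF assms line_in, of a] by (simp add: h_line)

locale contracting_axis = axial + contracting_line
begin

text \<open>
  A ray with bounded feet is moved by a large power of \<open>h\<close> to a ray with feet far away, so that
  the two rays diverge.
\<close>

lemma fixed_end:
  assumes \<rho>: "geodesic_on Y {0..} \<rho>" and fx: "asymptotic Y (\<lambda>t. h (\<rho> t)) \<rho>"
  shows "asymptotic Y \<rho> \<sigma> \<or> asymptotic Y \<rho> (\<lambda>t. \<sigma> (- t))"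
proof (rule ccontr)
  assume "\<not> ?thesis"
  then obtain B where B: "\<And>t a. t \<ge> 0 \<Longrightarrow> foot Y \<sigma> (\<rho> t) a \<Longrightarrow> \<bar>a\<bar> \<le> B"
    using ray_cases[OF \<rho>] by blast
  have \<rho>_in: "\<rho> t \<in> M" and \<rho>_d: "d (\<rho> s) (\<rho> t) = \<bar>s - t\<bar>" if "0 \<le> t" "0 \<le> s" for s t
    using \<rho> that by (auto simp: geodesic_on_def)
  have as: "asymptotic Y (\<lambda>t. (h ^^ n) (\<rho> t)) \<rho>" for n
  proof (induction n)
    case 0
    have "d (\<rho> t) (\<rho> t) = 0" if "t \<ge> 0" for t using \<rho>_in that by simp
    then show ?case by (auto simp: asymptotic_def intro!: exI[of _ 0])
  next
    case (Suc n)
    have g: "geodesic_on Y {0..} (\<lambda>t. (h ^^ n) (\<rho> t))" for n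
      using geodesic_on_isometry[OF \<rho> isometry_on_funpow[OF iso onto]] .
    have "asymptotic Y (\<lambda>t. (h ^^ n) (h (\<rho> t))) (\<lambda>t. (h ^^ n) (\<rho> t))"
      using asymptotic_isometry[OF geodesic_on_isometry[OF \<rho> iso onto] \<rho> isometry_on_funpow(1)[OF iso onto]] fx
      by blast
    then show ?case using asymptotic_trans[OF g[of "Suc n"] g[of n] \<rho>] Suc
      by (simp add: funpow_swap1)
  qed
  obtain n :: nat where n: "2 * B + K < real n * l" using reals_Archimedean3[OF l_pos] by blast
  have "0 \<le> B"
  proof -
    obtain a where "foot Y \<sigma> (\<rho> 0) a" using foot_ex \<rho>_in by blast
    then show ?thesis using B[of 0 a] by simp
  qed
  then have n0: "0 < n" using n K_pos by (cases "n = 0") auto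
  interpret n: axial Y \<sigma> "h ^^ n" "real n * l" using axis_funpow[OF n0] .
  obtain C where C: "\<And>t. t \<ge> 0 \<Longrightarrow> d ((h ^^ n) (\<rho> t)) (\<rho> t) \<le> C" using as[of n] by (auto simp: asymptotic_def)
  \<comment> \<open>Since the foot stays within \<open>B\<close>, the height of
    \<open>\<rho> t\<close> at this time exceeds \<open>C + K\<close>, more than contraction
    permits.\<close>
  define t where "t = max 0 (C + K + d (\<rho> 0) (\<sigma> 0) + B + 1)"
  have t: "0 \<le> t" "C + K + d (\<rho> 0) (\<sigma> 0) + B < t" by (auto simp: t_def)
  obtain a where a: "foot Y \<sigma> (\<rho> t) a" using foot_ex \<rho>_in t(1) by blast
  have aB: "\<bar>a\<bar> \<le> B" using B[OF t(1) a] .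
  have "d ((h ^^ n) (\<rho> t)) (\<sigma> (a + real n * l)) + \<bar>a + real n * l - a\<bar> + d (\<rho> t) (\<sigma> a) - K \<le> d ((h ^^ n) (\<rho> t)) (\<rho> t)"
    using \<rho>_in[OF t(1,1)] n \<open>0 \<le> B\<close> l_pos
    by (intro contractingD n.foot_translate a n.h_in) auto
  then have "d (\<rho> t) (\<sigma> a) - K \<le> C"
    using C[OF t(1)] zero_le_mult_iff[of "real n" l] l_pos
      mdist_nonneg[of Y "(h ^^ n) (\<rho> t)" "\<sigma> (a + real n * l)"] by linarith
  moreover have "d (\<rho> 0) (\<rho> t) \<le> d (\<rho> 0) (\<sigma> 0) + (d (\<sigma> 0) (\<sigma> a) + d (\<sigma> a) (\<rho> t))"
    using mdist_triangle[of "\<rho> 0" Y "\<sigma> 0" "\<rho> t"] mdist_triangle[of "\<sigma> 0" Y "\<sigma> a" "\<rho> t"] \<rho>_in t(1) by simp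
  moreover have "d (\<rho> 0) (\<rho> t) = t" "d (\<sigma> 0) (\<sigma> a) = \<bar>a\<bar>" "d (\<sigma> a) (\<rho> t) = d (\<rho> t) (\<sigma> a)"
    using \<rho>_d t(1) by (simp_all add: line_dist mdist_commute)
  ultimately show False using t aB by linarith
qed

text \<open>Cancelling the smaller power leaves a positive power of \<open>h\<close>, which has the
  same contracting axis.\<close>

lemma fixed_end_funpow:
  assumes \<rho>: "geodesic_on Y {0..} \<rho>" and mn: "m \<noteq> n"
    and fx: "asymptotic Y (\<lambda>t. (h ^^ m) (\<rho> t)) (\<lambda>t. (h ^^ n) (\<rho> t))"
  shows "asymptotic Y \<rho> \<sigma> \<or> asymptotic Y \<rho> (\<lambda>t. \<sigma> (- t))"
proof -
  have main: "asymptotic Y \<rho> \<sigma> \<or> asymptotic Y \<rho> (\<lambda>t. \<sigma> (- t))"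
    if fx: "asymptotic Y (\<lambda>t. (h ^^ m) (\<rho> t)) (\<lambda>t. (h ^^ n) (\<rho> t))" and "n < m" for m n
  proof -
    define k where "k = m - n"
    have k: "0 < k" "m = n + k" using that by (auto simp: k_def)
    interpret k: axial Y \<sigma> "h ^^ k" "real k * l" using axis_funpow[OF k(1)] .
    interpret k: contracting_axis Y \<sigma> "h ^^ k" "real k * l" K by unfold_locales
    have "asymptotic Y (\<lambda>t. (h ^^ n) ((h ^^ k) (\<rho> t))) (\<lambda>t. (h ^^ n) (\<rho> t))"
      using fx by (simp add: k(2) funpow_add)
    then have "asymptotic Y (\<lambda>t. (h ^^ k) (\<rho> t)) \<rho>"
      using asymptotic_isometry[OF geodesic_on_isometry[OF \<rho> k.iso k.onto] \<rho> isometry_on_funpow(1)[OF iso onto]]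
      by blast
    then show ?thesis by (rule k.fixed_end[OF \<rho>])
  qed
  show ?thesis
    using main[of m n] main[of n m] fx mn asymptotic_sym[OF fx] by (cases "n < m") auto
qed

lemma end_fixed:
  shows "asymptotic Y (\<lambda>t. (h ^^ n) (\<sigma> t)) \<sigma>"
    and "asymptotic Y (\<lambda>t. (h ^^ n) (\<sigma> (- t))) (\<lambda>t. \<sigma> (- t))"
proof -
  have "(h ^^ m) (\<sigma> t) = \<sigma> (t + real m * l)" for m t
    by (induction m) (auto simp: h_line algebra_simps)
  then show "asymptotic Y (\<lambda>t. (h ^^ n) (\<sigma> t)) \<sigma>"
    "asymptotic Y (\<lambda>t. (h ^^ n) (\<sigma> (- t))) (\<lambda>t. \<sigma> (- t))"
    by (auto simp: asymptotic_def line_dist intro!: exI[of _ "\<bar>real n * l\<bar>"])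
qed

end

definition ends :: "(real \<Rightarrow> 'a) \<Rightarrow> (real \<Rightarrow> 'a) set" where
  "ends \<sigma> = {\<sigma>, \<lambda>t. \<sigma> (- t)}"

lemma geodesic_on_ends: "geodesic_on Y UNIV \<sigma> \<Longrightarrow> \<alpha> \<in> ends \<sigma> \<Longrightarrow> geodesic_on Y {0..} \<alpha>"
  by (auto simp: ends_def geodesic_on_def)

text \<open>
  If \<open>h\<close> fixes the end of \<open>\<alpha>\<close>, then \<open>g\<close> moves it, and \<open>p\<close> is determined by \<open>\<beta>\<close>. Otherwise
  \<open>q\<close> is determined by \<open>p\<close> and \<open>\<beta>\<close>. So in a square the exceptional pairs are few.
\<close>

lemma few_exceptions:
  assumes g: "contracting_axis Y \<sigma> g l K" and h: "contracting_axis Y \<sigma>' h l' K'"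
    and indep: "\<And>\<xi> \<eta>. \<xi> \<in> ends \<sigma> \<Longrightarrow> \<eta> \<in> ends \<sigma>' \<Longrightarrow> \<not> asymptotic Y \<xi> \<eta>"
    and \<alpha>: "geodesic_on Y {0..} \<alpha>" and \<beta>: "geodesic_on Y {0..} \<beta>"
  shows "card {(p, q). p < N \<and> q < N \<and> asymptotic Y (\<lambda>t. (g ^^ p) ((h ^^ q) (\<alpha> t))) \<beta>} \<le> N"
proof -
  interpret g: contracting_axis Y \<sigma> g l K by fact
  interpret h: contracting_axis Y \<sigma>' h l' K' by fact
  let ?B = "{(p, q). p < N \<and> q < N \<and> asymptotic Y (\<lambda>t. (g ^^ p) ((h ^^ q) (\<alpha> t))) \<beta>}"
  have gp: "isometry_on Y (g ^^ p)" "(g ^^ p) ` mspace Y = mspace Y" for p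
    by (rule isometry_on_funpow[OF g.iso g.onto])+
  have hp: "isometry_on Y (h ^^ p)" "(h ^^ p) ` mspace Y = mspace Y" for p
    by (rule isometry_on_funpow[OF h.iso h.onto])+
  have h\<alpha>: "geodesic_on Y {0..} (\<lambda>t. (h ^^ q) (\<alpha> t))" for q
    by (rule geodesic_on_isometry[OF \<alpha> hp])
  have gh\<alpha>: "geodesic_on Y {0..} (\<lambda>t. (g ^^ p) ((h ^^ q) (\<alpha> t)))" for p q
    by (rule geodesic_on_isometry[OF h\<alpha> gp])
  have B2: "asymptotic Y (\<lambda>t. (g ^^ p) ((h ^^ q) (\<alpha> t))) (\<lambda>t. (g ^^ p') ((h ^^ q') (\<alpha> t)))"
    if "(p, q) \<in> ?B" "(p', q') \<in> ?B" for p q p' q'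
    using that asymptotic_trans[OF gh\<alpha> \<beta> gh\<alpha>] asymptotic_sym by blast
  show ?thesis
  proof (cases "\<exists>\<eta>\<in>ends \<sigma>'. asymptotic Y \<alpha> \<eta>")
    case True
    then obtain \<eta> where \<eta>: "\<eta> \<in> ends \<sigma>'" "asymptotic Y \<alpha> \<eta>" by blast
    have \<eta>g: "geodesic_on Y {0..} \<eta>" using geodesic_on_ends[OF h.line \<eta>(1)] .
    have h\<eta>: "asymptotic Y (\<lambda>t. (h ^^ q) (\<alpha> t)) \<eta>" for q
    proof -
      have "asymptotic Y (\<lambda>t. (h ^^ q) (\<alpha> t)) (\<lambda>t. (h ^^ q) (\<eta> t))"
        using asymptotic_isometry[OF \<alpha> \<eta>g hp(1)] \<eta>(2) by blast
      moreover have "asymptotic Y (\<lambda>t. (h ^^ q) (\<eta> t)) \<eta>"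
        using \<eta>(1) h.end_fixed[of q] by (auto simp: ends_def)
      ultimately show ?thesis
        using asymptotic_trans[OF h\<alpha> geodesic_on_isometry[OF \<eta>g hp] \<eta>g] by blast
    qed
    have "inj_on snd ?B"
    proof (rule inj_onI)
      fix u v assume uv: "u \<in> ?B" "v \<in> ?B" "snd u = snd v"
      obtain p q p' where e: "u = (p, q)" "v = (p', q)" using uv(3) by (cases u; cases v) auto
      have "p = p'"
      proof (rule ccontr)
        assume "p \<noteq> p'"
        moreover have "asymptotic Y (\<lambda>t. (g ^^ p) ((h ^^ q) (\<alpha> t))) (\<lambda>t. (g ^^ p') ((h ^^ q) (\<alpha> t)))"
          using B2[of p q p' q] uv e by simp
        ultimately have "\<exists>\<xi>\<in>ends \<sigma>. asymptotic Y (\<lambda>t. (h ^^ q) (\<alpha> t)) \<xi>"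
          using g.fixed_end_funpow[OF h\<alpha>[of q], of p p'] by (auto simp: ends_def)
        then obtain \<xi> where \<xi>: "\<xi> \<in> ends \<sigma>" "asymptotic Y (\<lambda>t. (h ^^ q) (\<alpha> t)) \<xi>" by blast
        then have "asymptotic Y \<xi> \<eta>"
          using asymptotic_trans[OF geodesic_on_ends[OF g.line \<xi>(1)] h\<alpha> \<eta>g] h\<eta> asymptotic_sym by blast
        then show False using indep \<xi> \<eta> by blast
      qed
      then show "u = v" using e by simp
    qed
    moreover have "snd ` ?B \<subseteq> {..<N}" by auto
    ultimately show ?thesis using card_inj_on_le[of snd ?B "{..<N}"] by simp
  next
    case False
    have "inj_on fst ?B"
    proof (rule inj_onI)
      fix u v assume uv: "u \<in> ?B" "v \<in> ?B" "fst u = fst v"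
      obtain p q q' where e: "u = (p, q)" "v = (p, q')" using uv(3) by (cases u; cases v) auto
      have "asymptotic Y (\<lambda>t. (g ^^ p) ((h ^^ q) (\<alpha> t))) (\<lambda>t. (g ^^ p) ((h ^^ q') (\<alpha> t)))"
        using B2[of p q p q'] uv e by simp
      then have "asymptotic Y (\<lambda>t. (h ^^ q) (\<alpha> t)) (\<lambda>t. (h ^^ q') (\<alpha> t))"
        using asymptotic_isometry[OF h\<alpha> h\<alpha> gp(1)] by blast
      then have "q = q'"
        using h.fixed_end_funpow[OF \<alpha>, of q q'] False by (auto simp: ends_def)
      then show "u = v" using e by simp
    qed
    moreover have "fst ` ?B \<subseteq> {..<N}" by auto
    ultimately show ?thesis using card_inj_on_le[of fst ?B "{..<N}"] by simp
  qed
qed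

section \<open>Ping-pong\<close>

text \<open>A form of Behrstock's inequality.\<close>

lemma foot_transfer:
  assumes \<sigma>: "contracting_line Y \<sigma> K" and \<tau>: "contracting_line Y \<tau> K" and y: "y \<in> mspace Y"
    and \<sigma>\<tau>: "\<And>t f. foot Y \<sigma> (\<tau> t) f \<Longrightarrow> \<bar>f\<bar> \<le> \<theta>" and \<tau>\<sigma>: "\<And>t f. foot Y \<tau> (\<sigma> t) f \<Longrightarrow> \<bar>f\<bar> \<le> \<theta>"
    and a: "foot Y \<sigma> y a" "\<theta> + K \<le> \<bar>a\<bar>" and b: "foot Y \<tau> y b"
  shows "\<bar>b\<bar> \<le> \<theta> + 2 * K" "mdist Y y (\<sigma> a) + \<bar>a\<bar> - \<theta> - K \<le> mdist Y y (\<tau> b)"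
proof -
  interpret s: contracting_line Y \<sigma> K by fact
  interpret t: contracting_line Y \<tau> K by fact
  obtain f where f: "foot Y \<sigma> (\<tau> b) f" using s.foot_ex t.line_in by blast
  obtain r where r: "foot Y \<tau> (\<sigma> a) r" using t.foot_ex s.line_in by blast
  have fr: "\<bar>f\<bar> \<le> \<theta>" "\<bar>r\<bar> \<le> \<theta>" using \<sigma>\<tau> \<tau>\<sigma> f r by auto
  have 1: "s.d y (\<sigma> a) + \<bar>a - f\<bar> + s.d (\<tau> b) (\<sigma> f) - K \<le> s.d y (\<tau> b)"
    using fr a by (intro s.contractingD y t.line_in f) auto
  have af: "\<bar>a\<bar> - \<theta> \<le> \<bar>a - f\<bar>" using fr by simp
  show "s.d y (\<sigma> a) + \<bar>a\<bar> - \<theta> - K \<le> s.d y (\<tau> b)"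
    using 1 af mdist_nonneg[of Y "\<tau> b" "\<sigma> f"] by linarith
  show "\<bar>b\<bar> \<le> \<theta> + 2 * K"
  \<comment> \<open>Otherwise contraction applies over both lines, and each of the two heights of
    \<open>y\<close> would have to exceed the other.\<close>
  proof (rule ccontr)
    assume "\<not> \<bar>b\<bar> \<le> \<theta> + 2 * K"
    then have br: "2 * K < \<bar>b - r\<bar>" using fr by simp
    have "s.d y (\<tau> b) + \<bar>b - r\<bar> + s.d (\<sigma> a) (\<tau> r) - K \<le> s.d y (\<sigma> a)"
      using br t.K_pos by (intro t.contractingD y s.line_in b r) auto
    moreover have "0 \<le> s.d (\<sigma> a) (\<tau> r)" by simp
    ultimately have "s.d y (\<tau> b) + K < s.d y (\<sigma> a)" using br by linarith
    then have "K < 0"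
      using 1 mdist_nonneg[of Y "\<tau> b" "\<sigma> f"] abs_ge_zero[of "a - f"] t.K_pos by linarith
    then show False using t.K_pos by simp
  qed
qed

text \<open>An index \<open>(c, e)\<close> is a letter: \<open>c\<close> names the generator,
  \<open>e\<close> its sign, and the letter translates its line in the positive direction. The
  constants do not involve the translation length, which enters only afterwards as
  \<open>\<Lambda>\<close>.\<close>

locale ping_pong = cat0 +
  fixes L :: "bool \<times> bool \<Rightarrow> real \<Rightarrow> 'a" and K \<theta> E :: real and x0 :: 'a
  assumes L_lines: "\<And>s. contracting_line Y (L s) K"
    and reverse: "\<And>c e t. L (c, \<not> e) t = L (c, e) (- t)"
    and bounded: "\<And>c e t a. foot Y (L (c, e)) (L (\<not> c, e') t) a \<Longrightarrow> \<bar>a\<bar> \<le> \<theta>"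
    and x0: "x0 \<in> mspace Y" and E: "\<And>s. mdist Y x0 (L s 0) \<le> E"
begin

sublocale l: contracting_line Y "L s" K for s
  by (rule L_lines)

text \<open>The part \<open>2 * \<theta> + 3 * K\<close> is the loss at a change of generator by
  \<open>foot_transfer\<close>: \<open>\<theta> + 2 * K\<close> in the foot and
  \<open>\<theta> + K\<close> in the height. The part \<open>4 * E\<close> is twice the bound of
  \<open>foot_x0\<close>.\<close>

definition bound :: real where "bound = 2 * \<theta> + 3 * K + 4 * E"

lemma nonneg: "0 < K" "0 \<le> \<theta>" "0 \<le> E"
proof -
  show "0 < K" using l.K_pos by simp
  obtain a where "foot Y (L (True, True)) (L (\<not> True, True) 0) a" using l.foot_ex l.line_in by blast
  then show "0 \<le> \<theta>" using bounded[of True True True 0 a] by simp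
  show "0 \<le> E" using E[of undefined] mdist_nonneg[of Y x0 "L undefined 0"] by linarith
qed

lemma bound_pos: "0 < bound"
  using nonneg by (simp add: bound_def)

lemma foot_x0:
  assumes "foot Y (L s) x0 a"
  shows "\<bar>a\<bar> \<le> 2 * E"
proof -
  have "d x0 (L s a) \<le> E" using assms E[of s] by (auto simp: foot_def intro: order_trans)
  moreover have "d (L s 0) (L s a) \<le> d (L s 0) x0 + d x0 (L s a)"
    using x0 by (intro mdist_triangle) auto
  moreover have "d (L s 0) (L s a) = \<bar>a\<bar>" by (simp add: l.line_dist)
  ultimately show ?thesis using E[of s] mdist_commute[of Y "L s 0" x0] by linarith
qed

context
  fixes act :: "bool \<times> bool \<Rightarrow> 'a \<Rightarrow> 'a" and \<Lambda> :: real
  assumes ax: "\<And>s. axial Y (L s) (act s) \<Lambda>" and \<Lambda>: "bound \<le> \<Lambda>"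
begin

lemma word_in: "foldr act w x0 \<in> M"
  by (induction w) (auto simp: x0 axial.h_in[OF ax])

text \<open>
  Repeated letters move the foot further along the line; at each change of the generator, the
  distance of the foot on the old line is traded for height over the new one.
\<close>

lemma word_far:
  assumes "w \<noteq> []" "reduced_word w"
  shows "\<exists>a. foot Y (L (hd w)) (foldr act w x0) a \<and> \<Lambda> - (\<theta> + 2 * K + 2 * E) \<le> a \<and>
    real (length w) * (\<Lambda> - bound) \<le> d (foldr act w x0) (L (hd w) a) + a"
  using assms
proof (induction w)
  case (Cons s w)
  let ?y = "foldr act w x0"
  have y: "?y \<in> M" by (rule word_in)
  obtain b where b: "foot Y (L s) ?y b" using l.foot_ex y by blast
  have f: "foot Y (L s) (act s ?y) (b + \<Lambda>)" using axial.foot_translate[OF ax y b] .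
  have h: "d (act s ?y) (L s (b + \<Lambda>)) = d ?y (L s b)" using axial.height_translate[OF ax y] .
  have "\<exists>a. foot Y (L s) (act s ?y) a \<and> \<Lambda> - (\<theta> + 2 * K + 2 * E) \<le> a \<and>
    real (Suc (length w)) * (\<Lambda> - bound) \<le> d (act s ?y) (L s a) + a"
  proof (intro exI conjI)
    show "foot Y (L s) (act s ?y) (b + \<Lambda>)" by (rule f)
    \<comment> \<open>Before \<open>s\<close> acts, the foot over its line is negative by a bounded
      amount at most, and height plus foot has dropped by at most \<open>bound\<close>. The action
      then adds \<open>\<Lambda>\<close> to the foot and keeps the height.\<close>
    have main: "- (\<theta> + 2 * K + 2 * E) \<le> b \<and> real (length w) * (\<Lambda> - bound) - bound \<le> d ?y (L s b) + b"
    proof (cases w)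
      case Nil
      have "- (2 * E) \<le> b" using foot_x0[of s b] b Nil by simp
      moreover have "0 \<le> d ?y (L s b)" by simp
      moreover have "real (length w) * (\<Lambda> - bound) = 0" using Nil by simp
      moreover have "bound = 2 * \<theta> + 3 * K + 4 * E" by (rule bound_def)
      ultimately show ?thesis using nonneg by (intro conjI) linarith+
    next
      case (Cons s' w')
      obtain c e c' e' where s: "s = (c, e)" "s' = (c', e')" by (cases s; cases s') auto
      have red: "reduced_word w" "\<not> (c = c' \<and> e \<noteq> e')"
        using \<open>reduced_word (s # w)\<close> by (auto simp: reduced_word_def Cons s)
      obtain a where a: "foot Y (L s') ?y a" "\<Lambda> - (\<theta> + 2 * K + 2 * E) \<le> a"
          "real (length w) * (\<Lambda> - bound) \<le> d ?y (L s' a) + a"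
        using Cons.IH red(1) Cons by auto
      show ?thesis
      proof (cases "c = c'")
        case True
        then have "s = s'" using red s by simp
        then have "a = b" using l.foot_unique[OF y a(1)] b by simp
        then show ?thesis using a \<Lambda> nonneg \<open>s = s'\<close> bound_pos by (simp add: bound_def)
      next
        case False
        then have c: "c' = (\<not> c)" by simp
        have a0: "\<theta> + K \<le> a" using a(2) \<Lambda> nonneg by (simp add: bound_def)
        have "\<bar>b\<bar> \<le> \<theta> + 2 * K \<and> d ?y (L s' a) + \<bar>a\<bar> - \<theta> - K \<le> d ?y (L s b)"
        proof -
          have 1: "\<bar>f\<bar> \<le> \<theta>" if "foot Y (L s') (L s t) f" for t f
            using that bounded[of c' e' e t f] by (simp add: s c)
          have 2: "\<bar>f\<bar> \<le> \<theta>" if "foot Y (L s) (L s' t) f" for t f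
            using that bounded[of c e e' t f] by (simp add: s c)
          have 3: "\<theta> + K \<le> \<bar>a\<bar>" using a0 by simp
          show ?thesis
            using foot_transfer[OF L_lines L_lines y _ _ a(1) 3 b] 1 2 by blast
        qed
        moreover have "bound = 2 * \<theta> + 3 * K + 4 * E" by (rule bound_def)
        moreover have "\<bar>a\<bar> = a" using a0 nonneg by simp
        ultimately show ?thesis using a(3) nonneg by (intro conjI) linarith+
      qed
    qed
    then show "\<Lambda> - (\<theta> + 2 * K + 2 * E) \<le> b + \<Lambda>" by simp
    have "real (Suc (length w)) * (\<Lambda> - bound) = real (length w) * (\<Lambda> - bound) - bound + \<Lambda>"
      by (simp add: algebra_simps)
    then show "real (Suc (length w)) * (\<Lambda> - bound) \<le> d (act s ?y) (L s (b + \<Lambda>)) + (b + \<Lambda>)"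
      using main h by linarith
  qed
  then show ?case by simp
qed simp

lemma displacement_lower:
  assumes "w \<noteq> []" "reduced_word w"
  shows "real (length w) * (\<Lambda> - bound) - bound \<le> d x0 (foldr act w x0)"
proof -
  let ?y = "foldr act w x0" and ?s = "hd w"
  obtain a where a: "foot Y (L ?s) ?y a" "\<Lambda> - (\<theta> + 2 * K + 2 * E) \<le> a"
      "real (length w) * (\<Lambda> - bound) \<le> d ?y (L ?s a) + a"
    using word_far[OF assms] by blast
  obtain b where b: "foot Y (L ?s) x0 b" using l.foot_ex x0 by blast
  have bE: "\<bar>b\<bar> \<le> 2 * E" using foot_x0[OF b] .
  have ab: "K \<le> a - b" using a(2) \<Lambda> bE nonneg by (simp add: bound_def)
  have "d ?y (L ?s a) + \<bar>a - b\<bar> + d x0 (L ?s b) - K \<le> d ?y x0"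
    using ab by (intro l.contractingD word_in x0 a b) auto
  moreover have "0 \<le> d x0 (L ?s b)" "d ?y x0 = d x0 ?y" by (simp_all add: mdist_commute)
  moreover have "bound = 2 * \<theta> + 3 * K + 4 * E" by (rule bound_def)
  ultimately show ?thesis using a(3) bE ab nonneg by linarith
qed

lemma displacement_upper:
  "d x0 (foldr act w x0) \<le> real (length w) * (\<Lambda> + bound)"
proof (induction w)
  case Nil
  then show ?case using x0 by simp
next
  case (Cons s w)
  let ?y = "foldr act w x0"
  interpret s: axial Y "L s" "act s" \<Lambda> by (rule ax)
  have y: "?y \<in> M" by (rule word_in)
  have "d x0 (act s ?y) \<le> d x0 (L s 0) + (d (L s 0) (L s \<Lambda>) + (d (L s \<Lambda>) (act s x0) + d (act s x0) (act s ?y)))"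
    using mdist_triangle[of x0 Y "L s 0" "act s ?y"] mdist_triangle[of "L s 0" Y "L s \<Lambda>" "act s ?y"]
      mdist_triangle[of "L s \<Lambda>" Y "act s x0" "act s ?y"] x0 y s.h_in by simp
  moreover have "d (L s 0) (L s \<Lambda>) = \<Lambda>" using s.l_pos by (simp add: l.line_dist)
  moreover have "d (L s \<Lambda>) (act s x0) = d x0 (L s 0)"
    using s.h_dist[OF x0 l.line_in[of s 0]] by (simp add: s.h_line mdist_commute)
  moreover have "d (act s x0) (act s ?y) = d x0 ?y" using s.h_dist x0 y by simp
  ultimately have "d x0 (act s ?y) \<le> \<Lambda> + bound + real (length w) * (\<Lambda> + bound)"
    using E[of s] Cons nonneg by (simp add: bound_def)
  then show ?case by (simp add: algebra_simps)
qed

lemma nontrivial: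
  assumes "w \<noteq> []" "reduced_word w" "2 * bound < \<Lambda>"
  shows "foldr act w x0 \<noteq> x0"
proof
  assume "foldr act w x0 = x0"
  then have "real (length w) * (\<Lambda> - bound) - bound \<le> 0"
    using displacement_lower[OF assms(1,2)] x0 by simp
  moreover have "1 * (\<Lambda> - bound) \<le> real (length w) * (\<Lambda> - bound)"
    using \<Lambda> assms(1) by (intro mult_right_mono) (auto simp: Suc_le_eq)
  ultimately have "1 * (\<Lambda> - bound) \<le> bound" by simp
  then show False using assms(3) by simp
qed

text \<open>The displacement of \<open>x0\<close> under the \<open>k\<close>-th power of
  \<open>f\<close> is \<open>k * m\<close> up to \<open>2 * D\<close>. It is also the displacement
  under the \<open>k\<close>-th power of the word, which is reduced. Dividing by \<open>k\<close>
  removes the additive errors.\<close>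

lemma translation_length_word:
  assumes w: "w \<noteq> []" "\<And>k. reduced_word (concat (replicate k w))"
    and f: "axial Y \<tau> f m" and fw: "\<And>x. x \<in> M \<Longrightarrow> f x = foldr act w x"
  shows "real (length w) * (\<Lambda> - bound) \<le> m" "m \<le> real (length w) * (\<Lambda> + bound)"
proof -
  interpret f: axial Y \<tau> f m by fact
  define D where "D = d x0 (\<tau> 0)"
  have arch: "p \<le> q" if "\<And>k. real (Suc k) * p \<le> real (Suc k) * q + B" for p q B :: real
  proof (rule ccontr)
    assume "\<not> p \<le> q"
    then obtain k :: nat where "\<bar>B\<bar> < real k * (p - q)" using reals_Archimedean3[of "p - q"] by auto
    moreover have "real k * (p - q) \<le> real (Suc k) * (p - q)" using \<open>\<not> p \<le> q\<close> by (intro mult_right_mono) auto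
    ultimately show False using that[of k] by (simp add: algebra_simps)
  qed
  have pow: "foldr act (concat (replicate k w)) x0 = (f ^^ k) x0 \<and> (f ^^ k) x0 \<in> M" for k
  proof (induction k)
    case (Suc k)
    then show ?case using fw f.h_in by simp
  qed (simp add: x0)
  have near: "\<bar>d x0 ((f ^^ Suc k) x0) - real (Suc k) * m\<bar> \<le> 2 * D" for k
  proof -
    interpret k: axial Y \<tau> "f ^^ Suc k" "real (Suc k) * m" by (rule f.axis_funpow) simp
    let ?F = "f ^^ Suc k"
    have 1: "d (?F x0) (?F (\<tau> 0)) = D" using k.h_dist[OF x0 f.line_in] by (simp add: D_def)
    have 2: "d (\<tau> 0) (?F (\<tau> 0)) = real (Suc k) * m" using k.l_pos by (simp only: k.h_line f.line_dist)
    have "d x0 (?F x0) \<le> d x0 (\<tau> 0) + (d (\<tau> 0) (?F (\<tau> 0)) + d (?F (\<tau> 0)) (?F x0))"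
      using mdist_triangle[of x0 Y "\<tau> 0" "?F x0"] mdist_triangle[of "\<tau> 0" Y "?F (\<tau> 0)" "?F x0"]
        x0 k.h_in[OF x0] k.h_in[OF f.line_in] by (simp del: funpow.simps)
    moreover have "d (\<tau> 0) (?F (\<tau> 0)) \<le> d (\<tau> 0) x0 + (d x0 (?F x0) + d (?F x0) (?F (\<tau> 0)))"
      using mdist_triangle[of "\<tau> 0" Y x0 "?F (\<tau> 0)"] mdist_triangle[of x0 Y "?F x0" "?F (\<tau> 0)"]
        x0 k.h_in[OF x0] k.h_in[OF f.line_in] by (simp del: funpow.simps)
    ultimately show ?thesis using 1 2 D_def mdist_commute[of Y "?F (\<tau> 0)" "?F x0"] mdist_commute[of Y "\<tau> 0" x0]
      by linarith
  qed
  have len: "real (length (concat (replicate k w))) = real k * real (length w)" for k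
    by (induction k) (auto simp: algebra_simps)
  show "real (length w) * (\<Lambda> - bound) \<le> m"
  proof (rule arch)
    fix k
    have "real (length (concat (replicate (Suc k) w))) * (\<Lambda> - bound) - bound \<le> d x0 ((f ^^ Suc k) x0)"
      using displacement_lower[OF _ w(2)[of "Suc k"]] w(1) pow[of "Suc k"] by (simp del: length_concat length_append)
    then show "real (Suc k) * (real (length w) * (\<Lambda> - bound)) \<le> real (Suc k) * m + (2 * D + bound)"
      using near[of k] unfolding len mult.assoc by linarith
  qed
  show "m \<le> real (length w) * (\<Lambda> + bound)"
  proof (rule arch)
    fix k
    have "d x0 ((f ^^ Suc k) x0) \<le> real (length (concat (replicate (Suc k) w))) * (\<Lambda> + bound)"
      using displacement_upper[of "concat (replicate (Suc k) w)"] pow[of "Suc k"] by simp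
    then show "real (Suc k) * m \<le> real (Suc k) * (real (length w) * (\<Lambda> + bound)) + 2 * D"
      using near[of k] unfolding len mult.assoc by linarith
  qed
qed

end

end

section \<open>Ping-pong data from an axis and its image\<close>

definition letter_line :: "(real \<Rightarrow> 'a) \<Rightarrow> ('a \<Rightarrow> 'a) \<Rightarrow> bool \<times> bool \<Rightarrow> real \<Rightarrow> 'a" where
  "letter_line \<sigma> \<phi> s t = (if fst s then id else \<phi>) (\<sigma> (if snd s then t else - t))"

lemma letter_line_simps:
  "letter_line \<sigma> \<phi> (True, True) = \<sigma>" "letter_line \<sigma> \<phi> (True, False) = (\<lambda>t. \<sigma> (- t))"
  "letter_line \<sigma> \<phi> (False, True) = (\<lambda>t. \<phi> (\<sigma> t))" "letter_line \<sigma> \<phi> (False, False) = (\<lambda>t. \<phi> (\<sigma> (- t)))"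
  by (auto simp: letter_line_def)

lemma (in contracting_line) contracting_line_image:
  assumes "isometry_on Y \<phi>" "\<phi> ` M = M"
  shows "contracting_line Y (\<lambda>t. \<phi> (\<sigma> t)) K"
proof -
  have ft: "foot Y (\<lambda>t. \<phi> (\<sigma> t)) (\<phi> x) a \<longleftrightarrow> foot Y \<sigma> x a" if "x \<in> M" for x a
    using assms(1) that by (simp add: foot_def isometry_on_def)
  have "contracting Y (\<lambda>t. \<phi> (\<sigma> t)) K"
    unfolding contracting_def
  proof (intro ballI allI impI, elim conjE)
    fix x y a b
    assume "x \<in> M" "y \<in> M" and ab: "foot Y (\<lambda>t. \<phi> (\<sigma> t)) x a" "foot Y (\<lambda>t. \<phi> (\<sigma> t)) y b" "K \<le> \<bar>a - b\<bar>"
    then have "x \<in> \<phi> ` M" "y \<in> \<phi> ` M" using assms(2) by simp_all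
    then obtain x' y' where x: "x' \<in> M" "x = \<phi> x'" and y: "y' \<in> M" "y = \<phi> y'" by (elim imageE)
    have "d x' (\<sigma> a) + \<bar>a - b\<bar> + d y' (\<sigma> b) - K \<le> d x' y'"
      using ab x y ft by (intro contractingD) auto
    then show "d x (\<phi> (\<sigma> a)) + \<bar>a - b\<bar> + d y (\<phi> (\<sigma> b)) - K \<le> d x y"
      using assms(1) x y by (simp add: isometry_on_def)
  qed
  then show ?thesis
    using geodesic_on_isometry[OF line assms] K_pos by unfold_locales
qed

text \<open>Lines without a common end have bounded feet on each other, in both directions. The base
  point is taken on \<open>\<sigma>\<close>, so \<open>E\<close> is only its distance to its
  image.\<close>

lemma (in contracting_line) ping_pong_ex:
  assumes \<phi>: "isometry_on Y \<phi>" "\<phi> ` M = M"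
    and n: "\<And>\<alpha> \<beta>. \<alpha> \<in> ends \<sigma> \<Longrightarrow> \<beta> \<in> ends \<sigma> \<Longrightarrow> \<not> asymptotic Y (\<lambda>t. \<phi> (\<alpha> t)) \<beta>"
  shows "\<exists>\<theta> E. ping_pong Y (letter_line \<sigma> \<phi>) K \<theta> E (\<sigma> 0)"
proof -
  interpret p: contracting_line Y "\<lambda>t. \<phi> (\<sigma> t)" K by (rule contracting_line_image[OF \<phi>])
  have e: "\<sigma> \<in> ends \<sigma>" "(\<lambda>t. \<sigma> (- t)) \<in> ends \<sigma>" by (simp_all add: ends_def)
  have n': "\<not> asymptotic Y \<beta> (\<lambda>t. \<phi> (\<alpha> t))" if "\<alpha> \<in> ends \<sigma>" "\<beta> \<in> ends \<sigma>" for \<alpha> \<beta>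
    using n[OF that] asymptotic_sym by blast
  obtain B where B: "\<And>t a. foot Y \<sigma> (\<phi> (\<sigma> t)) a \<Longrightarrow> \<bar>a\<bar> \<le> B"
    using bounded_feet_of_line[OF p.line n[OF e(1,1)] n[OF e(1,2)] n[OF e(2,1)] n[OF e(2,2)]] by blast
  obtain C where C: "\<And>t a. foot Y (\<lambda>t. \<phi> (\<sigma> t)) (\<sigma> t) a \<Longrightarrow> \<bar>a\<bar> \<le> C"
    using p.bounded_feet_of_line[OF line n'[OF e(1,1)] n'[OF e(2,1)] n'[OF e(1,2)] n'[OF e(2,2)]] by blast
  interpret r: contracting_line Y "\<lambda>t. \<sigma> (- t)" K by (rule contracting_reverse)
  interpret pr: contracting_line Y "\<lambda>t. \<phi> (\<sigma> (- t))" K by (rule p.contracting_reverse)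
  have "ping_pong Y (letter_line \<sigma> \<phi>) K (max B C) (d (\<sigma> 0) (\<phi> (\<sigma> 0))) (\<sigma> 0)"
  proof (intro ping_pong.intro ping_pong_axioms.intro cat0_axioms)
    fix s :: "bool \<times> bool"
    show "contracting_line Y (letter_line \<sigma> \<phi> s) K"
    proof -
      obtain c e where s: "s = (c, e)" by (cases s)
      show ?thesis
        unfolding s
        using contracting_line_axioms p.contracting_line_axioms r.contracting_line_axioms pr.contracting_line_axioms
        by (cases c; cases e) (simp_all add: letter_line_simps)
    qed
    show "d (\<sigma> 0) (letter_line \<sigma> \<phi> s 0) \<le> d (\<sigma> 0) (\<phi> (\<sigma> 0))"
      by (simp add: letter_line_def)
  next
    fix c e t
    show "letter_line \<sigma> \<phi> (c, \<not> e) t = letter_line \<sigma> \<phi> (c, e) (- t)" by (simp add: letter_line_def)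
  next
    fix c e e' t a
    assume f: "foot Y (letter_line \<sigma> \<phi> (c, e)) (letter_line \<sigma> \<phi> (\<not> c, e') t) a"
    \<comment> \<open>The signs absorb the orientations of the two letters, so that only the bounds
      \<open>B\<close> and \<open>C\<close> for the unreversed lines are needed.\<close>
    define t' a' where "t' = (if e' then t else - t)" and "a' = (if e then a else - a)"
    have pl: "letter_line \<sigma> \<phi> (\<not> c, e') t = (if c then \<phi> (\<sigma> t') else \<sigma> t')"
      by (simp add: letter_line_def t'_def)
    show "\<bar>a\<bar> \<le> max B C"
    proof (cases c)
      case True
      then have "foot Y \<sigma> (\<phi> (\<sigma> t')) a'"
        using f unfolding pl by (cases e) (simp_all add: letter_line_simps foot_reverse a'_def)
      then show ?thesis using B[of t' a'] by (simp add: a'_def split: if_splits)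
    next
      case False
      then have "foot Y (\<lambda>t. \<phi> (\<sigma> t)) (\<sigma> t') a'"
        using f unfolding pl by (cases e) (simp_all add: letter_line_simps p.foot_reverse a'_def)
      then show ?thesis using C[of t' a'] by (simp add: a'_def split: if_splits)
    qed
  qed simp
  then show ?thesis by blast
qed

section \<open>Words in groups\<close>

definition letter :: "('g, 'm) monoid_scheme \<Rightarrow> 'g \<times> bool \<Rightarrow> 'g" where
  "letter G s = (if snd s then fst s else inv\<^bsub>G\<^esub> fst s)"

lemma not_reduced_word:
  "\<not> reduced_word w \<Longrightarrow> \<exists>u x y v. w = u @ x # y # v \<and> fst x = fst y \<and> snd x \<noteq> snd y"
proof (induction w)
  case (Cons x w)
  then have "w \<noteq> []" by (auto simp: reduced_word_def)
  then obtain y v where w: "w = y # v" by (cases w) auto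
  show ?case
  proof (cases "reduced_word w")
    case True
    then have "fst x = fst y \<and> snd x \<noteq> snd y"
      using Cons.prems by (auto simp: reduced_word_def w split: prod.splits)
    then show ?thesis unfolding w by (metis append_Nil)
  next
    case False
    then obtain u x' y' v where "w = u @ x' # y' # v" "fst x' = fst y'" "snd x' \<noteq> snd y'" using Cons.IH by blast
    then show ?thesis by (metis append_Cons)
  qed
qed (simp add: reduced_word_def)

text \<open>Reducedness concerns neighbouring letters only, and every junction of a power already
  occurs in \<open>w @ w\<close>.\<close>

lemma reduced_word_power:
  assumes "reduced_word (w @ w)"
  shows "reduced_word (concat (replicate k w))"
proof (induction k)
  case (Suc k)
  show ?case
  proof (cases "k = 0 \<or> w = []")
    case True
    then show ?thesis
      using assms by (auto simp: reduced_word_def successively_append_iff)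
  next
    case False
    then obtain j where "k = Suc j" by (cases k) auto
    then show ?thesis
      using False Suc assms by (simp add: reduced_word_def successively_append_iff)
  qed
qed (simp add: reduced_word_def)

context group
begin

lemma letter_closed: "fst s \<in> carrier G \<Longrightarrow> letter G s \<in> carrier G"
  by (simp add: letter_def)

lemma word_value_Nil: "word_value G [] = \<one>"
  by (simp add: word_value_def)

lemma word_value_Cons: "word_value G (s # w) = letter G s \<otimes> word_value G w"
  by (simp add: word_value_def letter_def split: prod.split)

lemma word_value_closed: "fst ` set w \<subseteq> carrier G \<Longrightarrow> word_value G w \<in> carrier G"
  by (induction w) (auto simp: word_value_Nil word_value_Cons letter_closed)

lemma word_value_append:
  "fst ` set u \<subseteq> carrier G \<Longrightarrow> fst ` set v \<subseteq> carrier G \<Longrightarrow>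
    word_value G (u @ v) = word_value G u \<otimes> word_value G v"
  by (induction u) (auto simp: word_value_Nil word_value_Cons letter_closed word_value_closed m_assoc)

lemma letter_cancel:
  assumes "fst x \<in> carrier G" "fst x = fst y" "snd x \<noteq> snd y"
  shows "letter G x \<otimes> letter G y = \<one>"
  using assms by (auto simp: letter_def)

lemma generate_word:
  assumes S: "S \<subseteq> carrier G" and g: "g \<in> generate G S"
  shows "\<exists>w. fst ` set w \<subseteq> S \<and> word_value G w = g"
  using g
proof (induction rule: generate.induct)
  case one
  then show ?case by (intro exI[of _ "[]"]) (simp add: word_value_Nil)
next
  case (incl h)
  then show ?case using S by (intro exI[of _ "[(h, True)]"]) (auto simp: word_value_Nil word_value_Cons letter_def)
next
  case (inv h)
  then show ?case using S by (intro exI[of _ "[(h, False)]"]) (auto simp: word_value_Nil word_value_Cons letter_def)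
next
  case (eng h1 h2)
  then obtain u v where u: "fst ` set u \<subseteq> S" "word_value G u = h1" and v: "fst ` set v \<subseteq> S" "word_value G v = h2"
    by blast
  have "fst ` set u \<subseteq> carrier G" "fst ` set v \<subseteq> carrier G" using u v S by auto
  then show ?case using u v word_value_append[of u v] by (intro exI[of _ "u @ v"]) auto
qed

text \<open>A word of minimal length among those that represent a conjugate is cyclically reduced.\<close>

lemma conjugate_cyclically_reduced:
  assumes S: "S \<subseteq> carrier G" and g: "g \<in> generate G S"
  shows "\<exists>w t. fst ` set w \<subseteq> S \<and> t \<in> carrier G \<and> g = t \<otimes> word_value G w \<otimes> inv t \<and>
    (\<forall>k. reduced_word (concat (replicate k w)))"
proof -
  define P where "P w \<longleftrightarrow> fst ` set w \<subseteq> S \<and> (\<exists>t\<in>carrier G. g = t \<otimes> word_value G w \<otimes> inv t)" for w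
  obtain w0 where w0: "fst ` set w0 \<subseteq> S" "word_value G w0 = g" using generate_word[OF S g] by blast
  have "g \<in> carrier G" using generate_in_carrier[OF S g] .
  then have "P w0" using w0 by (auto simp: P_def intro!: bexI[of _ \<one>])
  then obtain w where w: "P w" and min: "\<And>v. P v \<Longrightarrow> length w \<le> length v"
    using exists_least_iff[of "\<lambda>n. \<exists>w. P w \<and> length w = n"] by (metis not_le)
  obtain t where t: "t \<in> carrier G" "g = t \<otimes> word_value G w \<otimes> inv t" and wS: "fst ` set w \<subseteq> S"
    using w by (auto simp: P_def)
  have red: "reduced_word w"
  proof (rule ccontr)
    assume "\<not> reduced_word w"
    then obtain u x y v where d: "w = u @ x # y # v" "fst x = fst y" "snd x \<noteq> snd y" using not_reduced_word by blast
    have in_G: "fst ` set u \<subseteq> carrier G" "fst ` set v \<subseteq> carrier G" "fst x \<in> carrier G" "fst y \<in> carrier G"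
      using wS S d(1) by auto
    have "word_value G w = word_value G u \<otimes> (letter G x \<otimes> letter G y \<otimes> word_value G v)"
      using in_G word_value_append[of u "x # y # v"]
      by (simp add: d(1) word_value_Cons m_assoc letter_closed word_value_closed)
    also have "\<dots> = word_value G (u @ v)"
      using letter_cancel[OF in_G(3) d(2,3)] in_G by (simp add: word_value_append word_value_closed)
    finally have "P (u @ v)" using t wS d(1) by (auto simp: P_def)
    then show False using min[of "u @ v"] d(1) by simp
  qed
  have "reduced_word (w @ w)"
  proof (rule ccontr)
    assume "\<not> reduced_word (w @ w)"
    then have ne: "w \<noteq> []" and lh: "fst (last w) = fst (hd w)" "snd (last w) \<noteq> snd (hd w)"
      using red by (auto simp: reduced_word_def successively_append_iff split: prod.splits)
    obtain x w' where x: "w = x # w'" using ne by (cases w) auto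
    have "w' \<noteq> []" using lh x by auto
    then obtain u y where y: "w = x # u @ [y]" using x by (cases w' rule: rev_cases) auto
    have xy: "fst y = fst x" "snd y \<noteq> snd x" using lh y by auto
    have in_G: "fst ` set u \<subseteq> carrier G" "fst x \<in> carrier G" "fst y \<in> carrier G" using wS S y by auto
    let ?x = "letter G x" and ?u = "word_value G u" and ?y = "letter G y"
    have c: "?x \<in> carrier G" "?u \<in> carrier G" "?y \<in> carrier G"
      using in_G by (auto simp: letter_closed word_value_closed)
    \<comment> \<open>The last letter is the inverse of the first. Moving the first into the
      conjugating element leaves the word \<open>u\<close>, shorter by two.\<close>
    have "?y \<otimes> ?x = \<one>" using letter_cancel[OF in_G(3) xy] .
    then have yx: "?y = inv ?x" using c by (simp add: inv_equality)
    have "word_value G w = ?x \<otimes> (?u \<otimes> inv ?x)"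
      using in_G c by (simp add: y word_value_Cons word_value_append word_value_Nil yx)
    then have "g = (t \<otimes> ?x) \<otimes> ?u \<otimes> inv (t \<otimes> ?x)"
      using t c by (simp add: m_assoc inv_mult_group)
    then have "P u" using t c wS y by (auto simp: P_def intro!: bexI[of _ "t \<otimes> ?x"])
    then show False using min[of u] y by simp
  qed
  then show ?thesis using t wS reduced_word_power by blast
qed

end


section \<open>The action on the factors\<close>

context
  fixes X :: "'n \<Rightarrow> 'a metric"
begin

interpretation G: group "isometry_product_group X"
  by (rule group_isometry_product_group)

lemma in_isometry_product_group:
  "g \<in> carrier (isometry_product_group X) \<longleftrightarrow> (\<forall>i. g i \<in> carrier (isometry_group (X i)))"
  by (auto simp: isometry_product_group_def PiE_iff)

lemma isometry_groupD:
  assumes "h \<in> carrier (isometry_group Y)"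
  shows "isometry_on Y h" "h ` mspace Y = mspace Y" "h \<in> Bij (mspace Y)"
  using assms by (auto simp: isometry_group_def Bij_def bij_betw_def)

lemma componentD:
  assumes "g \<in> carrier (isometry_product_group X)"
  shows "isometry_on (X i) (g i)" "g i ` mspace (X i) = mspace (X i)" "x \<in> mspace (X i) \<Longrightarrow> g i x \<in> mspace (X i)"
proof -
  show "isometry_on (X i) (g i)" "g i ` mspace (X i) = mspace (X i)"
    using assms isometry_groupD[of "g i" "X i"] by (auto simp: in_isometry_product_group)
  then show "g i x \<in> mspace (X i)" if "x \<in> mspace (X i)" using that by blast
qed

text \<open>Elements of the group are restricted to the underlying space, so products are
  compositions only there; this is why such laws carry a membership hypothesis.\<close>

lemma mult_apply:
  assumes "g \<in> carrier (isometry_product_group X)" "h \<in> carrier (isometry_product_group X)" "x \<in> mspace (X i)"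
  shows "(g \<otimes>\<^bsub>isometry_product_group X\<^esub> h) i x = g i (h i x)"
proof -
  have "g i \<in> Bij (mspace (X i))" "h i \<in> Bij (mspace (X i))"
    using assms(1,2) isometry_groupD(3) by (auto simp: in_isometry_product_group)
  then show ?thesis
    using assms(3) by (simp add: isometry_product_group_def isometry_group_def BijGroup_def compose_def)
qed

lemma one_apply:
  "x \<in> mspace (X i) \<Longrightarrow> \<one>\<^bsub>isometry_product_group X\<^esub> i x = x"
  by (simp add: isometry_product_group_def isometry_group_def BijGroup_def)

lemma inv_apply:
  assumes "g \<in> carrier (isometry_product_group X)" "x \<in> mspace (X i)"
  shows "(inv\<^bsub>isometry_product_group X\<^esub> g) i (g i x) = x"
  using mult_apply[of "inv\<^bsub>isometry_product_group X\<^esub> g" g x i] assms one_apply by simp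

lemma pow_apply:
  assumes "g \<in> carrier (isometry_product_group X)" "x \<in> mspace (X i)"
  shows "(g [^]\<^bsub>isometry_product_group X\<^esub> (n::nat)) i x = (g i ^^ n) x"
  using assms(2)
proof (induction n arbitrary: x)
  case 0
  then show ?case by (simp add: one_apply)
next
  case (Suc n)
  then show ?case
    using assms(1) componentD(3)[OF assms(1) Suc.prems]
    by (simp add: mult_apply funpow_swap1)
qed

lemma word_value_apply:
  assumes "fst ` set w \<subseteq> carrier (isometry_product_group X)" "x \<in> mspace (X i)"
  shows "word_value (isometry_product_group X) w i x =
    foldr (\<lambda>s. letter (isometry_product_group X) s i) w x"
  using assms
proof (induction w)
  case Nil
  then show ?case by (simp add: G.word_value_Nil one_apply)
next
  case (Cons s w)
  then show ?case
    using mult_apply[of "letter (isometry_product_group X) s" "word_value (isometry_product_group X) w" x i]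
    by (simp add: G.word_value_Cons G.letter_closed G.word_value_closed)
qed

end


section \<open>Axes of powers, inverses and conjugates\<close>

lemma axis_cong:
  assumes "axial Y \<sigma> h l" "\<And>x. x \<in> mspace Y \<Longrightarrow> h' x = h x"
  shows "axial Y \<sigma> h' l"
proof -
  interpret a: axial Y \<sigma> h l by fact
  have "isometry_on Y h'" using a.iso assms(2) by (simp add: isometry_on_def)
  moreover have "h' ` mspace Y = mspace Y" using a.onto assms(2) by (metis image_cong)
  moreover have "axis_of Y h' l \<sigma>" using a.ax assms(2) by (simp add: axis_of_def)
  ultimately show ?thesis by unfold_locales
qed

lemma axis_inverse:
  assumes "axial Y \<sigma> h l" "isometry_on Y h'" "h' ` mspace Y = mspace Y" "\<And>x. x \<in> mspace Y \<Longrightarrow> h' (h x) = x"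
  shows "axial Y (\<lambda>t. \<sigma> (- t)) h' l"
proof -
  interpret a: axial Y \<sigma> h l by fact
  interpret r: cat0_line Y "\<lambda>t. \<sigma> (- t)" by (rule a.reverse)
  have "h' (\<sigma> (- t)) = \<sigma> (- (t + l))" for t
    using assms(4)[OF a.line_in, of "- (t + l)"] by (simp add: a.h_line)
  then have "axis_of Y h' l (\<lambda>t. \<sigma> (- t))" using a.l_pos r.line by (simp add: axis_of_def)
  then show ?thesis using assms(2,3) by unfold_locales
qed

lemma axis_conjugate:
  assumes "axial Y \<sigma> h l" "isometry_on Y h'" "h' ` mspace Y = mspace Y"
    and "isometry_on Y \<phi>" "\<phi> ` mspace Y = mspace Y" "\<And>x. x \<in> mspace Y \<Longrightarrow> h' (\<phi> x) = \<phi> (h x)"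
  shows "axial Y (\<lambda>t. \<phi> (\<sigma> t)) h' l"
proof -
  interpret a: axial Y \<sigma> h l by fact
  have "geodesic_on Y UNIV (\<lambda>t. \<phi> (\<sigma> t))" using geodesic_on_isometry[OF a.line assms(4,5)] .
  moreover have "axis_of Y h' l (\<lambda>t. \<phi> (\<sigma> t))"
    using calculation a.l_pos assms(6) by (simp add: axis_of_def a.h_line)
  ultimately show ?thesis using assms(2,3) by unfold_locales
qed

text \<open>The only place where the absence of a flat half-plane enters for group elements;
  afterwards contraction takes over.\<close>

lemma rank_one_contracting_axis:
  assumes Y: "Hadamard_space Y" "locally_compact_space (mtopology_of Y)" and h: "rank_one Y h"
  obtains \<sigma> K where "contracting_axis Y \<sigma> h (translation_length Y h) K"
proof -
  obtain l \<sigma> where ax: "axis_of Y h l \<sigma>" and nb: "\<not> bounds_flat_half_plane Y \<sigma>" and hG: "h \<in> carrier (isometry_group Y)"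
    using h by (auto simp: rank_one_def)
  have geo: "geodesic_on Y UNIV \<sigma>" using ax by (simp add: axis_of_def)
  interpret cat0 Y using Y(1) by unfold_locales (simp add: Hadamard_space_def)
  interpret axial Y \<sigma> h l using isometry_groupD[OF hG] ax geo by unfold_locales
  have complete: "mcomplete_of Y" using Y(1) by (simp add: Hadamard_space_def)
  obtain K where "0 < K" "contracting Y \<sigma> K"
    using contracting_ex[OF complete hopf_rinow[OF complete Y(2)] nb] by blast
  then interpret contracting_axis Y \<sigma> h l K by unfold_locales
  have "translation_length Y h = l" using translation_length_eq[OF iso ax] .
  then show thesis using that[of \<sigma> K] contracting_axis_axioms by simp
qed

lemma independent_ends:
  assumes "independent_rank_one Y g h" and g: "axial Y \<sigma> g l" and h: "axial Y \<tau> h m"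
    and e: "\<alpha> \<in> ends \<sigma>" "\<beta> \<in> ends \<tau>"
  shows "\<not> asymptotic Y \<alpha> \<beta>"
proof
  interpret g: axial Y \<sigma> g l by fact
  interpret h: axial Y \<tau> h m by fact
  assume "asymptotic Y \<alpha> \<beta>"
  then obtain B where "\<And>t. t \<ge> 0 \<Longrightarrow> mdist Y (\<alpha> t) (\<beta> t) \<le> B" by (auto simp: asymptotic_def)
  then have "ray_end Y \<alpha> = ray_end Y \<beta>"
    using geodesic_on_ends[OF g.line e(1)] geodesic_on_ends[OF h.line e(2)] by (intro ray_end_cong)
  moreover have "ray_end Y \<alpha> \<in> {attracting_point Y g, repelling_point Y g}"
    using e(1) attracting_point_eq[OF g.iso g.ax] repelling_point_eq[OF g.iso g.ax] by (auto simp: ends_def)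
  moreover have "ray_end Y \<beta> \<in> {attracting_point Y h, repelling_point Y h}"
    using e(2) attracting_point_eq[OF h.iso h.ax] repelling_point_eq[OF h.iso h.ax] by (auto simp: ends_def)
  moreover have "{attracting_point Y g, repelling_point Y g} \<inter> {attracting_point Y h, repelling_point Y h} = {}"
    using assms(1) by (simp only: independent_rank_one_def)
  ultimately show False by (metis disjoint_iff)
qed

section \<open>Closed cones\<close>

text \<open>The minors of \<open>v\<close> and \<open>v0\<close> measure their difference in
  direction. The condition on them is closed and invariant under scaling, so it passes from
  translation vectors to a whole limit cone.\<close>

lemma closed_cone_neighbourhood:
  fixes C :: "(real^'n::finite) set"
  assumes C: "open C" "\<And>v t. v \<in> C \<Longrightarrow> 0 < t \<Longrightarrow> t *\<^sub>R v \<in> C"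
    and v0: "v0 \<in> C" "\<And>i. 0 < v0 $ i"
  obtains \<delta> where "0 < \<delta>"
    "\<And>v. (\<And>i. 0 \<le> v $ i) \<Longrightarrow> (\<And>i j. \<bar>v $ i * v0 $ j - v $ j * v0 $ i\<bar> \<le> \<delta> * v $ j) \<Longrightarrow> v \<noteq> 0 \<Longrightarrow> v \<in> C"
proof -
  obtain e where e: "0 < e" "ball v0 e \<subseteq> C" using C(1) v0(1) openE by blast
  \<comment> \<open>The norm is estimated by the sum of the coordinates, each of which contributes
    at most \<delta>.\<close>
  define \<delta> where "\<delta> = e / (2 * real CARD('n))"
  have \<delta>: "0 < \<delta>" "real CARD('n) * \<delta> < e" using e(1) by (auto simp: \<delta>_def)
  show thesis
  proof (rule that[OF \<delta>(1)])
    fix v :: "real^'n"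
    assume nonneg: "\<And>i. 0 \<le> v $ i" and v: "\<And>i j. \<bar>v $ i * v0 $ j - v $ j * v0 $ i\<bar> \<le> \<delta> * v $ j" and "v \<noteq> 0"
    then obtain j where "v $ j \<noteq> 0" by (auto simp: vec_eq_iff)
    then have vj: "0 < v $ j" using nonneg[of j] by simp
    define s where "s = v $ j / v0 $ j"
    have s: "0 < s" "v $ j = s * v0 $ j" using vj v0(2)[of j] by (auto simp: s_def)
    have close: "\<bar>v $ i - s * v0 $ i\<bar> \<le> s * \<delta>" for i
    proof -
      have "v $ i * v0 $ j - v $ j * v0 $ i = (v $ i - s * v0 $ i) * v0 $ j" by (simp add: s(2) algebra_simps)
      then have "\<bar>v $ i - s * v0 $ i\<bar> * v0 $ j \<le> s * \<delta> * v0 $ j"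
        using v[of i j] v0(2)[of j] by (simp add: abs_mult s(2) mult_ac)
      then show ?thesis using v0(2)[of j] by simp
    qed
    have "\<bar>(v0 - (1 / s) *\<^sub>R v) $ i\<bar> \<le> \<delta>" for i
    proof -
      have "(v0 - (1 / s) *\<^sub>R v) $ i = - ((v $ i - s * v0 $ i) / s)"
        using s(1) by (simp add: field_simps)
      then have "\<bar>(v0 - (1 / s) *\<^sub>R v) $ i\<bar> = \<bar>v $ i - s * v0 $ i\<bar> / s"
        using s(1) by (simp only: abs_minus_cancel abs_divide abs_of_pos)
      also have "\<dots> \<le> s * \<delta> / s" using close[of i] s(1) by (intro divide_right_mono) auto
      finally show ?thesis using s(1) by simp
    qed
    then have "norm (v0 - (1 / s) *\<^sub>R v) \<le> (\<Sum>i\<in>(UNIV::'n set). \<delta>)"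
      by (intro order_trans[OF norm_le_l1_cart] sum_mono)
    then have "(1 / s) *\<^sub>R v \<in> C" using \<delta>(2) e(2) by (auto simp: dist_norm)
    then have "s *\<^sub>R (1 / s) *\<^sub>R v \<in> C" using C(2) s(1) by blast
    then show "v \<in> C" using s(1) by simp
  qed
qed

lemma closed_cone_condition:
  fixes v0 :: "real^'n::finite"
  shows "closed {v. (\<forall>i. 0 \<le> v $ i) \<and> (\<forall>i j. \<bar>v $ i * v0 $ j - v $ j * v0 $ i\<bar> \<le> \<delta> * v $ j)}"
  by (intro closed_Collect_conj closed_Collect_all closed_Collect_le continuous_intros)


section \<open>Schottky subgroups\<close>

lemma (in group) subgroup_nat_pow_closed:
  fixes n :: nat
  assumes "subgroup H G" "x \<in> H"
  shows "x [^] n \<in> H"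
  by (induction n) (auto simp: subgroup.one_closed[OF assms(1)] subgroup.m_closed[OF assms(1)] assms(2))

text \<open>Candidates are the products of a power of \<open>g\<close> and a power of
  \<open>h\<close> with exponents below \<open>N\<close>. By \<open>few_exceptions\<close> each pair
  of ends in each factor rules out at most \<open>N\<close> of the \<open>N * N\<close>
  candidates.\<close>

lemma separating_element:
  fixes X :: "'n::finite \<Rightarrow> 'a metric"
  assumes \<Gamma>: "subgroup \<Gamma> (isometry_product_group X)" and g: "g \<in> \<Gamma>" and h: "h \<in> \<Gamma>"
    and axes: "\<And>i. contracting_axis (X i) (\<tau> i) (g i) (l i) (K i)" "\<And>i. contracting_axis (X i) (\<tau>' i) (h i) (l' i) (K' i)"
    and indep: "\<And>i \<xi> \<eta>. \<xi> \<in> ends (\<tau> i) \<Longrightarrow> \<eta> \<in> ends (\<tau>' i) \<Longrightarrow> \<not> asymptotic (X i) \<xi> \<eta>"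
    and \<sigma>: "\<And>i. geodesic_on (X i) UNIV (\<sigma> i)"
  shows "\<exists>\<phi>\<in>\<Gamma>. \<forall>i. \<forall>\<alpha>\<in>ends (\<sigma> i). \<forall>\<beta>\<in>ends (\<sigma> i). \<not> asymptotic (X i) (\<lambda>t. \<phi> i (\<alpha> t)) \<beta>"
proof -
  let ?G = "isometry_product_group X"
  interpret G: group ?G by (rule group_isometry_product_group)
  have in_G: "g \<in> carrier ?G" "h \<in> carrier ?G" using \<Gamma> g h subgroup.subset by auto
  \<comment> \<open>There are at most four pairs of ends per factor, hence fewer than
    \<open>N\<close> conditions.\<close>
  define N where "N = 4 * CARD('n) + 1"
  define I where "I = (SIGMA i:UNIV. ends (\<sigma> i) \<times> ends (\<sigma> i))"
  define bad where "bad = (\<lambda>(i, \<alpha>, \<beta>). {(p, q). p < N \<and> q < N \<and>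
    asymptotic (X i) (\<lambda>t. (g i ^^ p) ((h i ^^ q) (\<alpha> t))) \<beta>})"
  have ends_card: "finite (ends \<rho>) \<and> card (ends \<rho>) \<le> 2" for \<rho> :: "real \<Rightarrow> 'a"
    by (auto simp: ends_def card_insert_if)
  have sq: "card (ends \<rho> \<times> ends \<rho>) \<le> 4" for \<rho> :: "real \<Rightarrow> 'a"
    using mult_mono[of "card (ends \<rho>)" 2 "card (ends \<rho>)" 2] ends_card[of \<rho>] by (simp add: card_cartesian_product)
  have "card I = (\<Sum>i\<in>UNIV. card (ends (\<sigma> i) \<times> ends (\<sigma> i)))"
    unfolding I_def using ends_card by (intro card_SigmaI) auto
  also have "\<dots> \<le> (\<Sum>i\<in>(UNIV::'n set). 4)" by (intro sum_mono sq)
  finally have cI: "card I < N" by (simp add: N_def)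
  have fI: "finite I" using ends_card by (auto simp: I_def)
  have "card (bad x) \<le> N" if "x \<in> I" for x
  proof -
    obtain i \<alpha> \<beta> where x: "x = (i, \<alpha>, \<beta>)" "\<alpha> \<in> ends (\<sigma> i)" "\<beta> \<in> ends (\<sigma> i)" using \<open>x \<in> I\<close> by (auto simp: I_def)
    show ?thesis
      unfolding x(1) bad_def prod.case
      using few_exceptions[OF axes(1) axes(2) indep geodesic_on_ends[OF \<sigma> x(2)] geodesic_on_ends[OF \<sigma> x(3)]] .
  qed
  then have "(\<Sum>x\<in>I. card (bad x)) \<le> card I * N"
    using sum_bounded_above[of I "\<lambda>x. card (bad x)" N] by simp
  then have "card (\<Union>x\<in>I. bad x) \<le> card I * N" using card_UN_le[OF fI, of bad] by simp
  also have "\<dots> < card ({..<N} \<times> {..<N})" proof -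
    have "0 < N" by (simp add: N_def)
    then show ?thesis using mult_strict_right_mono[OF cI, of N] by (simp add: card_cartesian_product)
  qed
  finally have lt: "card (\<Union>x\<in>I. bad x) < card ({..<N} \<times> {..<N})" .
  have "\<not> {..<N} \<times> {..<N} \<subseteq> (\<Union>x\<in>I. bad x)"
  proof
    assume sub: "{..<N} \<times> {..<N} \<subseteq> (\<Union>x\<in>I. bad x)"
    have "finite (bad x)" for x
      by (rule finite_subset[of _ "{..<N} \<times> {..<N}"]) (auto simp: bad_def split: prod.splits)
    then show False using card_mono[OF _ sub] fI lt by (simp add: not_less[symmetric])
  qed
  then obtain p q where pq: "p < N" "q < N" "\<And>x. x \<in> I \<Longrightarrow> (p, q) \<notin> bad x" by auto
  define \<phi> where "\<phi> = g [^]\<^bsub>?G\<^esub> p \<otimes>\<^bsub>?G\<^esub> h [^]\<^bsub>?G\<^esub> q"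
  have pows: "g [^]\<^bsub>?G\<^esub> p \<in> \<Gamma>" "h [^]\<^bsub>?G\<^esub> q \<in> \<Gamma>"
    using G.subgroup_nat_pow_closed[OF \<Gamma>] g h by auto
  then have "\<phi> \<in> \<Gamma>" using subgroup.m_closed[OF \<Gamma>] by (simp add: \<phi>_def)
  moreover have "\<not> asymptotic (X i) (\<lambda>t. \<phi> i (\<alpha> t)) \<beta>" if ab: "\<alpha> \<in> ends (\<sigma> i)" "\<beta> \<in> ends (\<sigma> i)" for i \<alpha> \<beta>
  proof -
    have "\<phi> i x = (g i ^^ p) ((h i ^^ q) x)" if "x \<in> mspace (X i)" for x
      using that in_G componentD(3)[OF G.nat_pow_closed[OF in_G(2), of q] that]
      by (simp add: \<phi>_def mult_apply pow_apply)
    moreover have "\<alpha> t \<in> mspace (X i)" if "0 \<le> t" for t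
      using geodesic_on_ends[OF \<sigma> ab(1)] that by (auto simp: geodesic_on_def)
    ultimately have "asymptotic (X i) (\<lambda>t. \<phi> i (\<alpha> t)) \<beta> \<longleftrightarrow> asymptotic (X i) (\<lambda>t. (g i ^^ p) ((h i ^^ q) (\<alpha> t))) \<beta>"
      by (simp add: asymptotic_def)
    then show ?thesis using pq(3)[of "(i, \<alpha>, \<beta>)"] pq(1,2) ab by (auto simp: I_def bad_def)
  qed
  ultimately show ?thesis by blast
qed

lemma letter_axis:
  fixes X :: "'n::finite \<Rightarrow> 'a metric" and \<gamma> \<phi> :: "'n \<Rightarrow> 'a \<Rightarrow> 'a" and n :: nat
  defines "G \<equiv> isometry_product_group X"
  defines "a \<equiv> \<gamma> [^]\<^bsub>G\<^esub> n"
  assumes in_G: "\<gamma> \<in> carrier G" "\<phi> \<in> carrier G" and ax: "axial (X i) \<sigma> (\<gamma> i) l" and n: "0 < n"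
  shows "axial (X i) (letter_line \<sigma> (\<phi> i) s)
    (letter G (if fst s then a else \<phi> \<otimes>\<^bsub>G\<^esub> a \<otimes>\<^bsub>G\<^esub> inv\<^bsub>G\<^esub> \<phi>, snd s) i) (real n * l)"
proof -
  interpret G: group G unfolding G_def by (rule group_isometry_product_group)
  let ?b = "\<phi> \<otimes>\<^bsub>G\<^esub> a \<otimes>\<^bsub>G\<^esub> inv\<^bsub>G\<^esub> \<phi>"
  have c: "a \<in> carrier G" "?b \<in> carrier G" using in_G by (simp_all add: a_def)
  have iso: "isometry_on (X i) (f i)" "f i ` mspace (X i) = mspace (X i)" if "f \<in> carrier G" for f
    using that componentD(1,2)[of f X i] by (simp_all add: G_def)
  have inv: "(inv\<^bsub>G\<^esub> f) i (f i x) = x" if "f \<in> carrier G" "x \<in> mspace (X i)" for f x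
    using that inv_apply[of f X x i] by (simp add: G_def)
  have a: "axial (X i) \<sigma> (a i) (real n * l)"
    using axial.axis_funpow[OF ax n] by (rule axis_cong) (use in_G in \<open>simp add: a_def G_def pow_apply\<close>)
  have b: "axial (X i) (\<lambda>t. \<phi> i (\<sigma> t)) (?b i) (real n * l)"
  proof (rule axis_conjugate[OF a])
    fix x assume x: "x \<in> mspace (X i)"
    have "?b \<otimes>\<^bsub>G\<^esub> \<phi> = \<phi> \<otimes>\<^bsub>G\<^esub> a" using in_G c(1) by (simp add: G.m_assoc)
    then have "(?b \<otimes>\<^bsub>G\<^esub> \<phi>) i x = (\<phi> \<otimes>\<^bsub>G\<^esub> a) i x" by simp
    then show "?b i (\<phi> i x) = \<phi> i (a i x)"
      using mult_apply[of ?b X \<phi> x i] mult_apply[of \<phi> X a x i] in_G c x by (simp add: G_def)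
  qed (use iso in_G c in auto)
  have ai: "axial (X i) (\<lambda>t. \<sigma> (- t)) ((inv\<^bsub>G\<^esub> a) i) (real n * l)"
    using c by (intro axis_inverse[OF a] iso inv) auto
  have bi: "axial (X i) (\<lambda>t. \<phi> i (\<sigma> (- t))) ((inv\<^bsub>G\<^esub> ?b) i) (real n * l)"
    using c by (intro axis_inverse[OF b] iso inv) auto
  obtain c e where s: "s = (c, e)" by (cases s)
  show ?thesis
    unfolding s using a b ai bi by (cases c; cases e) (simp_all add: letter_def letter_line_simps)
qed

text \<open>Ping-pong uses Boolean labels instead of group elements. As \<open>a\<close> and
  \<open>b\<close> differ, cancellation in the elements and in the labels is the same.\<close>

lemma word_value_pair:
  fixes a b :: 'g
  assumes ab: "a \<noteq> b" and w: "fst ` set w \<subseteq> {a, b}"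
  obtains v where "w = map (\<lambda>s. (if fst s then a else b, snd s)) v" "length v = length w"
    "reduced_word w \<longleftrightarrow> reduced_word v"
proof
  let ?f = "\<lambda>s. (if fst s then a else b, snd s)" and ?g = "\<lambda>s. (fst s = a, snd s)"
  show "w = map ?f (map ?g w)"
    using w by (induction w) (auto simp: prod_eq_iff)
  have "reduced_word w \<longleftrightarrow> reduced_word (map ?f (map ?g w))"
    using \<open>w = map ?f (map ?g w)\<close> by simp
  also have "\<dots> \<longleftrightarrow> reduced_word (map ?g w)"
    unfolding reduced_word_def successively_map[of _ ?f] using ab
    by (intro arg_cong2[where f = successively] refl ext) (auto split: prod.split)
  finally show "reduced_word w \<longleftrightarrow> reduced_word (map ?g w)" .
qed simp

theorem proposition6p5:
  fixes X :: "'n::finite \<Rightarrow> 'a metric"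
    and \<Gamma> :: "('n \<Rightarrow> 'a \<Rightarrow> 'a) set"
    and C :: "(real^'n) set"
  assumes "\<And>i. Hadamard_space (X i)"
    and "\<And>i. locally_compact_space (mtopology_of (X i))"
    and "subgroup \<Gamma> (isometry_product_group X)"
    and "properly_discontinuous X \<Gamma>"
    and "\<exists>g\<in>\<Gamma>. \<exists>h\<in>\<Gamma>. independent_regular_axial X g h"
    and "open C"
    and "C \<subseteq> {v. \<forall>i. 0 < v $ i}"
    and "\<And>v t. v \<in> C \<Longrightarrow> 0 < t \<Longrightarrow> t *\<^sub>R v \<in> C"
    and "C \<inter> limit_cone X \<Gamma> \<noteq> {}"
  shows "\<exists>\<Gamma>'. \<Gamma>' \<subseteq> \<Gamma> \<and> free_subgroup \<Gamma>' (isometry_product_group X) \<and>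
    nonabelian \<Gamma>' (isometry_product_group X) \<and>
    limit_cone X \<Gamma>' - {0} \<subseteq> C"
proof -
  define G where "G = isometry_product_group X"
  interpret G: group G unfolding G_def by (rule group_isometry_product_group)
  have \<Gamma>: "subgroup \<Gamma> G" using assms(3) by (simp add: G_def)
  have \<Gamma>G: "\<Gamma> \<subseteq> carrier G" using \<Gamma> by (rule subgroup.subset)
  have contr: "\<exists>\<sigma> K. contracting_axis (X i) \<sigma> (f i) (translation_length (X i) (f i)) K"
    if "regular_axial X f" for f i
    using that rank_one_contracting_axis[OF assms(1,2)] unfolding regular_axial_def by metis

  obtain \<gamma> where \<gamma>: "\<gamma> \<in> \<Gamma>" "regular_axial X \<gamma>" and \<gamma>C: "translation_vector X \<gamma> \<in> C"
  proof -
    let ?V = "\<Union>\<gamma>\<in>{\<gamma>\<in>\<Gamma>. regular_axial X \<gamma>}. {t *\<^sub>R translation_vector X \<gamma> | t. 0 \<le> t}"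
    have "C \<inter> ?V \<noteq> {}"
      using assms(9) open_Int_closure_eq_empty[OF assms(6), of ?V] by (simp add: limit_cone_def)
    then obtain \<gamma> t where *: "\<gamma> \<in> \<Gamma>" "regular_axial X \<gamma>" "0 \<le> t" "t *\<^sub>R translation_vector X \<gamma> \<in> C"
      by auto
    \<comment> \<open>The half-line includes its origin, but \<open>C\<close> lies in the open
      orthant.\<close>
    have "t \<noteq> 0" using *(4) assms(7) by auto
    then have "(1 / t) *\<^sub>R t *\<^sub>R translation_vector X \<gamma> \<in> C" using *(3) by (intro assms(8) *(4)) simp
    then show thesis using that * \<open>t \<noteq> 0\<close> by simp
  qed
  define l where "l i = translation_length (X i) (\<gamma> i)" for i
  have tv: "translation_vector X f $ i = translation_length (X i) (f i)" for f i
    by (simp add: translation_vector_def)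
  obtain \<sigma> K where ax: "\<And>i. contracting_axis (X i) (\<sigma> i) (\<gamma> i) (l i) (K i)"
    using contr[OF \<gamma>(2)] unfolding l_def by metis
  have axi: "axial (X i) (\<sigma> i) (\<gamma> i) (l i)" for i using ax contracting_axis.axioms(1) by blast
  have conl: "contracting_line (X i) (\<sigma> i) (K i)" for i using ax contracting_axis.axioms(2) by blast
  have line: "geodesic_on (X i) UNIV (\<sigma> i)" for i
    using axi[of i] by (simp add: axial_def cat0_line_def cat0_line_axioms_def)
  have l_pos: "0 < l i" for i using axial.l_pos[OF axi] .

  obtain g h where gh: "g \<in> \<Gamma>" "h \<in> \<Gamma>" "independent_regular_axial X g h" using assms(5) by blast
  obtain \<tau> Kg where ag: "\<And>i. contracting_axis (X i) (\<tau> i) (g i) (translation_length (X i) (g i)) (Kg i)"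
    using contr[of g] gh(3) unfolding independent_regular_axial_def by metis
  obtain \<tau>' Kh where ah: "\<And>i. contracting_axis (X i) (\<tau>' i) (h i) (translation_length (X i) (h i)) (Kh i)"
    using contr[of h] gh(3) unfolding independent_regular_axial_def by metis
  have "\<not> asymptotic (X i) \<xi> \<eta>" if "\<xi> \<in> ends (\<tau> i)" "\<eta> \<in> ends (\<tau>' i)" for i \<xi> \<eta>
    using gh(3) independent_ends[OF _ contracting_axis.axioms(1)[OF ag] contracting_axis.axioms(1)[OF ah] that]
    by (simp add: independent_regular_axial_def)
  then obtain \<phi> where \<phi>: "\<phi> \<in> \<Gamma>"
    and sep: "\<And>i \<alpha> \<beta>. \<alpha> \<in> ends (\<sigma> i) \<Longrightarrow> \<beta> \<in> ends (\<sigma> i) \<Longrightarrow> \<not> asymptotic (X i) (\<lambda>t. \<phi> i (\<alpha> t)) \<beta>"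
    using separating_element[OF assms(3) gh(1,2) ag ah _ line] by blast
  have in_G: "\<gamma> \<in> carrier G" "\<phi> \<in> carrier G" using \<gamma> \<phi> \<Gamma>G by auto
  have \<phi>i: "isometry_on (X i) (\<phi> i)" "\<phi> i ` mspace (X i) = mspace (X i)" for i
    using componentD(1,2)[OF in_G(2)[unfolded G_def]] by auto
  obtain \<theta> E where pp: "\<And>i. ping_pong (X i) (letter_line (\<sigma> i) (\<phi> i)) (K i) (\<theta> i) (E i) (\<sigma> i 0)"
    using contracting_line.ping_pong_ex[OF conl \<phi>i sep] by metis
  \<comment> \<open>One error constant for all factors, independent of the power \<open>n\<close>
    chosen next.\<close>
  define W where "W = Max (range (\<lambda>i. ping_pong.bound (K i) (\<theta> i) (E i)))"
  have W: "ping_pong.bound (K i) (\<theta> i) (E i) \<le> W" for i unfolding W_def by (intro Max_ge) auto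
  have W_pos: "0 < W" using ping_pong.bound_pos[OF pp] W less_le_trans by blast

  obtain \<delta> where \<delta>: "0 < \<delta>" "\<And>v. (\<And>i. 0 \<le> v $ i) \<Longrightarrow>
      (\<And>i j. \<bar>v $ i * translation_vector X \<gamma> $ j - v $ j * translation_vector X \<gamma> $ i\<bar> \<le> \<delta> * v $ j) \<Longrightarrow> v \<noteq> 0 \<Longrightarrow> v \<in> C"
    using closed_cone_neighbourhood[OF assms(6,8) \<gamma>C] l_pos unfolding tv l_def by metis
  \<comment> \<open>The first condition is what ping-pong asks for. The second weighs errors in the
    minors: for words of length \<open>m\<close> these are at most
    \<open>m * W * (l i + l j)\<close>, while component \<open>j\<close> is at least
    \<open>m * (n * l j - W)\<close>.\<close>
  have "\<forall>\<^sub>F n :: nat in sequentially. \<forall>i j. 2 * W < real n * l i \<and> W * (l i + l j) \<le> \<delta> * (real n * l j - W)"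
    unfolding eventually_all_finite
  proof (intro eventually_all_finite eventually_conj)
    fix i j
    show "\<forall>\<^sub>F n :: nat in sequentially. 2 * W < real n * l i" using l_pos[of i] by real_asymp
    show "\<forall>\<^sub>F n :: nat in sequentially. W * (l i + l j) \<le> \<delta> * (real n * l j - W)"
      using l_pos[of j] \<delta>(1) by real_asymp
  qed
  then obtain n :: nat where n: "\<And>i. 2 * W < real n * l i"
    and n\<delta>: "\<And>i j. W * (l i + l j) \<le> \<delta> * (real n * l j - W)"
    by (auto simp: eventually_sequentially)
  have n0: "0 < n" using n[of undefined] W_pos by (cases "n = 0") auto
  have Wn: "ping_pong.bound (K i) (\<theta> i) (E i) \<le> real n * l i" "2 * ping_pong.bound (K i) (\<theta> i) (E i) < real n * l i" for i
    using W[of i] n[of i] W_pos by linarith+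

  define a where "a = \<gamma> [^]\<^bsub>G\<^esub> n"
  define b where "b = \<phi> \<otimes>\<^bsub>G\<^esub> a \<otimes>\<^bsub>G\<^esub> inv\<^bsub>G\<^esub> \<phi>"
  have ab_\<Gamma>: "a \<in> \<Gamma>" "b \<in> \<Gamma>"
    unfolding a_def b_def using \<gamma>(1) \<phi> \<Gamma>
    by (auto intro!: G.subgroup_nat_pow_closed subgroup.m_closed subgroup.m_inv_closed)
  then have ab: "a \<in> carrier G" "b \<in> carrier G" using \<Gamma>G by auto
  define gen where "gen s = (if fst s then a else b, snd s)" for s :: "bool \<times> bool"
  define act where "act i s = letter G (gen s) i" for i s
  have axes: "axial (X i) (letter_line (\<sigma> i) (\<phi> i) s) (act i s) (real n * l i)" for i s
    unfolding act_def gen_def a_def b_def G_def by (rule letter_axis[OF in_G[unfolded G_def] axi n0])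
  have val_apply: "word_value G (map gen w) i x = foldr (act i) w x" if "x \<in> mspace (X i)" for w i x
  proof -
    have "fst ` set (map gen w) \<subseteq> carrier G" using ab by (auto simp: gen_def)
    then show ?thesis
      using word_value_apply[of "map gen w" X x i] that
      by (simp add: G_def act_def[abs_def] foldr_map comp_def)
  qed
  have \<sigma>0: "\<sigma> i 0 \<in> mspace (X i)" for i using line[of i] by (auto simp: geodesic_on_def)
  have free: "word_value G (map gen w) \<noteq> \<one>\<^bsub>G\<^esub>" if w: "w \<noteq> []" "reduced_word w" for w
  proof
    \<comment> \<open>Any one factor suffices: there the word moves the base point.\<close>
    fix i
    assume "word_value G (map gen w) = \<one>\<^bsub>G\<^esub>"
    then have "foldr (act i) w (\<sigma> i 0) = \<sigma> i 0"
      using val_apply[OF \<sigma>0, of w i] one_apply[of "\<sigma> i 0" X i] \<sigma>0 by (simp add: G_def)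
    then show False using ping_pong.nontrivial[OF pp axes Wn(1) w Wn(2)] by blast
  qed
  \<comment> \<open>This must precede the relabelling of words. If \<open>a = b\<close>, then two
    different labels would cancel in a word that is reduced in the labels, against
    \<open>free\<close>.\<close>
  have ne: "a \<noteq> b"
  proof
    assume "a = b"
    then have "word_value G (map gen [(True, True), (False, False)]) = \<one>\<^bsub>G\<^esub>"
      using ab by (simp add: gen_def G.word_value_Cons G.word_value_Nil letter_def)
    then show False using free[of "[(True, True), (False, False)]"] by (simp add: reduced_word_def)
  qed
  define \<Gamma>' where "\<Gamma>' = generate G {a, b}"
  have basis: "free_basis G {a, b} \<Gamma>'"
    unfolding free_basis_def
  proof (intro conjI allI impI)
    fix w :: "(('n \<Rightarrow> 'a \<Rightarrow> 'a) \<times> bool) list"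
    assume "w \<noteq> [] \<and> fst ` set w \<subseteq> {a, b} \<and> reduced_word w"
    then have w: "w \<noteq> []" "fst ` set w \<subseteq> {a, b}" "reduced_word w" by auto
    obtain v where v: "w = map gen v" "length v = length w" "reduced_word w \<longleftrightarrow> reduced_word v"
      using word_value_pair[OF ne w(2)] unfolding gen_def by blast
    then show "word_value G w \<noteq> \<one>\<^bsub>G\<^esub>" using free[of v] w by auto
  qed (use ab in \<open>auto simp: \<Gamma>'_def\<close>)
  have sub: "subgroup \<Gamma>' G" unfolding \<Gamma>'_def using ab by (intro G.generate_is_subgroup) auto
  have incl: "\<Gamma>' \<subseteq> \<Gamma>" unfolding \<Gamma>'_def using ab_\<Gamma> \<Gamma> by (intro G.generate_subgroup_incl) auto
  have nonab: "nonabelian \<Gamma>' G"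
    unfolding nonabelian_def
  proof (intro bexI)
    show "a \<otimes>\<^bsub>G\<^esub> b \<noteq> b \<otimes>\<^bsub>G\<^esub> a"
    proof
      assume comm: "a \<otimes>\<^bsub>G\<^esub> b = b \<otimes>\<^bsub>G\<^esub> a"
      \<comment> \<open>The commutator is a reduced word, so freeness forbids that it is
        trivial.\<close>
      have "word_value G (map gen [(True, True), (False, True), (True, False), (False, False)]) =
          a \<otimes>\<^bsub>G\<^esub> b \<otimes>\<^bsub>G\<^esub> (inv\<^bsub>G\<^esub> a \<otimes>\<^bsub>G\<^esub> inv\<^bsub>G\<^esub> b)"
        using ab by (simp add: gen_def G.word_value_Cons G.word_value_Nil letter_def G.m_assoc)
      also have "inv\<^bsub>G\<^esub> a \<otimes>\<^bsub>G\<^esub> inv\<^bsub>G\<^esub> b = inv\<^bsub>G\<^esub> (b \<otimes>\<^bsub>G\<^esub> a)" using ab by (simp add: G.inv_mult_group)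
      also have "a \<otimes>\<^bsub>G\<^esub> b \<otimes>\<^bsub>G\<^esub> inv\<^bsub>G\<^esub> (b \<otimes>\<^bsub>G\<^esub> a) = \<one>\<^bsub>G\<^esub>" using ab by (simp add: comm)
      finally show False
        using free[of "[(True, True), (False, True), (True, False), (False, False)]"] by (simp add: reduced_word_def)
    qed
  qed (auto simp: \<Gamma>'_def intro: generate.incl)

  \<comment> \<open>The number \<open>m\<close>, the length of the cyclically reduced word, is the
    same in all factors; this is what preserves the direction.\<close>
  have lengths: "\<exists>m::nat. 0 < m \<and> (\<forall>i. real m * (real n * l i - W) \<le> translation_length (X i) (f i) \<and>
      translation_length (X i) (f i) \<le> real m * (real n * l i + W))"
    if f: "f \<in> \<Gamma>'" "regular_axial X f" for f
  proof -
    obtain w t where w: "fst ` set w \<subseteq> {a, b}" and t: "t \<in> carrier G"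
      and fw: "f = t \<otimes>\<^bsub>G\<^esub> word_value G w \<otimes>\<^bsub>G\<^esub> inv\<^bsub>G\<^esub> t" and red: "\<And>k. reduced_word (concat (replicate k w))"
      using G.conjugate_cyclically_reduced[of "{a, b}" f] ab f(1) unfolding \<Gamma>'_def by blast
    let ?w = "word_value G w"
    have in_C: "fst ` set w \<subseteq> carrier G" using w ab by auto
    then have wG: "?w \<in> carrier G" by (rule G.word_value_closed)
    have fG: "f \<in> carrier G" using fw t wG by simp
    obtain \<rho> Kf where \<rho>: "\<And>i. contracting_axis (X i) (\<rho> i) (f i) (translation_length (X i) (f i)) (Kf i)"
      using contr[OF f(2)] by metis
    \<comment> \<open>Conjugation carries the axes of \<open>f\<close> to axes of the cyclically
      reduced word and keeps the translation lengths.\<close>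
    have axw: "axial (X i) (\<lambda>s. (inv\<^bsub>G\<^esub> t) i (\<rho> i s)) (?w i) (translation_length (X i) (f i))" for i
    proof (rule axis_conjugate[OF contracting_axis.axioms(1)[OF \<rho>]])
      fix x assume x: "x \<in> mspace (X i)"
      have "inv\<^bsub>G\<^esub> t \<otimes>\<^bsub>G\<^esub> f = ?w \<otimes>\<^bsub>G\<^esub> inv\<^bsub>G\<^esub> t"
        using t wG by (simp add: fw G.m_assoc[symmetric])
      then have "(inv\<^bsub>G\<^esub> t \<otimes>\<^bsub>G\<^esub> f) i x = (?w \<otimes>\<^bsub>G\<^esub> inv\<^bsub>G\<^esub> t) i x" by simp
      then show "?w i ((inv\<^bsub>G\<^esub> t) i x) = (inv\<^bsub>G\<^esub> t) i (f i x)"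
        using mult_apply[of "inv\<^bsub>G\<^esub> t" X f x i] mult_apply[of ?w X "inv\<^bsub>G\<^esub> t" x i] t wG fG x
        unfolding G_def[symmetric] by simp
    qed (use componentD(1,2)[of _ X] wG t in \<open>simp_all add: G_def[symmetric]\<close>)
    \<comment> \<open>The identity has no axis.\<close>
    have "w \<noteq> []"
    proof
      fix i
      interpret A: axial "X i" "\<lambda>s. (inv\<^bsub>G\<^esub> t) i (\<rho> i s)" "?w i" "translation_length (X i) (f i)"
        by (rule axw)
      assume "w = []"
      then have "?w i x = x" if "x \<in> mspace (X i)" for x
        using one_apply[of x X i] that by (simp add: G.word_value_Nil) (simp add: G_def)
      then have "mdist (X i) ((inv\<^bsub>G\<^esub> t) i (\<rho> i 0)) ((inv\<^bsub>G\<^esub> t) i (\<rho> i (0 + translation_length (X i) (f i)))) = 0"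
        using A.h_line[of 0] A.line_in by simp
      then show False using A.line_dist[of 0 "0 + translation_length (X i) (f i)"] A.l_pos by simp
    qed
    obtain v where v: "w = map gen v" "length v = length w"
      using word_value_pair[OF ne w] unfolding gen_def by blast
    have v_red: "reduced_word (concat (replicate k v))" for k
    proof -
      have "map gen (concat (replicate k v)) = concat (replicate k w)"
        by (simp add: v(1) map_concat)
      then have m: "reduced_word (map gen (concat (replicate k v)))" using red[of k] by simp
      have "reduced_word u" if "reduced_word (map gen u)" for u
        using that unfolding reduced_word_def successively_map
        by (rule successively_mono) (auto simp: gen_def split: if_splits)
      then show ?thesis using m by blast
    qed
    have v0: "v \<noteq> []" using v \<open>w \<noteq> []\<close> by auto
    have "real (length v) * (real n * l i - W) \<le> translation_length (X i) (f i) \<and>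
      translation_length (X i) (f i) \<le> real (length v) * (real n * l i + W)" for i
    proof -
      have "?w i x = foldr (act i) v x" if "x \<in> mspace (X i)" for x using val_apply[OF that, of v] v(1) by simp
      note len = ping_pong.translation_length_word[OF pp axes Wn(1) v0 v_red axw this]
      have "real (length v) * (real n * l i - W) \<le> real (length v) * (real n * l i - ping_pong.bound (K i) (\<theta> i) (E i))"
        "real (length v) * (real n * l i + ping_pong.bound (K i) (\<theta> i) (E i)) \<le> real (length v) * (real n * l i + W)"
        using W[of i] by (auto intro!: mult_left_mono)
      then show ?thesis using len by linarith
    qed
    then show ?thesis using v0 by (intro exI[of _ "length v"]) auto
  qed

  \<comment> \<open>A closed set that contains all the half-lines, hence also the limit cone; its
    nonzero elements lie in \<open>C\<close>.\<close>
  let ?D = "{v. (\<forall>i. 0 \<le> v $ i) \<and> (\<forall>i j. \<bar>v $ i * translation_vector X \<gamma> $ j - v $ j * translation_vector X \<gamma> $ i\<bar> \<le> \<delta> * v $ j)}"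
  have "limit_cone X \<Gamma>' \<subseteq> ?D"
    unfolding limit_cone_def
  proof (rule closure_minimal[OF _ closed_cone_condition], intro UN_least subsetI)
    fix f v assume "f \<in> {f \<in> \<Gamma>'. regular_axial X f}" "v \<in> {t *\<^sub>R translation_vector X f | t. 0 \<le> t}"
    then obtain t where f: "f \<in> \<Gamma>'" "regular_axial X f" and t: "0 \<le> t" "v = t *\<^sub>R translation_vector X f" by blast
    define u where "u i = translation_length (X i) (f i)" for i
    obtain m :: nat where m: "0 < m" "\<And>i. real m * (real n * l i - W) \<le> u i" "\<And>i. u i \<le> real m * (real n * l i + W)"
      using lengths[OF f] unfolding u_def by blast
    have u0: "0 \<le> u i" for i
    proof -
      have "0 \<le> real m * (real n * l i - W)" using n[of i] W_pos by (intro mult_nonneg_nonneg) auto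
      then show ?thesis using m(2)[of i] by linarith
    qed
    have ul: "\<bar>u i * l j - u j * l i\<bar> \<le> \<delta> * u j" for i j
    proof -
      have e: "\<bar>u i - real m * (real n * l i)\<bar> \<le> real m * W" for i
        using m(2,3)[of i] by (simp add: abs_le_iff algebra_simps)
      \<comment> \<open>The main terms \<open>m * n * l i * l j\<close> cancel, so only the errors
        remain.\<close>
      have "u i * l j - u j * l i = (u i - real m * (real n * l i)) * l j - (u j - real m * (real n * l j)) * l i"
        by (simp add: algebra_simps)
      then have "\<bar>u i * l j - u j * l i\<bar> \<le> \<bar>u i - real m * (real n * l i)\<bar> * l j + \<bar>u j - real m * (real n * l j)\<bar> * l i"
        using abs_triangle_ineq4[of "(u i - real m * (real n * l i)) * l j" "(u j - real m * (real n * l j)) * l i"]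
          l_pos[of i] l_pos[of j] by (simp add: abs_mult)
      also have "\<dots> \<le> real m * W * l j + real m * W * l i"
        using e l_pos by (intro add_mono mult_right_mono) (auto simp: less_imp_le)
      also have "\<dots> = real m * (W * (l i + l j))" by (simp add: algebra_simps)
      also have "\<dots> \<le> real m * (\<delta> * (real n * l j - W))" using n\<delta> by (intro mult_left_mono) auto
      also have "\<dots> = \<delta> * (real m * (real n * l j - W))" by (simp add: algebra_simps)
      also have "\<dots> \<le> \<delta> * u j" using m(2) \<delta>(1) by (intro mult_left_mono) auto
      finally show ?thesis .
    qed
    have "\<bar>t * u i * l j - t * u j * l i\<bar> \<le> \<delta> * (t * u j)" for i j
    proof -
      have "\<bar>t * u i * l j - t * u j * l i\<bar> = t * \<bar>u i * l j - u j * l i\<bar>"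
        using t(1) abs_mult[of t "u i * l j - u j * l i"] by (simp add: algebra_simps)
      also have "\<dots> \<le> t * (\<delta> * u j)" using ul t(1) by (intro mult_left_mono)
      finally show ?thesis by (simp add: mult_ac)
    qed
    then show "v \<in> ?D" using t u0 by (simp add: tv u_def l_def)
  qed
  then have "limit_cone X \<Gamma>' - {0} \<subseteq> C" using \<delta>(2) by blast
  then show ?thesis
    using incl sub basis nonab unfolding free_subgroup_def G_def[symmetric] by blast
qed

end
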